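(* Let $\beta_c=\int_0^1\sqrt{2x}\,dx=\sqrt{8/9}$, let $p=p_n$ be in the dense regime, i.e. $\sqrt{\log n/n}\ll p\ll1$, and let $\varepsilon>0$ be a constant. Then the following hold. (i) Assume further that $p\le 1/(\log n)^4$. Then there exists an online algorithm $\mathcal{A}^*$ which runs in time $O(n^3)$, such that as $n\to\infty$, $$\mathbb{P}\big[\mathcal{A}^*(G,\mathsf{G})\in\mathrm{S}_{\beta_c-\varepsilon}(G,\mathsf{G})\big]=1-o(1),$$ where $\mathbb{P}$ is over $(G,\mathsf{G})\sim\mathbf{G}(n,p)^{\otimes2}$ and the internal randomness of $\mathcal{A}^*$. (ii) There exists $c=c(\varepsilon)>0$ such that for any online algorithm $\mathcal{A}$, $$\mathbb{P}\Big[\mathbb{Q}\big[\mathcal{A}(G,\mathsf{G})\in\mathrm{S}_{\beta_c+\varepsilon}(G,\mathsf{G})\big]\ge\exp(-cn\log n)\Big]=o(1),$$ where $\mathbb{Q}$ denotes the internal randomness of $\mathcal{A}$ and the outer probability is over $(G,\mathsf{G})\sim\mathbf{G}(n,p)^{\otimes2}$.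
   Context: $\mathbf{G}(n,p)$ is the law of the Erdős–Rényi graph on $n$ labelled vertices with edge density $p$; $(G,\mathsf{G})\sim\mathbf{G}(n,p)^{\otimes2}$ means $G,\mathsf{G}$ are independent. For graphs $G,\mathsf{G}$ with $0/1$ adjacency entries $G_{i,j},\mathsf{G}_{i,j}$ and $\pi\in\mathrm{S}_n$, set $\mathrm{O}(\pi)=\sum_{1\le i<j\le n}G_{i,j}\mathsf{G}_{\pi(i),\pi(j)}$ and $\widetilde{\mathrm{O}}(\pi)=\mathrm{O}(\pi)-\binom n2p^2$. In the dense regime, with $D_{n,p}=\sqrt{n^3p^2\log n}$, let $\mathrm{S}_\beta(G,\mathsf{G})=\{\pi\in\mathrm{S}_n:\widetilde{\mathrm{O}}(\pi)\ge\beta D_{n,p}\}$. Let $\mathfrak{G}_n$ be the set of simple graphs on $n$ labelled vertices. A graph alignment algorithm is a (possibly randomized) algorithm given by a sample space $\Omega$, a deterministic function $f:\mathfrak{G}_n\times\mathfrak{G}_n\times\Omega\to\mathrm{S}_n$ and probability measures $\{\mathbb{P}_{G,\mathsf{G}}\}$ on $\Omega$; on input $(G,\mathsf{G})$ it samples the internal randomness $\omega\sim\mathbb{P}_{G,\mathsf{G}}$ and outputs $f(G,\mathsf{G},\omega)$. It is an online algorithm if it outputs a permutation $\pi^*$ according to these rules: the values $\pi^*(1),\dots,\pi^*(n)$ are determined sequentially; and for each $1\le k\le n$, once $\pi^*(1),\dots,\pi^*(k-1)$ are determined, $\pi^*(k)$ is a random variable (with internal randomness of the algorithm) taking values in $[n]\setminus\{\pi^*(1),\dots,\pi^*(k-1)\}$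 with a distribution $\mathbb{P}_k$ determined by $\{G_{i,j}\}_{1\le i<j\le k}$, $\{\mathsf{G}_{i,j}\}_{1\le i<j\le n}$ and $\pi^*(1),\dots,\pi^*(k-1)$. $f\ll g$ means $f/g\to0$ as $n\to\infty$. *)

theory Defs
  imports "HOL-Probability.Probability" "HOL-Library.Landau_Symbols"
begin

section \<open>Graphs, overlap and the set of good permutations\<close>

text \<open>A simple graph on the vertex set \<open>{1..n}\<close> is given by its set of edges.\<close>

type_synonym graph = "nat set set"

definition vertex_pairs :: "nat \<Rightarrow> nat set set" where
  "vertex_pairs n = {e. e \<subseteq> {1..n} \<and> card e = 2}"

definition simple_graphs :: "nat \<Rightarrow> graph set" where
  "simple_graphs n = Pow (vertex_pairs n)"

definition adj :: "graph \<Rightarrow> nat \<Rightarrow> nat \<Rightarrow> nat" where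
  "adj G i j = of_bool ({i, j} \<in> G)"

definition erdos_renyi :: "nat \<Rightarrow> real \<Rightarrow> graph pmf" where
  "erdos_renyi n p =
     map_pmf (\<lambda>b. {e \<in> vertex_pairs n. b e})
       (Pi_pmf (vertex_pairs n) False (\<lambda>_. bernoulli_pmf p))"

definition overlap :: "nat \<Rightarrow> graph \<Rightarrow> graph \<Rightarrow> (nat \<Rightarrow> nat) \<Rightarrow> nat" where
  "overlap n G H \<pi> = (\<Sum>j\<in>{1..n}. \<Sum>i\<in>{1..<j}. adj G i j * adj H (\<pi> i) (\<pi> j))"

definition centered_overlap ::
    "nat \<Rightarrow> real \<Rightarrow> graph \<Rightarrow> graph \<Rightarrow> (nat \<Rightarrow> nat) \<Rightarrow> real" where
  "centered_overlap n p G H \<pi> = real (overlap n G H \<pi>) - real (n choose 2) * p\<^sup>2"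

definition scale_D :: "nat \<Rightarrow> real \<Rightarrow> real" where
  "scale_D n p = sqrt (real n ^ 3 * p\<^sup>2 * ln (real n))"

definition S_set :: "nat \<Rightarrow> real \<Rightarrow> real \<Rightarrow> graph \<Rightarrow> graph \<Rightarrow> (nat \<Rightarrow> nat) set" where
  "S_set n p \<beta> G H =
     {\<pi>. \<pi> permutes {1..n} \<and> centered_overlap n p G H \<pi> \<ge> \<beta> * scale_D n p}"

definition beta_c :: real where
  "beta_c = integral {0..1} (\<lambda>x. sqrt (2 * x))"

lemma beta_c_eq: "beta_c = sqrt (8 / 9)"
proof -
  have "((\<lambda>x. sqrt (2 * x)) has_integral
          (sqrt 2 * (2/3) * 1 * sqrt 1 - sqrt 2 * (2/3) * 0 * sqrt 0)) {0..(1::real)}"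
  proof (rule fundamental_theorem_of_calculus_interior)
    show "continuous_on {0..1::real} (\<lambda>x. sqrt 2 * (2/3) * x * sqrt x)"
      by (intro continuous_intros)
    fix x :: real assume x: "x \<in> {0<..<1}"
    have "((\<lambda>x. sqrt 2 * (2/3) * x * sqrt x) has_real_derivative
            sqrt 2 * (2/3) * sqrt x + sqrt 2 * (2/3) * x * (inverse (sqrt x) / 2)) (at x)"
      using x by (auto intro!: derivative_eq_intros)
    also have "sqrt 2 * (2/3) * sqrt x + sqrt 2 * (2/3) * x * (inverse (sqrt x) / 2) =
               sqrt 2 * (2/3) * sqrt x + sqrt 2 / 3 * (x / sqrt x)"
      by (simp add: field_simps)
    also have "x / sqrt x = sqrt x"
      using x by (simp add: real_div_sqrt)
    also have "sqrt 2 * (2/3) * sqrt x + sqrt 2 / 3 * sqrt x = sqrt (2 * x)"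
      by (simp add: real_sqrt_mult)
    finally show "((\<lambda>x. sqrt 2 * (2/3) * x * sqrt x) has_vector_derivative sqrt (2 * x)) (at x)"
      by (simp add: has_real_derivative_iff_has_vector_derivative)
  qed auto
  hence "beta_c = sqrt 2 * (2/3)"
    unfolding beta_c_def by (simp add: integral_unique)
  also have "\<dots> = sqrt (8 / 9)"
    by (rule real_sqrt_unique [symmetric]) (auto simp: power_mult_distrib power_divide)
  finally show ?thesis .
qed

text \<open>
  \<open>f \<in> o(g)\<close> is used for \<open>f \<ll> g\<close> because, unlike \<open>f / g \<longlonglongrightarrow> 0\<close>
  with \<open>x / 0 = 0\<close>, it excludes \<open>p n = 0\<close> for infinitely many \<open>n\<close>.
\<close>

definition dense_regime :: "(nat \<Rightarrow> real) \<Rightarrow> bool" where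
  "dense_regime p \<longleftrightarrow>
     (\<forall>n. 0 \<le> p n \<and> p n \<le> 1) \<and>
     (\<lambda>n. sqrt (ln (real n) / real n)) \<in> o(p) \<and> p \<in> o(\<lambda>_. 1)"


section \<open>Graph alignment algorithms and online algorithms\<close>

text \<open>
  A (randomized) graph alignment algorithm on \<open>n\<close> vertices, with output \<open>f G H \<omega>\<close> for
  internal randomness \<open>\<omega>\<close> sampled from a probability measure that may depend on \<open>G\<close> and \<open>H\<close>,
  is represented by the law of its output on each input, i.e. by a function into the probability
  mass functions on permutations. This is no restriction on the sample space:
\<close>

lemma alignment_law_exists:
  fixes M :: "'w measure" and f :: "'w \<Rightarrow> nat \<Rightarrow> nat"
  assumes "prob_space M" "f \<in> measurable M (count_space UNIV)"
    and "\<And>\<omega>. \<omega> \<in> space M \<Longrightarrow> f \<omega> permutes {1..n}"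
  shows "\<exists>q. measure_pmf q = distr M (count_space UNIV) f \<and> set_pmf q \<subseteq> {\<pi>. \<pi> permutes {1..n}}"
proof -
  interpret prob_space M by fact
  define N where "N = distr M (count_space UNIV) f"
  have N: "prob_space N"
    unfolding N_def by (rule prob_space_distr) fact
  interpret N: prob_space N by fact
  have sets_N [simp]: "sets N = UNIV"
    by (simp add: N_def)
  have space_N [simp]: "space N = UNIV"
    by (simp add: N_def)
  let ?S = "{\<pi>. \<pi> permutes {1..n}}"
  have fin: "finite ?S"
    by (simp add: finite_permutations)
  have AE_S: "AE \<pi> in N. \<pi> \<in> ?S"
    unfolding N_def using assms(2,3) by (subst AE_distr_iff) auto
  have "AE x in N. measure N {x} \<noteq> 0"
    using AE_S by (subst N.AE_support_countable) (auto intro!: exI[of _ ?S] countable_finite fin)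
  then obtain q where q: "measure_pmf q = N"
    using N sets_N by (metis (mono_tags, lifting) Abs_pmf_inverse mem_Collect_eq)
  moreover have "set_pmf q \<subseteq> ?S"
    using AE_S unfolding q [symmetric] by (auto simp: AE_measure_pmf_iff)
  ultimately show ?thesis
    unfolding N_def by blast
qed

text \<open>
  \<open>P k G H [\<pi>(1), \<dots>, \<pi>(k-1)]\<close> is the distribution from which \<open>\<pi>(k)\<close> is drawn.
\<close>

type_synonym online_rule = "nat \<Rightarrow> graph \<Rightarrow> graph \<Rightarrow> nat list \<Rightarrow> nat pmf"

definition valid_online_rule :: "nat \<Rightarrow> online_rule \<Rightarrow> bool" where
  "valid_online_rule n P \<longleftrightarrow>
     (\<forall>k\<in>{1..n}. \<forall>H\<in>simple_graphs n. \<forall>xs.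
        length xs = k - 1 \<and> distinct xs \<and> set xs \<subseteq> {1..n} \<longrightarrow>
        (\<forall>G\<in>simple_graphs n. set_pmf (P k G H xs) \<subseteq> {1..n} - set xs) \<and>
        (\<forall>G\<in>simple_graphs n. \<forall>G'\<in>simple_graphs n.
           (\<forall>i j. 1 \<le> i \<and> i < j \<and> j \<le> k \<longrightarrow> adj G i j = adj G' i j) \<longrightarrow>
           P k G H xs = P k G' H xs))"

primrec online_values :: "online_rule \<Rightarrow> graph \<Rightarrow> graph \<Rightarrow> nat \<Rightarrow> nat list pmf" where
  "online_values P G H 0 = return_pmf []"
| "online_values P G H (Suc k) =
     bind_pmf (online_values P G H k) (\<lambda>xs.
       map_pmf (\<lambda>v. xs @ [v]) (P (Suc k) G H xs))"

definition perm_of_list :: "nat list \<Rightarrow> nat \<Rightarrow> nat" where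
  "perm_of_list xs i = (if i \<in> {1..length xs} then xs ! (i - 1) else i)"

type_synonym alignment_algorithm = "graph \<Rightarrow> graph \<Rightarrow> (nat \<Rightarrow> nat) pmf"

definition online_algorithm :: "nat \<Rightarrow> alignment_algorithm \<Rightarrow> bool" where
  "online_algorithm n A \<longleftrightarrow>
     (\<exists>P. valid_online_rule n P \<and>
        (\<forall>G\<in>simple_graphs n. \<forall>H\<in>simple_graphs n.
           A G H = map_pmf perm_of_list (online_values P G H n)))"


section \<open>Running time\<close>

text \<open>
  Time is the number of instructions executed by a randomized word RAM. On inputs with \<open>n\<close>
  vertices, words are the numbers below \<open>W = (n + 2) ^ K\<close> with \<open>K\<close> a constant of the machine,
  i.e. a word has \<open>O(log n)\<close> bits; arithmetic is modulo \<open>W\<close>, except that subtraction is truncated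
  at 0 and division by 0 yields 0. Registers are directly addressed, memory only through registers.
  \<open>Rand d a\<close> draws a uniform random number between 0 and the content of register \<open>a\<close>.
\<close>

datatype instr =
    Const nat nat
  | Add nat nat nat
  | Sub nat nat nat
  | Mul nat nat nat
  | Div nat nat nat
  | Load nat nat
  | Store nat nat
  | Rand nat nat
  | JumpZero nat nat

record ram_state =
  pc :: nat
  reg :: "nat \<Rightarrow> nat"
  mem :: "nat \<Rightarrow> nat"

definition set_reg :: "nat \<Rightarrow> nat \<Rightarrow> ram_state \<Rightarrow> ram_state" where
  "set_reg d v s = s\<lparr>pc := Suc (pc s), reg := (reg s)(d := v)\<rparr>"

primrec exec_instr :: "nat \<Rightarrow> instr \<Rightarrow> ram_state \<Rightarrow> ram_state pmf" where
  "exec_instr W (Const d c) s = return_pmf (set_reg d (c mod W) s)"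
| "exec_instr W (Add d a b) s = return_pmf (set_reg d ((reg s a + reg s b) mod W) s)"
| "exec_instr W (Sub d a b) s = return_pmf (set_reg d (reg s a - reg s b) s)"
| "exec_instr W (Mul d a b) s = return_pmf (set_reg d ((reg s a * reg s b) mod W) s)"
| "exec_instr W (Div d a b) s = return_pmf (set_reg d (reg s a div reg s b) s)"
| "exec_instr W (Load d a) s = return_pmf (set_reg d (mem s (reg s a)) s)"
| "exec_instr W (Store a b) s =
     return_pmf (s\<lparr>pc := Suc (pc s), mem := (mem s)(reg s a := reg s b)\<rparr>)"
| "exec_instr W (Rand d a) s = map_pmf (\<lambda>v. set_reg d v s) (pmf_of_set {0..reg s a})"
| "exec_instr W (JumpZero a t) s =
     return_pmf (s\<lparr>pc := (if reg s a = 0 then t else Suc (pc s))\<rparr>)"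

definition halted :: "instr list \<Rightarrow> ram_state \<Rightarrow> bool" where
  "halted prog s \<longleftrightarrow> length prog \<le> pc s"

definition ram_step :: "nat \<Rightarrow> instr list \<Rightarrow> ram_state \<Rightarrow> ram_state pmf" where
  "ram_step W prog s = (if halted prog s then return_pmf s else exec_instr W (prog ! pc s) s)"

primrec ram_run :: "nat \<Rightarrow> instr list \<Rightarrow> nat \<Rightarrow> ram_state \<Rightarrow> ram_state pmf" where
  "ram_run W prog 0 s = return_pmf s"
| "ram_run W prog (Suc t) s = bind_pmf (ram_step W prog s) (ram_run W prog t)"

text \<open>
  Register 0 initially contains \<open>n\<close>; memory contains the two adjacency matrices, row by row,
  and zeros afterwards. The output values \<open>\<pi>(1), \<dots>, \<pi>(n)\<close> are read off the next \<open>n\<close> cells.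
\<close>

definition ram_input :: "nat \<Rightarrow> graph \<Rightarrow> graph \<Rightarrow> ram_state" where
  "ram_input n G H =
     \<lparr>pc = 0,
      reg = (\<lambda>_. 0)(0 := n),
      mem = (\<lambda>a. if a < n * n then adj G (a div n + 1) (a mod n + 1)
                 else if a < 2 * n * n then adj H ((a - n * n) div n + 1) ((a - n * n) mod n + 1)
                 else 0)\<rparr>"

definition ram_output :: "nat \<Rightarrow> ram_state \<Rightarrow> nat \<Rightarrow> nat" where
  "ram_output n s i = (if i \<in> {1..n} then mem s (2 * n * n + (i - 1)) else i)"

text \<open>
  A single program handles all \<open>n\<close>, and the time bound is for the worst case over the input graphs
  and the internal randomness.
\<close>

definition runs_in_time :: "(nat \<Rightarrow> alignment_algorithm) \<Rightarrow> (nat \<Rightarrow> nat) \<Rightarrow> bool" where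
  "runs_in_time A T \<longleftrightarrow>
     (\<exists>prog K. K > 0 \<and>
        (\<forall>n. \<forall>G\<in>simple_graphs n. \<forall>H\<in>simple_graphs n.
           let final = ram_run ((n + 2) ^ K) prog (T n) (ram_input n G H) in
             (\<forall>s\<in>set_pmf final. halted prog s) \<and> map_pmf (ram_output n) final = A n G H))"


section \<open>Joint law of input and output\<close>

definition input_law :: "nat \<Rightarrow> real \<Rightarrow> (graph \<times> graph) pmf" where
  "input_law n p = pair_pmf (erdos_renyi n p) (erdos_renyi n p)"

definition joint_law ::
    "nat \<Rightarrow> real \<Rightarrow> alignment_algorithm \<Rightarrow> (graph \<times> graph \<times> (nat \<Rightarrow> nat)) pmf" where
  "joint_law n p A =
     bind_pmf (input_law n p) (\<lambda>(G, H). map_pmf (\<lambda>\<pi>. (G, H, \<pi>)) (A G H))"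

end

theory Submission
  imports Defs
begin

text \<open>
  Reveal the graph \<open>G\<close> column by column, and keep \<open>H\<close> fixed. When \<open>\<pi>(k)\<close> is chosen, column \<open>k\<close> of \<open>G\<close>
  is a fresh random set \<open>C\<close>, and choosing \<open>v\<close> adds \<open>X v = card (C \<inter> N v)\<close> to the overlap, where \<open>N v\<close> is
  the set of earlier indices whose images are adjacent to \<open>v\<close> in \<open>H\<close>. The sizes of the sets \<open>N v\<close> are
  controlled by the edge counts of \<open>H\<close>, up to an error \<open>2 n sqrt (n p)\<close> that survives a union bound
  over all vertex subsets. As \<open>X v - p (card (N v))\<close> has standard deviation about \<open>p sqrt k\<close> and there are at most
  \<open>n\<close> candidates, its maximum is about \<open>p sqrt (2 k ln n)\<close>; the sum over \<open>k\<close> is \<open>\<beta>\<^sub>c D\<close>.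

  For the upper bound, the product over all steps of the exponential moments of the gains has
  expectation at most \<open>2 ^ n\<close>, whatever the online algorithm does. For the lower bound, the greedy
  algorithm picks the \<open>v\<close> with the largest \<open>X v\<close>; a truncated and exponentially weighted second moment
  argument shows that this maximum is almost reached with high probability, and Markov's inequality
  controls the total loss.
\<close>


section \<open>Random subsets\<close>

text \<open>The obstacle is that the sizes of the sets \<open>N v\<close> depend on the earlier
  choices, so that a clever rule might look for vertices with many matched neighbours. Only
  aggregate counts of \<open>H\<close> are available. Above the threshold, the sizes met in the
  first m steps add up to the number of edges of \<open>H\<close> inside the m used vertices, and
  summation by parts handles weights that decrease in k. Below it, the edges between used and free
  vertices force at least half of the free vertices to have nearly typical size. The tilt that suits
  step k is about sqrt (2 ln n / k) / p, which varies with k and is too large for small k; hence k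
  is shifted by \<open>\<delta>\<close> n above the threshold, and steps near both ends are given up
  below it. An excess of s D costs about exp (- s n ln n), because the common exponent sqrt (ln n /
  n) / p times D is n ln n, and this beats the factor 2 ^ n. In part (i) the assumption on p gives p
  ln n -> 0, which makes the correlations between different candidates negligible.\<close>

definition random_subset :: "'a set \<Rightarrow> real \<Rightarrow> 'a set pmf" where
  "random_subset A p = map_pmf (\<lambda>b. {x \<in> A. b x}) (Pi_pmf A False (\<lambda>_. bernoulli_pmf p))"

lemma erdos_renyi_random_subset: "erdos_renyi n p = random_subset (vertex_pairs n) p"
  by (simp add: erdos_renyi_def random_subset_def)

lemma set_random_subset: "set_pmf (random_subset A p) \<subseteq> Pow A"
  by (auto simp: random_subset_def)

lemma random_subset_subset: "C \<in> set_pmf (random_subset A p) \<Longrightarrow> C \<subseteq> A"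
  using set_random_subset[of A p] by auto

lemma finite_set_random_subset [simp]: "finite A \<Longrightarrow> finite (set_pmf (random_subset A p))"
  by (rule finite_subset[OF set_random_subset]) simp

lemma random_subset_empty [simp]: "random_subset {} p = return_pmf {}"
  by (simp add: random_subset_def)

lemma random_subset_insert:
  assumes "finite A" "x \<notin> A"
  shows "random_subset (insert x A) p =
    bind_pmf (bernoulli_pmf p) (\<lambda>b. map_pmf (\<lambda>C. if b then insert x C else C) (random_subset A p))"
proof -
  have "random_subset (insert x A) p =
     bind_pmf (bernoulli_pmf p) (\<lambda>b. map_pmf (\<lambda>f. {y \<in> insert x A. (f(x := b)) y})
       (Pi_pmf A False (\<lambda>_. bernoulli_pmf p)))"
    using assms by (simp add: random_subset_def Pi_pmf_insert' map_bind_pmf map_pmf_comp bind_return_pmf map_pmf_def[symmetric])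
  also have "\<dots> = bind_pmf (bernoulli_pmf p) (\<lambda>b. map_pmf (\<lambda>C. if b then insert x C else C) (random_subset A p))"
  proof (intro bind_pmf_cong refl)
    fix b
    show "map_pmf (\<lambda>f. {y \<in> insert x A. (f(x := b)) y}) (Pi_pmf A False (\<lambda>_. bernoulli_pmf p)) =
      map_pmf (\<lambda>C. if b then insert x C else C) (random_subset A p)"
      unfolding random_subset_def map_pmf_comp
      using assms by (intro map_pmf_cong refl) auto
  qed
  finally show ?thesis .
qed

lemma expectation_random_subset_insert:
  fixes g :: "'a set \<Rightarrow> real"
  assumes "finite A" "x \<notin> A" "0 \<le> p" "p \<le> 1"
  shows "measure_pmf.expectation (random_subset (insert x A) p) g =
    p * measure_pmf.expectation (random_subset A p) (\<lambda>C. g (insert x C)) +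
    (1 - p) * measure_pmf.expectation (random_subset A p) g"
proof -
  have "measure_pmf.expectation (random_subset (insert x A) p) g =
    (\<Sum>b\<in>UNIV. pmf (bernoulli_pmf p) b *\<^sub>R measure_pmf.expectation
      (map_pmf (\<lambda>C. if b then insert x C else C) (random_subset A p)) g)"
    unfolding random_subset_insert[OF assms(1,2)]
    by (rule pmf_expectation_bind) (use assms in simp_all)
  then show ?thesis using assms(3,4) by (simp add: UNIV_bool)
qed

text \<open>Disjoint blocks are independent: this splits off the column of a new vertex of
  \<open>G\<close>, and the two stars at a pair of vertices of \<open>H\<close>.\<close>

lemma random_subset_Un:
  assumes "finite A" "finite B" "A \<inter> B = {}"
  shows "random_subset (A \<union> B) p =
    map_pmf (\<lambda>(C, D). C \<union> D) (pair_pmf (random_subset A p) (random_subset B p))"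
  using assms
proof (induction A rule: finite_induct)
  case empty
  then show ?case by (simp add: pair_return_pmf1 map_pmf_comp)
next
  case (insert x A)
  have "random_subset (insert x A \<union> B) p =
    bind_pmf (bernoulli_pmf p) (\<lambda>b. map_pmf (\<lambda>C. if b then insert x C else C) (random_subset (A \<union> B) p))"
    using insert by (simp add: random_subset_insert)
  also have "\<dots> = map_pmf (\<lambda>(C, D). C \<union> D) (pair_pmf (random_subset (insert x A) p) (random_subset B p))"
    using insert
    by (simp add: random_subset_insert map_pmf_comp pair_pmf_def map_bind_pmf bind_assoc_pmf bind_map_pmf
        bind_return_pmf map_pmf_def[symmetric])
      (auto simp: map_pmf_def bind_assoc_pmf bind_return_pmf intro!: bind_pmf_cong)
  finally show ?case .
qed

lemma random_subset_image:
  assumes "finite A" "inj_on f A"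
  shows "random_subset (f ` A) p = map_pmf ((`) f) (random_subset A p)"
  using assms
proof (induction A rule: finite_induct)
  case (insert x A)
  then have "f x \<notin> f ` A" by auto
  with insert show ?case
    by (auto simp: random_subset_insert map_bind_pmf map_pmf_comp intro!: bind_pmf_cong map_pmf_cong)
qed auto

lemma random_subset_Int:
  assumes "finite A" "B \<subseteq> A"
  shows "map_pmf (\<lambda>C. C \<inter> B) (random_subset A p) = random_subset B p"
proof -
  have fin: "finite B" using assms finite_subset by blast
  have "map_pmf (\<lambda>C. C \<inter> B) (random_subset (B \<union> (A - B)) p) =
      map_pmf (\<lambda>(C, D). (C \<union> D) \<inter> B) (pair_pmf (random_subset B p) (random_subset (A - B) p))"
    using assms fin by (subst random_subset_Un) (auto simp: map_pmf_comp case_prod_unfold)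
  also have "\<dots> = map_pmf fst (pair_pmf (random_subset B p) (random_subset (A - B) p))"
  proof (intro map_pmf_cong refl)
    fix x assume "x \<in> set_pmf (pair_pmf (random_subset B p) (random_subset (A - B) p))"
    then have "fst x \<subseteq> B" "snd x \<subseteq> A - B"
      using random_subset_subset[of "fst x" B p] random_subset_subset[of "snd x" "A - B" p]
      by (auto simp del: subset_Diff_insert)
    then show "(case x of (C, D) \<Rightarrow> (C \<union> D) \<inter> B) = fst x" by (auto simp: case_prod_unfold)
  qed
  finally show ?thesis using assms by (simp add: map_fst_pair_pmf Un_absorb1)
qed

section \<open>Moments and exponential tilting of random subsets\<close>

context
  fixes p :: real
  assumes p: "0 \<le> p" "p \<le> 1"
begin

text \<open>Independence: an element contributes the factor \<open>f x\<close> if present and 1 if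
  absent. Constant \<open>f\<close> gives the exponential moment of the size; an \<open>f\<close>
  depending on membership in two sets gives joint moments.\<close>

lemma expectation_random_subset_prod:
  fixes f :: "'a \<Rightarrow> real"
  assumes "finite A"
  shows "measure_pmf.expectation (random_subset A p) (\<lambda>C. \<Prod>x\<in>C. f x) = (\<Prod>x\<in>A. 1 - p + p * f x)"
  using assms
proof (induction A rule: finite_induct)
  case (insert x A)
  have "measure_pmf.expectation (random_subset A p) (\<lambda>C. prod f (insert x C))
     = measure_pmf.expectation (random_subset A p) (\<lambda>C. f x * prod f C)"
  proof (intro integral_cong_AE AE_pmfI)
    fix C assume "C \<in> set_pmf (random_subset A p)"
    then have "C \<subseteq> A" by (rule random_subset_subset)
    then have "x \<notin> C" "finite C" using insert finite_subset by auto
    then show "prod f (insert x C) = f x * prod f C" by simp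
  qed auto
  with insert p show ?case
    by (simp add: expectation_random_subset_insert algebra_simps)
qed simp

lemma expectation_random_subset_exp_card:
  assumes "finite A" "B \<subseteq> A"
  shows "measure_pmf.expectation (random_subset A p) (\<lambda>C. exp (t * real (card (C \<inter> B)))) =
    (1 - p + p * exp t) ^ card B"
proof -
  have fin: "finite B" using assms finite_subset by blast
  have "measure_pmf.expectation (random_subset A p) (\<lambda>C. exp (t * real (card (C \<inter> B)))) =
     measure_pmf.expectation (map_pmf (\<lambda>C. C \<inter> B) (random_subset A p)) (\<lambda>C. exp (t * real (card C)))"
    by simp
  also have "\<dots> = measure_pmf.expectation (random_subset B p) (\<lambda>C. \<Prod>x\<in>C. exp t)"
    unfolding random_subset_Int[OF assms] by (simp add: exp_of_nat_mult mult.commute[of t])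
  also have "\<dots> = (1 - p + p * exp t) ^ card B"
    by (subst expectation_random_subset_prod[OF fin]) simp
  finally show ?thesis .
qed

lemma expectation_random_subset_exp_card_le:
  assumes "finite A" "B \<subseteq> A"
  shows "measure_pmf.expectation (random_subset A p) (\<lambda>C. exp (t * real (card (C \<inter> B)))) \<le>
    exp (real (card B) * p * (exp t - 1))"
proof -
  have "(1 - p + p * exp t) ^ card B \<le> exp (p * (exp t - 1)) ^ card B"
  proof (rule power_mono)
    show "1 - p + p * exp t \<le> exp (p * (exp t - 1))"
      using exp_ge_add_one_self[of "p * (exp t - 1)"] by (simp add: algebra_simps)
    show "0 \<le> 1 - p + p * exp t"
      using p by (intro add_nonneg_nonneg) auto
  qed
  also have "\<dots> = exp (real (card B) * p * (exp t - 1))"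
    by (simp add: exp_of_nat_mult mult.assoc)
  finally show ?thesis using assms by (simp add: expectation_random_subset_exp_card)
qed

lemma expectation_random_subset_card:
  assumes "finite A"
  shows "measure_pmf.expectation (random_subset A p) (\<lambda>C. real (card C)) = real (card A) * p"
  using assms
proof (induction A rule: finite_induct)
  case (insert x A)
  have "measure_pmf.expectation (random_subset A p) (\<lambda>C. real (card (insert x C)))
     = measure_pmf.expectation (random_subset A p) (\<lambda>C. 1 + real (card C))"
  proof (intro integral_cong_AE AE_pmfI)
    fix C assume "C \<in> set_pmf (random_subset A p)"
    then have "C \<subseteq> A" by (rule random_subset_subset)
    then have "x \<notin> C" "finite C" using insert finite_subset by auto
    then show "real (card (insert x C)) = 1 + real (card C)" by simp
  qed auto
  also have "\<dots> = 1 + real (card A) * p"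
    using insert by (subst Bochner_Integration.integral_add) (auto intro!: integrable_measure_pmf_finite)
  finally show ?case using insert p
    by (simp add: expectation_random_subset_insert algebra_simps)
qed simp

lemma variance_random_subset_card:
  assumes "finite A"
  shows "measure_pmf.expectation (random_subset A p) (\<lambda>C. (real (card C) - real (card A) * p)\<^sup>2) =
     real (card A) * p * (1 - p)"
  using assms
proof (induction A rule: finite_induct)
  case (insert x A)
  let ?E = "measure_pmf.expectation (random_subset A p)"
  have fin: "integrable (random_subset A p) f" for f :: "'a set \<Rightarrow> real"
    using insert by (auto intro!: integrable_measure_pmf_finite)
  \<comment> \<open>Inserting an element moves the centre by \<open>1 - p\<close> or by
    \<open>- p\<close>, so the induction needs the second moment around a shifted mean.\<close>
  have sh: "?E (\<lambda>C. (real (card C) - real (card A) * p + c)\<^sup>2) = real (card A) * p * (1 - p) + c\<^sup>2" for c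
  proof -
    have "?E (\<lambda>C. (real (card C) - real (card A) * p + c)\<^sup>2) =
       ?E (\<lambda>C. (real (card C) - real (card A) * p)\<^sup>2 + (2 * c * real (card C) + (c\<^sup>2 - 2 * c * real (card A) * p)))"
      by (intro integral_cong_AE AE_pmfI) (auto simp: power2_eq_square algebra_simps)
    also have "\<dots> = ?E (\<lambda>C. (real (card C) - real (card A) * p)\<^sup>2) + (?E (\<lambda>C. 2 * c * real (card C)) + (c\<^sup>2 - 2 * c * real (card A) * p))"
      using fin by (subst Bochner_Integration.integral_add, simp, simp)+ simp
    finally show ?thesis using insert expectation_random_subset_card[of A] by simp
  qed
  have "?E (\<lambda>C. (real (card (insert x C)) - real (card (insert x A)) * p)\<^sup>2)
     = ?E (\<lambda>C. (real (card C) - real (card A) * p + (1 - p))\<^sup>2)"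
  proof (intro integral_cong_AE AE_pmfI)
    fix C assume "C \<in> set_pmf (random_subset A p)"
    then have "C \<subseteq> A" by (rule random_subset_subset)
    then have "x \<notin> C" "finite C" using insert finite_subset by auto
    then show "(real (card (insert x C)) - real (card (insert x A)) * p)\<^sup>2 = (real (card C) - real (card A) * p + (1 - p))\<^sup>2"
      using insert by (simp add: algebra_simps)
  qed auto
  moreover have "?E (\<lambda>C. (real (card C) - real (card (insert x A)) * p)\<^sup>2)
     = ?E (\<lambda>C. (real (card C) - real (card A) * p + (- p))\<^sup>2)"
    using insert by (simp add: algebra_simps)
  ultimately have "measure_pmf.expectation (random_subset (insert x A) p)
      (\<lambda>C. (real (card C) - real (card (insert x A)) * p)\<^sup>2) =
      p * (real (card A) * p * (1 - p) + (1 - p)\<^sup>2) + (1 - p) * (real (card A) * p * (1 - p) + (- p)\<^sup>2)"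
    unfolding expectation_random_subset_insert[OF insert(1,2) p] sh by simp
  also have "\<dots> = real (card (insert x A)) * p * (1 - p)"
    using insert by (simp add: power2_eq_square algebra_simps)
  finally show ?case .
qed simp

text \<open>Weighting by an exponential of the size gives, up to normalisation, another random
  subset: per element, the normaliser times \<open>q\<close> is \<open>p * exp t\<close>, and times
  \<open>1 - q\<close> it is \<open>1 - p\<close>.\<close>

lemma expectation_random_subset_tilt:
  fixes g :: "'a set \<Rightarrow> real"
    and t :: real
  assumes "finite A"
  defines "q \<equiv> p * exp t / (1 - p + p * exp t)"
  shows "measure_pmf.expectation (random_subset A p) (\<lambda>C. exp (t * real (card C)) * g C) =
     (1 - p + p * exp t) ^ card A * measure_pmf.expectation (random_subset A q) g"
  using assms(1)
proof (induction A arbitrary: g rule: finite_induct)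
  case (insert x A)
  let ?E = "measure_pmf.expectation (random_subset A p)"
  let ?E' = "measure_pmf.expectation (random_subset A q)"
  let ?z = "1 - p + p * exp t"
  have z: "?z > 0"
  proof (cases "p = 1")
    case False with p show ?thesis by (intro add_pos_nonneg) auto
  qed simp
  have q: "0 \<le> q" using z p unfolding q_def by simp
  have "p * exp t \<le> ?z" using p by simp
  then have q1: "q \<le> 1" using z unfolding q_def by (simp only: divide_le_eq_1 simp_thms)
  have zq1: "?z * q = p * exp t"
    using z unfolding q_def by simp
  have zq2: "?z * (1 - q) = 1 - p"
    unfolding right_diff_distrib zq1 by simp
  have "?E (\<lambda>C. exp (t * real (card (insert x C))) * g (insert x C))
     = ?E (\<lambda>C. exp t * (exp (t * real (card C)) * g (insert x C)))"
  proof (intro integral_cong_AE AE_pmfI)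
    fix C assume "C \<in> set_pmf (random_subset A p)"
    then have "C \<subseteq> A" by (rule random_subset_subset)
    then have "x \<notin> C" "finite C" using insert finite_subset by auto
    then show "exp (t * real (card (insert x C))) * g (insert x C) = exp t * (exp (t * real (card C)) * g (insert x C))"
      by (simp add: algebra_simps exp_add)
  qed auto
  also have "\<dots> = exp t * (?z ^ card A * ?E' (\<lambda>C. g (insert x C)))"
    using insert.IH[of "\<lambda>C. g (insert x C)"] by simp
  finally have "measure_pmf.expectation (random_subset (insert x A) p) (\<lambda>C. exp (t * real (card C)) * g C)
    = ?z ^ card A * ((p * exp t) * ?E' (\<lambda>C. g (insert x C)) + (1 - p) * ?E' g)"
    using insert p by (simp add: expectation_random_subset_insert algebra_simps)
  also have "\<dots> = ?z ^ card A * ((?z * q) * ?E' (\<lambda>C. g (insert x C)) + (?z * (1 - q)) * ?E' g)"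
    by (simp only: zq1 zq2)
  also have "\<dots> = ?z ^ card (insert x A) * (q * ?E' (\<lambda>C. g (insert x C)) + (1 - q) * ?E' g)"
  proof -
    have "z ^ k * ((z * a) * x + (z * b) * y) = (z * z ^ k) * (a * x + b * y)"
      for z a b x y :: real and k by (simp add: algebra_simps)
    then show ?thesis unfolding card_insert_disjoint[OF insert(1,2)] power_Suc .
  qed
  finally show ?case by (simp only: expectation_random_subset_insert[OF insert(1,2) q q1])
qed simp

end


section \<open>The Markov chain of partial matchings\<close>

text \<open>Steps are counted from 0: step \<open>k\<close> decides the image of the vertex
  \<open>Suc k\<close>, whose edges to \<open>{1..k}\<close> form the column that is still random at
  that time.\<close>

definition new_edges :: "nat \<Rightarrow> nat set \<Rightarrow> graph" where
  "new_edges k C = (\<lambda>i. {i, Suc k}) ` C"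

definition new_nbrs :: "graph \<Rightarrow> nat \<Rightarrow> nat set" where
  "new_nbrs G k = {i \<in> {1..k}. {i, Suc k} \<in> G}"

text \<open>Positions in \<open>xs\<close> rather than vertices of \<open>H\<close>, so that the set
  lies in the same index range as the column of \<open>G\<close> with which it is
  intersected.\<close>

definition back_nbrs :: "graph \<Rightarrow> nat list \<Rightarrow> nat \<Rightarrow> nat set" where
  "back_nbrs H xs v = {i \<in> {1..length xs}. {xs ! (i - 1), v} \<in> H}"

definition score :: "graph \<Rightarrow> graph \<Rightarrow> nat list \<Rightarrow> nat \<Rightarrow> nat" where
  "score G H xs v = card (new_nbrs G (length xs) \<inter> back_nbrs H xs v)"

text \<open>\<open>G\<close> is sampled only on its first \<open>k\<close> vertices, so that the
  next column is still unrevealed, while \<open>H\<close> is a fixed graph.\<close>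

definition partial_run :: "online_rule \<Rightarrow> graph \<Rightarrow> real \<Rightarrow> nat \<Rightarrow> (graph \<times> nat list) pmf" where
  "partial_run P H p k = bind_pmf (erdos_renyi k p) (\<lambda>G. map_pmf (Pair G) (online_values P G H k))"

section \<open>Vertex pairs, columns and valid rules\<close>

lemma finite_vertex_pairs [simp]: "finite (vertex_pairs n)"
  unfolding vertex_pairs_def by simp

lemma vertex_pairs_mono: "k \<le> n \<Longrightarrow> vertex_pairs k \<subseteq> vertex_pairs n"
  by (force simp: vertex_pairs_def)

lemma simple_graphs_mono: "k \<le> n \<Longrightarrow> simple_graphs k \<subseteq> simple_graphs n"
  using vertex_pairs_mono by (auto simp: simple_graphs_def)

lemma set_erdos_renyi: "set_pmf (erdos_renyi n p) \<subseteq> simple_graphs n"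
  by (simp add: erdos_renyi_random_subset simple_graphs_def set_random_subset)

lemma inj_on_new_edge: "inj_on (\<lambda>i. {i, Suc k}) {1..k}"
  by (auto simp: inj_on_def doubleton_eq_iff)

lemma vertex_pairs_Suc:
  "vertex_pairs (Suc k) = vertex_pairs k \<union> new_edges k {1..k}"
  "vertex_pairs k \<inter> new_edges k {1..k} = {}"
proof -
  show "vertex_pairs k \<inter> new_edges k {1..k} = {}"
    by (auto simp: vertex_pairs_def new_edges_def)
  show "vertex_pairs (Suc k) = vertex_pairs k \<union> new_edges k {1..k}"
  proof (intro equalityI subsetI)
    fix e assume e: "e \<in> vertex_pairs (Suc k)"
    then obtain x y where xy: "e = {x, y}" "x \<noteq> y" by (auto simp: vertex_pairs_def card_2_iff)
    show "e \<in> vertex_pairs k \<union> new_edges k {1..k}"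
    proof (cases "Suc k \<in> e")
      case True
      then obtain z where "e = {z, Suc k}" "z \<noteq> Suc k" using xy by auto
      then show ?thesis using e by (auto simp: vertex_pairs_def new_edges_def)
    next
      case False
      with e show ?thesis by (auto simp: vertex_pairs_def le_Suc_eq subset_iff)
    qed
  next
    fix e assume "e \<in> vertex_pairs k \<union> new_edges k {1..k}"
    then show "e \<in> vertex_pairs (Suc k)"
      by (force simp: vertex_pairs_def new_edges_def)
  qed
qed

lemma erdos_renyi_Suc:
  "erdos_renyi (Suc k) p =
     map_pmf (\<lambda>(G, C). G \<union> new_edges k C) (pair_pmf (erdos_renyi k p) (random_subset {1..k} p))"
proof -
  have "random_subset (new_edges k {1..k}) p = map_pmf (new_edges k) (random_subset {1..k} p)"
    using random_subset_image[OF _ inj_on_new_edge, of k p] by (simp add: new_edges_def[abs_def])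
  moreover have "finite (new_edges k {1..k})" by (simp add: new_edges_def)
  ultimately show ?thesis
    unfolding erdos_renyi_random_subset vertex_pairs_Suc(1)
    by (subst random_subset_Un[OF _ _ vertex_pairs_Suc(2)])
      (simp_all add: pair_map_pmf2 map_pmf_comp case_prod_unfold)
qed

lemma adj_union_new_edges: "j \<le> k \<Longrightarrow> i < j \<Longrightarrow> adj (G \<union> new_edges k C) i j = adj G i j"
  by (auto simp: adj_def new_edges_def doubleton_eq_iff)

lemma new_nbrs_union_old: "j < k \<Longrightarrow> new_nbrs (G \<union> new_edges k C) j = new_nbrs G j"
  by (auto simp: new_nbrs_def new_edges_def doubleton_eq_iff)

lemma new_nbrs_union_new:
  assumes "G \<in> simple_graphs k" "C \<subseteq> {1..k}"
  shows "new_nbrs (G \<union> new_edges k C) k = C"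
  using assms by (auto simp: new_nbrs_def new_edges_def doubleton_eq_iff simple_graphs_def vertex_pairs_def)

lemma union_new_edges_simple:
  assumes "G \<in> simple_graphs k" "C \<subseteq> {1..k}"
  shows "G \<union> new_edges k C \<in> simple_graphs (Suc k)"
  using assms vertex_pairs_Suc(1)[of k] by (auto simp: simple_graphs_def new_edges_def)

definition partial_inj :: "nat \<Rightarrow> nat \<Rightarrow> nat list set" where
  "partial_inj n k = {xs. length xs = k \<and> distinct xs \<and> set xs \<subseteq> {1..n}}"

lemma valid_online_ruleD:
  assumes "valid_online_rule n P" "k < n" "H \<in> simple_graphs n" "xs \<in> partial_inj n k" "G \<in> simple_graphs n"
  shows "set_pmf (P (Suc k) G H xs) \<subseteq> {1..n} - set xs"
    "G' \<in> simple_graphs n \<Longrightarrow> (\<And>i j. 1 \<le> i \<Longrightarrow> i < j \<Longrightarrow> j \<le> Suc k \<Longrightarrow> adj G i j = adj G' i j) \<Longrightarrow>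
      P (Suc k) G H xs = P (Suc k) G' H xs"
proof -
  have "Suc k \<in> {1..n}" "length xs = Suc k - 1 \<and> distinct xs \<and> set xs \<subseteq> {1..n}"
    using assms by (auto simp: partial_inj_def)
  note * = assms(1)[unfolded valid_online_rule_def, rule_format, OF this(1) assms(3) this(2)]
  show "set_pmf (P (Suc k) G H xs) \<subseteq> {1..n} - set xs" using * assms(5) by blast
  show "G' \<in> simple_graphs n \<Longrightarrow> (\<And>i j. 1 \<le> i \<Longrightarrow> i < j \<Longrightarrow> j \<le> Suc k \<Longrightarrow> adj G i j = adj G' i j) \<Longrightarrow>
      P (Suc k) G H xs = P (Suc k) G' H xs"
    using * assms(5) by blast
qed

lemma partial_inj_snoc:
  "xs \<in> partial_inj n k \<Longrightarrow> v \<in> {1..n} - set xs \<Longrightarrow> xs @ [v] \<in> partial_inj n (Suc k)"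
  by (auto simp: partial_inj_def)

lemma set_online_values:
  assumes "valid_online_rule n P" "k \<le> n" "H \<in> simple_graphs n" "G \<in> simple_graphs n"
  shows "set_pmf (online_values P G H k) \<subseteq> partial_inj n k"
  using assms(2)
proof (induction k)
  case (Suc k)
  then show ?case
    using valid_online_ruleD(1)[OF assms(1) _ assms(3) _ assms(4), of k] partial_inj_snoc[of _ n k]
    by (fastforce simp: set_bind_pmf)
qed (simp add: partial_inj_def)

text \<open>This is the online condition in the form needed below: the first \<open>k\<close> values
  ignore all later columns of \<open>G\<close>.\<close>

lemma online_values_cong:
  assumes "valid_online_rule n P" "k \<le> n" "H \<in> simple_graphs n" "G \<in> simple_graphs n" "G' \<in> simple_graphs n"
    and "\<And>i j. 1 \<le> i \<Longrightarrow> i < j \<Longrightarrow> j \<le> k \<Longrightarrow> adj G i j = adj G' i j"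
  shows "online_values P G H k = online_values P G' H k"
  using assms(2,6)
proof (induction k)
  case (Suc k)
  then have IH: "online_values P G H k = online_values P G' H k" by simp
  have "P (Suc k) G H xs = P (Suc k) G' H xs" if "xs \<in> set_pmf (online_values P G H k)" for xs
    using set_online_values[OF assms(1) _ assms(3,4), of k] that Suc.prems
    by (intro valid_online_ruleD(2)[OF assms(1) _ assms(3) _ assms(4) assms(5)]) auto
  then show ?case unfolding online_values.simps IH[symmetric] by (intro bind_pmf_cong) auto
qed simp

text \<open>By \<open>online_values_cong\<close> the first \<open>k\<close> values do not see the
  column of \<open>Suc k\<close>, so this column may be drawn after them; this makes the run a
  Markov chain.\<close>

lemma partial_run_Suc:
  assumes "valid_online_rule n P" "k < n" "H \<in> simple_graphs n"
  shows "partial_run P H p (Suc k) =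
    bind_pmf (partial_run P H p k) (\<lambda>(G, xs).
    bind_pmf (random_subset {1..k} p) (\<lambda>C.
      map_pmf (\<lambda>v. (G \<union> new_edges k C, xs @ [v])) (P (Suc k) (G \<union> new_edges k C) H xs)))"
proof -
  let ?R = "random_subset {1..k} p"
  let ?U = "\<lambda>G C. G \<union> new_edges k C"
  have "partial_run P H p (Suc k) = bind_pmf (erdos_renyi k p) (\<lambda>G. bind_pmf ?R (\<lambda>C.
     bind_pmf (online_values P (?U G C) H k) (\<lambda>xs. map_pmf (\<lambda>v. (?U G C, xs @ [v])) (P (Suc k) (?U G C) H xs))))"
    by (simp add: partial_run_def erdos_renyi_Suc bind_map_pmf pair_pmf_def bind_assoc_pmf bind_return_pmf
        map_bind_pmf map_pmf_comp)
  also have "\<dots> = bind_pmf (erdos_renyi k p) (\<lambda>G. bind_pmf ?R (\<lambda>C.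
     bind_pmf (online_values P G H k) (\<lambda>xs. map_pmf (\<lambda>v. (?U G C, xs @ [v])) (P (Suc k) (?U G C) H xs))))"
  proof (rule bind_pmf_cong[OF refl], rule bind_pmf_cong[OF refl])
    fix G C assume "G \<in> set_pmf (erdos_renyi k p)" "C \<in> set_pmf ?R"
    then have G: "G \<in> simple_graphs k" "C \<subseteq> {1..k}"
      using set_erdos_renyi[of k p] random_subset_subset by blast+
    have "?U G C \<in> simple_graphs n" "G \<in> simple_graphs n"
      using union_new_edges_simple[OF G] G simple_graphs_mono[of "Suc k" n] simple_graphs_mono[of k n] assms(2) by auto
    then have "online_values P (?U G C) H k = online_values P G H k"
      using assms by (intro online_values_cong[OF assms(1)]) (auto simp: adj_union_new_edges)
    then show "bind_pmf (online_values P (?U G C) H k) (\<lambda>xs. map_pmf (\<lambda>v. (?U G C, xs @ [v])) (P (Suc k) (?U G C) H xs))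
       = bind_pmf (online_values P G H k) (\<lambda>xs. map_pmf (\<lambda>v. (?U G C, xs @ [v])) (P (Suc k) (?U G C) H xs))"
      by simp
  qed
  also have "\<dots> = bind_pmf (partial_run P H p k) (\<lambda>(G, xs). bind_pmf ?R (\<lambda>C.
      map_pmf (\<lambda>v. (?U G C, xs @ [v])) (P (Suc k) (?U G C) H xs)))"
    unfolding partial_run_def
    by (subst bind_commute_pmf) (simp add: bind_assoc_pmf bind_map_pmf)
  finally show ?thesis .
qed

lemma set_partial_run:
  assumes "valid_online_rule n P" "k \<le> n" "H \<in> simple_graphs n"
  shows "set_pmf (partial_run P H p k) \<subseteq> simple_graphs k \<times> partial_inj n k"
  using set_erdos_renyi[of k p] set_online_values[OF assms] simple_graphs_mono[OF assms(2)]
  by (fastforce simp: partial_run_def)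

context
  fixes n :: nat and P :: online_rule and H :: graph and p :: real
  assumes P: "valid_online_rule n P" and H: "H \<in> simple_graphs n"
begin

lemma nn_integral_partial_run_Suc:
  assumes "k < n"
  shows "(\<integral>\<^sup>+z. f z \<partial>partial_run P H p (Suc k)) =
    (\<integral>\<^sup>+(G, xs). (\<integral>\<^sup>+C. (\<integral>\<^sup>+v. f (G \<union> new_edges k C, xs @ [v]) \<partial>P (Suc k) (G \<union> new_edges k C) H xs)
       \<partial>random_subset {1..k} p) \<partial>partial_run P H p k)"
  unfolding partial_run_Suc[OF P assms H]
  by (simp add: case_prod_unfold nn_integral_map_pmf)

text \<open>The bound on one step holds for every past, so the rule may depend on the past
  arbitrarily: the newest factor is integrated out and the induction hypothesis bounds the others.
  Nonnegative integrals avoid integrability conditions.\<close>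

lemma nn_integral_partial_run_prod:
  fixes w :: "nat list \<Rightarrow> nat \<Rightarrow> nat set \<Rightarrow> ennreal"
  assumes w: "\<And>k xs G. k < n \<Longrightarrow> xs \<in> partial_inj n k \<Longrightarrow> G \<in> simple_graphs k \<Longrightarrow>
     (\<integral>\<^sup>+C. (\<integral>\<^sup>+v. w xs v C \<partial>P (Suc k) (G \<union> new_edges k C) H xs) \<partial>random_subset {1..k} p) \<le> K"
  shows "k \<le> n \<Longrightarrow> (\<integral>\<^sup>+(G, xs). (\<Prod>j<k. w (take j xs) (xs ! j) (new_nbrs G j)) \<partial>partial_run P H p k) \<le> K ^ k"
proof (induction k)
  case 0
  then show ?case by (simp add: case_prod_unfold)
next
  case (Suc k)
  let ?W = "\<lambda>G xs. \<Prod>j<k. w (take j xs) (xs ! j) (new_nbrs G j)"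
  have "(\<integral>\<^sup>+(G, xs). (\<Prod>j<Suc k. w (take j xs) (xs ! j) (new_nbrs G j)) \<partial>partial_run P H p (Suc k)) =
    (\<integral>\<^sup>+(G, xs). (\<integral>\<^sup>+C. (\<integral>\<^sup>+v. (\<Prod>j<Suc k. w (take j (xs @ [v])) ((xs @ [v]) ! j) (new_nbrs (G \<union> new_edges k C) j))
       \<partial>P (Suc k) (G \<union> new_edges k C) H xs) \<partial>random_subset {1..k} p) \<partial>partial_run P H p k)"
    using Suc.prems by (subst nn_integral_partial_run_Suc) auto
  also have "\<dots> = (\<integral>\<^sup>+(G, xs). (\<integral>\<^sup>+C. (\<integral>\<^sup>+v. ?W G xs * w xs v C
       \<partial>P (Suc k) (G \<union> new_edges k C) H xs) \<partial>random_subset {1..k} p) \<partial>partial_run P H p k)"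
    unfolding case_prod_unfold
  proof (intro nn_integral_cong_AE AE_pmfI)
    fix z C v assume z: "z \<in> set_pmf (partial_run P H p k)" and C: "C \<in> set_pmf (random_subset {1..k} p)"
    have *: "fst z \<in> simple_graphs k" "snd z \<in> partial_inj n k"
      using set_partial_run[OF P _ H, of k p] z Suc.prems by auto
    then have len: "length (snd z) = k" by (simp add: partial_inj_def)
    have "new_nbrs (fst z \<union> new_edges k C) k = C"
      using *(1) random_subset_subset[OF C] by (rule new_nbrs_union_new)
    then show "(\<Prod>j<Suc k. w (take j (snd z @ [v])) ((snd z @ [v]) ! j) (new_nbrs (fst z \<union> new_edges k C) j)) =
       ?W (fst z) (snd z) * w (snd z) v C"
      using len by (auto simp: new_nbrs_union_old nth_append intro!: prod.cong)
  qed
  also have "\<dots> = (\<integral>\<^sup>+(G, xs). ?W G xs * (\<integral>\<^sup>+C. (\<integral>\<^sup>+v. w xs v C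
       \<partial>P (Suc k) (G \<union> new_edges k C) H xs) \<partial>random_subset {1..k} p) \<partial>partial_run P H p k)"
    by (simp add: nn_integral_cmult)
  also have "\<dots> \<le> (\<integral>\<^sup>+(G, xs). ?W G xs * K \<partial>partial_run P H p k)"
    unfolding case_prod_unfold
  proof (intro nn_integral_mono_AE AE_pmfI mult_left_mono)
    fix z assume "z \<in> set_pmf (partial_run P H p k)"
    then have *: "fst z \<in> simple_graphs k" "snd z \<in> partial_inj n k"
      using set_partial_run[OF P _ H, of k p] Suc.prems by auto
    show "(\<integral>\<^sup>+C. (\<integral>\<^sup>+v. w (snd z) v C \<partial>P (Suc k) (fst z \<union> new_edges k C) H (snd z)) \<partial>random_subset {1..k} p) \<le> K"
      using * Suc.prems by (intro w) auto
  qed auto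
  also have "\<dots> = (\<integral>\<^sup>+(G, xs). ?W G xs \<partial>partial_run P H p k) * K"
    by (simp add: case_prod_unfold nn_integral_multc)
  also have "\<dots> \<le> K ^ k * K"
    using Suc by (intro mult_right_mono) auto
  finally show ?case by (simp add: mult.commute)
qed

text \<open>Additive counterpart of the product bound, with a constant for each step; it controls
  the expected total loss of the greedy rule.\<close>

lemma nn_integral_partial_run_sum:
  fixes w :: "nat list \<Rightarrow> nat \<Rightarrow> nat set \<Rightarrow> ennreal"
  assumes w: "\<And>k xs G. k < n \<Longrightarrow> xs \<in> partial_inj n k \<Longrightarrow> G \<in> simple_graphs k \<Longrightarrow>
     (\<integral>\<^sup>+C. (\<integral>\<^sup>+v. w xs v C \<partial>P (Suc k) (G \<union> new_edges k C) H xs) \<partial>random_subset {1..k} p) \<le> K k"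
  shows "k \<le> n \<Longrightarrow> (\<integral>\<^sup>+(G, xs). (\<Sum>j<k. w (take j xs) (xs ! j) (new_nbrs G j)) \<partial>partial_run P H p k) \<le> (\<Sum>j<k. K j)"
proof (induction k)
  case 0
  then show ?case by (simp add: case_prod_unfold)
next
  case (Suc k)
  let ?W = "\<lambda>G xs. \<Sum>j<k. w (take j xs) (xs ! j) (new_nbrs G j)"
  have "(\<integral>\<^sup>+(G, xs). (\<Sum>j<Suc k. w (take j xs) (xs ! j) (new_nbrs G j)) \<partial>partial_run P H p (Suc k)) =
    (\<integral>\<^sup>+(G, xs). (\<integral>\<^sup>+C. (\<integral>\<^sup>+v. (\<Sum>j<Suc k. w (take j (xs @ [v])) ((xs @ [v]) ! j) (new_nbrs (G \<union> new_edges k C) j))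
       \<partial>P (Suc k) (G \<union> new_edges k C) H xs) \<partial>random_subset {1..k} p) \<partial>partial_run P H p k)"
    using Suc.prems by (subst nn_integral_partial_run_Suc) auto
  also have "\<dots> = (\<integral>\<^sup>+(G, xs). (\<integral>\<^sup>+C. (\<integral>\<^sup>+v. ?W G xs + w xs v C
       \<partial>P (Suc k) (G \<union> new_edges k C) H xs) \<partial>random_subset {1..k} p) \<partial>partial_run P H p k)"
    unfolding case_prod_unfold
  proof (intro nn_integral_cong_AE AE_pmfI)
    fix z C v assume z: "z \<in> set_pmf (partial_run P H p k)" and C: "C \<in> set_pmf (random_subset {1..k} p)"
    have *: "fst z \<in> simple_graphs k" "snd z \<in> partial_inj n k"
      using set_partial_run[OF P _ H, of k p] z Suc.prems by auto
    then have len: "length (snd z) = k" by (simp add: partial_inj_def)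
    have "new_nbrs (fst z \<union> new_edges k C) k = C"
      using *(1) random_subset_subset[OF C] by (rule new_nbrs_union_new)
    then show "(\<Sum>j<Suc k. w (take j (snd z @ [v])) ((snd z @ [v]) ! j) (new_nbrs (fst z \<union> new_edges k C) j)) =
       ?W (fst z) (snd z) + w (snd z) v C"
      using len by (auto simp: new_nbrs_union_old nth_append intro!: sum.cong)
  qed
  also have "\<dots> = (\<integral>\<^sup>+(G, xs). ?W G xs \<partial>partial_run P H p k) + (\<integral>\<^sup>+(G, xs). (\<integral>\<^sup>+C. (\<integral>\<^sup>+v. w xs v C
       \<partial>P (Suc k) (G \<union> new_edges k C) H xs) \<partial>random_subset {1..k} p) \<partial>partial_run P H p k)"
    by (simp add: nn_integral_add case_prod_unfold)
  also have "\<dots> \<le> (\<integral>\<^sup>+(G, xs). ?W G xs \<partial>partial_run P H p k) + (\<integral>\<^sup>+z. K k \<partial>partial_run P H p k)"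
    unfolding case_prod_unfold
  proof (intro nn_integral_mono_AE AE_pmfI add_left_mono)
    fix z assume "z \<in> set_pmf (partial_run P H p k)"
    then have *: "fst z \<in> simple_graphs k" "snd z \<in> partial_inj n k"
      using set_partial_run[OF P _ H, of k p] Suc.prems by auto
    show "(\<integral>\<^sup>+C. (\<integral>\<^sup>+v. w (snd z) v C \<partial>P (Suc k) (fst z \<union> new_edges k C) H (snd z)) \<partial>random_subset {1..k} p) \<le> K k"
      using * Suc.prems by (intro w) auto
  qed
  also have "\<dots> \<le> (\<Sum>j<Suc k. K j)"
    using Suc by (auto intro!: add_mono)
  finally show ?case .
qed

end

text \<open>Each pair \<open>i < j\<close> is charged to the step that places \<open>j\<close>, the
  step that also reveals the corresponding entry of \<open>G\<close>. Note that
  \<open>perm_of_list\<close> counts from 1 and list positions from 0.\<close>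

lemma overlap_eq_sum_score:
  assumes "length xs = n"
  shows "overlap n G H (perm_of_list xs) = (\<Sum>k<n. score G H (take k xs) (xs ! k))"
proof -
  have "overlap n G H (perm_of_list xs) =
     (\<Sum>k<n. \<Sum>i\<in>{1..<Suc k}. adj G i (Suc k) * adj H (perm_of_list xs i) (perm_of_list xs (Suc k)))"
    unfolding overlap_def by (rule sum.reindex_bij_witness[of _ Suc "\<lambda>j. j - 1"]) auto
  also have "\<dots> = (\<Sum>k<n. score G H (take k xs) (xs ! k))"
  proof (intro sum.cong refl)
    fix k assume k: "k \<in> {..<n}"
    have "(\<Sum>i\<in>{1..<Suc k}. adj G i (Suc k) * adj H (perm_of_list xs i) (perm_of_list xs (Suc k))) =
       (\<Sum>i\<in>{1..k}. if i \<in> new_nbrs G k \<inter> back_nbrs H (take k xs) (xs ! k) then 1 else 0)"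
    proof (intro sum.cong)
      fix i assume i: "i \<in> {1..k}"
      then have "i \<le> n" "i - 1 < k" using k by auto
      then show "adj G i (Suc k) * adj H (perm_of_list xs i) (perm_of_list xs (Suc k)) =
        (if i \<in> new_nbrs G k \<inter> back_nbrs H (take k xs) (xs ! k) then 1 else 0)"
        using i k assms by (auto simp: adj_def perm_of_list_def new_nbrs_def back_nbrs_def)
    qed auto
    also have "\<dots> = card ({1..k} \<inter> (new_nbrs G k \<inter> back_nbrs H (take k xs) (xs ! k)))"
      by (simp add: sum.If_cases Collect_conj_eq)
    also have "{1..k} \<inter> (new_nbrs G k \<inter> back_nbrs H (take k xs) (xs ! k)) = new_nbrs G k \<inter> back_nbrs H (take k xs) (xs ! k)"
      by (auto simp: new_nbrs_def)
    finally show "(\<Sum>i\<in>{1..<Suc k}. adj G i (Suc k) * adj H (perm_of_list xs i) (perm_of_list xs (Suc k))) =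
      score G H (take k xs) (xs ! k)"
      using k assms by (simp add: score_def)
  qed
  finally show ?thesis .
qed

lemma card_back_nbrs:
  assumes "distinct xs"
  shows "card (back_nbrs H xs v) = card {u \<in> set xs. {u, v} \<in> H}"
proof (rule bij_betw_same_card)
  show "bij_betw (\<lambda>i. xs ! (i - 1)) (back_nbrs H xs v) {u \<in> set xs. {u, v} \<in> H}"
    unfolding bij_betw_def
  proof
    show "inj_on (\<lambda>i. xs ! (i - 1)) (back_nbrs H xs v)"
      using assms by (auto simp: inj_on_def back_nbrs_def nth_eq_iff_index_eq)
    show "(\<lambda>i. xs ! (i - 1)) ` back_nbrs H xs v = {u \<in> set xs. {u, v} \<in> H}"
    proof (intro equalityI subsetI)
      fix u assume "u \<in> {u \<in> set xs. {u, v} \<in> H}"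
      then obtain i where "i < length xs" "u = xs ! i" "{u, v} \<in> H" by (auto simp: in_set_conv_nth)
      then show "u \<in> (\<lambda>i. xs ! (i - 1)) ` back_nbrs H xs v"
        by (intro image_eqI[of _ _ "Suc i"]) (auto simp: back_nbrs_def)
    qed (auto simp: back_nbrs_def)
  qed
qed

text \<open>An edge of \<open>H\<close> inside the image is counted when the later of its endpoints
  is appended. The total depends only on the set of used vertices and not on their order, which
  makes a union bound over sets sufficient.\<close>

lemma sum_card_back_nbrs:
  assumes "H \<in> simple_graphs n" "distinct xs"
  shows "(\<Sum>k<length xs. card (back_nbrs H (take k xs) (xs ! k))) = card {e \<in> H. e \<subseteq> set xs}"
  using assms(2)
proof (induction xs rule: rev_induct)
  case Nil
  have "{e \<in> H. e = {}} = {}" using assms(1) by (auto simp: simple_graphs_def vertex_pairs_def)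
  then show ?case by simp
next
  case (snoc v xs)
  have fin: "finite H" using assms(1) finite_subset[of H "vertex_pairs n"] by (auto simp: simple_graphs_def)
  have eq: "{e \<in> H. e \<subseteq> set (xs @ [v])} = {e \<in> H. e \<subseteq> set xs} \<union> (\<lambda>u. {u, v}) ` {u \<in> set xs. {u, v} \<in> H}"
  proof (intro equalityI subsetI)
    fix e assume e: "e \<in> {e \<in> H. e \<subseteq> set (xs @ [v])}"
    then have "card e = 2" using assms(1) by (auto simp: simple_graphs_def vertex_pairs_def)
    then obtain x y where xy: "e = {x, y}" "x \<noteq> y" by (auto simp: card_2_iff)
    show "e \<in> {e \<in> H. e \<subseteq> set xs} \<union> (\<lambda>u. {u, v}) ` {u \<in> set xs. {u, v} \<in> H}"
    proof (cases "v \<in> e")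
      case True
      then obtain u where "e = {u, v}" "u \<noteq> v" using xy by auto
      then show ?thesis using e by auto
    qed (use e in auto)
  qed auto
  have "card {e \<in> H. e \<subseteq> set (xs @ [v])} = card {e \<in> H. e \<subseteq> set xs} + card ((\<lambda>u. {u, v}) ` {u \<in> set xs. {u, v} \<in> H})"
    unfolding eq using snoc.prems fin by (intro card_Un_disjoint) auto
  also have "card ((\<lambda>u. {u, v}) ` {u \<in> set xs. {u, v} \<in> H}) = card {u \<in> set xs. {u, v} \<in> H}"
    using snoc.prems by (intro card_image) (auto simp: inj_on_def doubleton_eq_iff)
  finally show ?case
    using snoc by (simp add: nth_append card_back_nbrs cong: sum.cong_simp)
qed


section \<open>Pseudo-random properties of random graphs\<close>

lemma doubleton_vertex_pairs: "{a, b} \<in> vertex_pairs n \<longleftrightarrow> a \<in> {1..n} \<and> b \<in> {1..n} \<and> a \<noteq> b"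
  by (cases "a = b") (auto simp: vertex_pairs_def)

lemma nn_integral_finite_pmf:
  assumes "finite (set_pmf M)" "\<And>x. x \<in> set_pmf M \<Longrightarrow> f x \<ge> 0"
  shows "(\<integral>\<^sup>+x. ennreal (f x) \<partial>measure_pmf M) = ennreal (measure_pmf.expectation M f)"
  using assms by (intro nn_integral_eq_integral integrable_measure_pmf_finite AE_pmfI) auto

lemma prob_le_nn_integral:
  assumes "\<And>x. x \<in> set_pmf M \<Longrightarrow> x \<in> X \<Longrightarrow> 1 \<le> f x" "(\<integral>\<^sup>+x. f x \<partial>measure_pmf M) \<le> ennreal c" "0 \<le> c"
  shows "measure_pmf.prob M X \<le> c"
proof -
  have "ennreal (measure_pmf.prob M X) = (\<integral>\<^sup>+x. indicator X x \<partial>measure_pmf M)"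
    by (simp add: measure_pmf.emeasure_eq_measure)
  also have "\<dots> \<le> (\<integral>\<^sup>+x. f x \<partial>measure_pmf M)"
    using assms(1) by (intro nn_integral_mono_AE AE_pmfI) (auto split: split_indicator)
  also have "\<dots> \<le> ennreal c" by fact
  finally show ?thesis using assms(3) by simp
qed

lemma prob_exp_moment:
  assumes "finite (set_pmf M)" "measure_pmf.expectation M (\<lambda>x. exp (f x)) \<le> c"
  shows "measure_pmf.prob M {x. f x \<ge> a} \<le> exp (- a) * c"
proof (rule prob_le_nn_integral)
  have "(\<integral>\<^sup>+x. ennreal (exp (f x - a)) \<partial>measure_pmf M) = ennreal (measure_pmf.expectation M (\<lambda>x. exp (f x - a)))"
    using assms(1) by (intro nn_integral_finite_pmf) auto
  also have "measure_pmf.expectation M (\<lambda>x. exp (f x - a)) = exp (- a) * measure_pmf.expectation M (\<lambda>x. exp (f x))"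
    by (simp add: exp_diff exp_minus field_simps)
  also have "ennreal \<dots> \<le> ennreal (exp (- a) * c)"
    using assms(2) by (intro ennreal_leI mult_left_mono) auto
  finally show "(\<integral>\<^sup>+x. ennreal (exp (f x - a)) \<partial>measure_pmf M) \<le> ennreal (exp (- a) * c)" .
  have "0 \<le> measure_pmf.expectation M (\<lambda>x. exp (f x))" by simp
  then have "0 \<le> c" using assms(2) by linarith
  then show "0 \<le> exp (- a) * c" by simp
qed auto

lemma exp_le_quadratic:
  fixes x :: real
  assumes "\<bar>x\<bar> \<le> 1"
  shows "exp x \<le> 1 + x + x\<^sup>2"
proof (cases "x \<ge> 0")
  case True with assms show ?thesis by (intro exp_bound) auto
next
  case False
  define y where "y = - x"
  have y: "0 \<le> y" "y \<le> 1" using False assms by (auto simp: y_def)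
  \<comment> \<open>The product equals \<open>1 + y ^ 3\<close>.\<close>
  have "1 \<le> (1 + y) * (1 - y + y\<^sup>2)" using y by (simp add: power2_eq_square algebra_simps)
  also have "\<dots> \<le> exp y * (1 - y + y\<^sup>2)"
    using y exp_ge_add_one_self[of y] by (intro mult_right_mono) auto
  finally show ?thesis by (simp add: y_def exp_minus field_simps)
qed

text \<open>\<open>edges_upper\<close> serves the upper bound, \<open>cut_lower\<close> and
  \<open>codegree_upper\<close> the lower bound. The mean codegree is about \<open>n * p^2\<close>;
  the factor 4 leaves room for an exponential tail.\<close>

definition edges_upper :: "real \<Rightarrow> nat \<Rightarrow> graph \<Rightarrow> bool" where
  "edges_upper p n H \<longleftrightarrow> (\<forall>S\<subseteq>{1..n}. real (card {e \<in> H. e \<subseteq> S}) \<le> real (card S choose 2) * p + 2 * real n * sqrt (real n * p))"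

definition cut_lower :: "real \<Rightarrow> nat \<Rightarrow> graph \<Rightarrow> bool" where
  "cut_lower p n H \<longleftrightarrow> (\<forall>S\<subseteq>{1..n}. \<forall>B\<subseteq>{1..n}. S \<inter> B = {} \<longrightarrow>
     real (card {(u, v) \<in> S \<times> B. {u, v} \<in> H}) \<ge> real (card S) * real (card B) * p - 2 * real n * sqrt (real n * p))"

definition codegree_upper :: "real \<Rightarrow> nat \<Rightarrow> graph \<Rightarrow> bool" where
  "codegree_upper p n H \<longleftrightarrow> (\<forall>v\<in>{1..n}. \<forall>w\<in>{1..n}. v \<noteq> w \<longrightarrow>
     real (card {u. {u, v} \<in> H \<and> {u, w} \<in> H}) \<le> 4 * real n * p\<^sup>2)"

context
  fixes p :: real
  assumes p: "0 \<le> p" "p \<le> 1"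
begin

text \<open>The sign of \<open>t\<close> selects the tail. For small \<open>t\<close> the
  exponential moment is compared with its second order expansion, in which the linear term cancels
  against the mean.\<close>

lemma chernoff:
  assumes "finite A" "B \<subseteq> A" "\<bar>t\<bar> \<le> 1"
  shows "measure_pmf.prob (random_subset A p) {C. t * (real (card (C \<inter> B)) - real (card B) * p) \<ge> a}
     \<le> exp (real (card B) * p * t\<^sup>2 - a)"
proof -
  have "measure_pmf.expectation (random_subset A p) (\<lambda>C. exp (t * (real (card (C \<inter> B)) - real (card B) * p)))
    = exp (- (t * (real (card B) * p))) * measure_pmf.expectation (random_subset A p) (\<lambda>C. exp (t * real (card (C \<inter> B))))"
    by (simp add: right_diff_distrib exp_diff exp_minus divide_inverse mult.commute)
  also have "\<dots> \<le> exp (- (t * (real (card B) * p))) * exp (real (card B) * p * (exp t - 1))"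
    using expectation_random_subset_exp_card_le[OF p assms(1,2)] by (intro mult_left_mono) auto
  also have "\<dots> = exp (real (card B) * p * (exp t - 1 - t))"
    by (simp add: exp_add[symmetric] algebra_simps)
  also have "\<dots> \<le> exp (real (card B) * p * t\<^sup>2)"
    using p exp_le_quadratic[OF assms(3)] by (auto intro!: mult_left_mono)
  finally have "measure_pmf.prob (random_subset A p) {C. t * (real (card (C \<inter> B)) - real (card B) * p) \<ge> a}
     \<le> exp (- a) * exp (real (card B) * p * t\<^sup>2)"
    using assms by (intro prob_exp_moment) auto
  then show ?thesis by (simp add: exp_add[symmetric])
qed

text \<open>With \<open>t = 2 / sqrt (n p)\<close> the deviation \<open>2 n sqrt (n p)\<close> costs a factor \<open>exp (- 2 n)\<close>,
  which beats a union bound over pairs of vertex subsets.\<close>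

lemma chernoff_vertex_pairs:
  assumes "finite A" "B \<subseteq> A" "2 * card B \<le> n * n" "4 \<le> real n * p" "s\<^sup>2 = 1"
  shows "measure_pmf.prob (random_subset A p)
     {C. s * (real (card (C \<inter> B)) - real (card B) * p) \<ge> 2 * real n * sqrt (real n * p)} \<le> exp (- 2 * real n)"
proof -
  define r where "r = sqrt (real n * p)"
  have r2: "r\<^sup>2 = real n * p" using p by (simp add: r_def)
  have r: "r \<ge> 2" unfolding r_def using assms(4) by (intro real_le_rsqrt) auto
  have s: "s = 1 \<or> s = -1" using assms(5) by (simp add: power2_eq_1_iff)
  define t where "t = s * (2 / r)"
  have t: "\<bar>t\<bar> \<le> 1" using r s by (auto simp: t_def)
  have t2: "t\<^sup>2 = 4 / r\<^sup>2" using assms(5) by (simp add: t_def power_mult_distrib power_divide)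
  have "{C. s * (real (card (C \<inter> B)) - real (card B) * p) \<ge> 2 * real n * r}
     \<subseteq> {C. t * (real (card (C \<inter> B)) - real (card B) * p) \<ge> 4 * real n}"
  proof
    fix C assume "C \<in> {C. s * (real (card (C \<inter> B)) - real (card B) * p) \<ge> 2 * real n * r}"
    then have "(2 / r) * (2 * real n * r) \<le> (2 / r) * (s * (real (card (C \<inter> B)) - real (card B) * p))"
      using r by (intro mult_left_mono) auto
    then show "C \<in> {C. t * (real (card (C \<inter> B)) - real (card B) * p) \<ge> 4 * real n}"
      using r by (simp add: t_def mult_ac)
  qed
  then have "measure_pmf.prob (random_subset A p) {C. s * (real (card (C \<inter> B)) - real (card B) * p) \<ge> 2 * real n * r}
     \<le> measure_pmf.prob (random_subset A p) {C. t * (real (card (C \<inter> B)) - real (card B) * p) \<ge> 4 * real n}"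
    by (intro measure_pmf.finite_measure_mono) auto
  also have "\<dots> \<le> exp (real (card B) * p * t\<^sup>2 - 4 * real n)"
    using assms t by (intro chernoff) auto
  also have "real (card B) * p * t\<^sup>2 \<le> 2 * real n"
  proof -
    have "2 * real (card B) \<le> real n * real n"
      using of_nat_mono[OF assms(3), where 'a = real] by simp
    then have "2 * real (card B) * p \<le> real n * real n * p" using p by (intro mult_right_mono) auto
    then have "real (card B) * p * 4 \<le> 2 * real n * r\<^sup>2" unfolding r2 by (simp add: mult_ac)
    then show ?thesis using r unfolding t2 by (simp add: field_simps)
  qed
  finally show ?thesis by (simp add: r_def)
qed

lemma prob_not_edges_upper:
  assumes "4 \<le> real n * p"
  shows "measure_pmf.prob (erdos_renyi n p) {H. \<not> edges_upper p n H} \<le> 2 ^ n * exp (- 2 * real n)"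
proof -
  let ?M = "erdos_renyi n p"
  let ?bad = "\<lambda>S. {H. 1 * (real (card (H \<inter> {e. e \<subseteq> S \<and> card e = 2})) - real (card {e. e \<subseteq> S \<and> card e = 2}) * p)
     \<ge> 2 * real n * sqrt (real n * p)}"
  have "measure_pmf.prob ?M {H. \<not> edges_upper p n H} \<le> measure_pmf.prob ?M (\<Union>S\<in>Pow {1..n}. ?bad S)"
  proof (rule measure_pmf.finite_measure_mono_AE)
    show "AE H in ?M. H \<in> {H. \<not> edges_upper p n H} \<longrightarrow> H \<in> (\<Union>S\<in>Pow {1..n}. ?bad S)"
    proof (intro AE_pmfI impI)
      fix H assume H: "H \<in> set_pmf ?M" "H \<in> {H. \<not> edges_upper p n H}"
      then obtain S where S: "S \<subseteq> {1..n}"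
        "real (card {e \<in> H. e \<subseteq> S}) > real (card S choose 2) * p + 2 * real n * sqrt (real n * p)"
        by (auto simp: edges_upper_def not_le)
      have "H \<subseteq> vertex_pairs n" using H(1) set_erdos_renyi by (auto simp: simple_graphs_def)
      then have "{e \<in> H. e \<subseteq> S} = H \<inter> {e. e \<subseteq> S \<and> card e = 2}" by (auto simp: vertex_pairs_def)
      moreover have "card {e. e \<subseteq> S \<and> card e = 2} = card S choose 2"
        using S(1) finite_subset by (intro n_subsets) blast
      ultimately have "H \<in> ?bad S" using S by simp
      then show "H \<in> (\<Union>S\<in>Pow {1..n}. ?bad S)" using S(1) by blast
    qed
  qed auto
  also have "\<dots> \<le> (\<Sum>S\<in>Pow {1..n}. measure_pmf.prob ?M (?bad S))"
    by (intro measure_pmf.finite_measure_subadditive_finite) auto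
  also have "\<dots> \<le> (\<Sum>S\<in>Pow {1..n}. exp (- 2 * real n))"
  proof (rule sum_mono)
    fix S assume S: "S \<in> Pow {1..n}"
    then have fin: "finite S" using finite_subset by blast
    have "card {e. e \<subseteq> S \<and> card e = 2} = card S choose 2" using fin by (intro n_subsets)
    moreover have "card S \<le> n" using S card_mono[of "{1..n}" S] by auto
    then have "card S * (card S - 1) \<le> n * n" by (intro mult_mono) auto
    then have "2 * (card S choose 2) \<le> n * n"
      unfolding choose_two by (rule order_trans[OF times_div_less_eq_dividend])
    ultimately show "measure_pmf.prob ?M (?bad S) \<le> exp (- 2 * real n)"
      unfolding erdos_renyi_random_subset using S assms
      by (intro chernoff_vertex_pairs) (auto simp: vertex_pairs_def)
  qed
  also have "\<dots> = 2 ^ n * exp (- 2 * real n)" by (simp add: card_Pow)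
  finally show ?thesis .
qed

lemma prob_not_cut_lower:
  assumes "4 \<le> real n * p"
  shows "measure_pmf.prob (erdos_renyi n p) {H. \<not> cut_lower p n H} \<le> 4 ^ n * exp (- 2 * real n)"
proof -
  let ?M = "erdos_renyi n p"
  let ?E = "\<lambda>(S, B). (\<lambda>(u, v). {u, v}) ` (S \<times> B)"
  let ?bad = "\<lambda>z. {H. - 1 * (real (card (H \<inter> ?E z)) - real (card (?E z)) * p) \<ge> 2 * real n * sqrt (real n * p)}"
  let ?I = "{(S, B). S \<subseteq> {1..n} \<and> B \<subseteq> {1..n} \<and> S \<inter> B = {}}"
  have fin: "finite ?I" by (rule finite_subset[of _ "Pow {1..n} \<times> Pow {1..n}"]) auto
  \<comment> \<open>As the two sides are disjoint, an edge determines its ordered pair, so counting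
    pairs is counting edges.\<close>
  have inj: "inj_on (\<lambda>(u, v). {u, v}) (S \<times> B)" if "S \<inter> B = {}" for S B :: "nat set"
  proof (rule inj_onI, clarify)
    fix a b a' b' assume *: "a \<in> S" "b \<in> B" "a' \<in> S" "b' \<in> B" "{a, b} = {a', b'}"
    then have "a \<noteq> b'" using that by blast
    then show "a = a' \<and> b = b'" using *(5) by (simp add: doubleton_eq_iff)
  qed
  have cardE: "card (?E (S, B)) = card S * card B" if "S \<inter> B = {}" for S B :: "nat set"
    using card_image[OF inj[OF that]] by (simp add: card_cartesian_product)
  have "measure_pmf.prob ?M {H. \<not> cut_lower p n H} \<le> measure_pmf.prob ?M (\<Union>z\<in>?I. ?bad z)"
  proof (rule measure_pmf.finite_measure_mono)
    show "{H. \<not> cut_lower p n H} \<subseteq> (\<Union>z\<in>?I. ?bad z)"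
    proof
      fix H assume H: "H \<in> {H. \<not> cut_lower p n H}"
      then obtain S B where S: "S \<subseteq> {1..n}" "B \<subseteq> {1..n}" "S \<inter> B = {}"
        "real (card {(u, v) \<in> S \<times> B. {u, v} \<in> H}) < real (card S) * real (card B) * p - 2 * real n * sqrt (real n * p)"
        unfolding cut_lower_def mem_Collect_eq not_all not_imp not_le by blast
      have "H \<inter> ?E (S, B) = (\<lambda>(u, v). {u, v}) ` {z \<in> S \<times> B. (\<lambda>(u, v). {u, v}) z \<in> H}"
        unfolding case_prod_conv by blast
      then have "H \<inter> ?E (S, B) = (\<lambda>(u, v). {u, v}) ` {(u, v) \<in> S \<times> B. {u, v} \<in> H}"
        by (simp add: case_prod_unfold mem_Times_iff conj_assoc)
      moreover have "card ((\<lambda>(u, v). {u, v}) ` {(u, v) \<in> S \<times> B. {u, v} \<in> H}) = card {(u, v) \<in> S \<times> B. {u, v} \<in> H}"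
        by (intro card_image inj_on_subset[OF inj[OF S(3)]]) auto
      ultimately have "H \<in> ?bad (S, B)" using S(4) cardE[OF S(3)] by (simp add: algebra_simps)
      then show "H \<in> (\<Union>z\<in>?I. ?bad z)" using S by blast
    qed
  qed auto
  also have "\<dots> \<le> (\<Sum>z\<in>?I. measure_pmf.prob ?M (?bad z))"
    by (intro measure_pmf.finite_measure_subadditive_finite fin) auto
  also have "\<dots> \<le> (\<Sum>z\<in>?I. exp (- 2 * real n))"
  proof (rule sum_mono)
    fix z assume z: "z \<in> ?I"
    then obtain S B where SB: "z = (S, B)" "S \<subseteq> {1..n}" "B \<subseteq> {1..n}" "S \<inter> B = {}" by auto
    then have fin: "finite S" "finite B" using finite_subset by blast+
    have "card S + card B = card (S \<union> B)" using fin SB by (simp add: card_Un_disjoint)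
    also have "\<dots> \<le> n" using SB card_mono[of "{1..n}" "S \<union> B"] by auto
    finally have le: "card S + card B \<le> n" .
    have "2 * (card S * card B) \<le> (card S + card B) * (card S + card B)" by (simp add: algebra_simps)
    also have "\<dots> \<le> n * n" using le by (intro mult_mono) auto
    finally have "2 * card (?E z) \<le> n * n" using cardE[OF SB(4)] SB(1) by simp
    moreover have "{a, b} \<in> vertex_pairs n" if "a \<in> S" "b \<in> B" for a b
      using that SB(2-4) unfolding doubleton_vertex_pairs by blast
    then have "?E z \<subseteq> vertex_pairs n"
      unfolding SB(1) by auto
    ultimately show "measure_pmf.prob ?M (?bad z) \<le> exp (- 2 * real n)"
      unfolding erdos_renyi_random_subset using assms
      by (intro chernoff_vertex_pairs) auto
  qed
  also have "\<dots> = real (card ?I) * exp (- 2 * real n)" by simp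
  also have "\<dots> \<le> 4 ^ n * exp (- 2 * real n)"
  proof (rule mult_right_mono)
    have "card ?I \<le> card (Pow {1..n} \<times> Pow {1..n})" by (intro card_mono) auto
    also have "\<dots> = 4 ^ n" by (simp add: card_cartesian_product card_Pow power_mult_distrib[symmetric])
    finally show "real (card ?I) \<le> 4 ^ n" using of_nat_mono[of "card ?I" "4 ^ n", where 'a = real] by simp
  qed simp
  finally show ?thesis .
qed

text \<open>The stars at \<open>v\<close> and \<open>w\<close> use disjoint sets of vertex pairs, so
  the neighbourhoods of \<open>v\<close> and \<open>w\<close> among the other vertices are
  independent random subsets. Integrating first over one and then over the other gives a factor
  \<open>1 + p^2 * (exp 1 - 1)\<close> per vertex; Markov's inequality is applied with exponent
  1.\<close>

lemma prob_codegree: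
  assumes "v \<in> {1..n}" "w \<in> {1..n}" "v \<noteq> w"
  shows "measure_pmf.prob (erdos_renyi n p) {H. real (card {u. {u, v} \<in> H \<and> {u, w} \<in> H}) > 4 * real n * p\<^sup>2}
    \<le> exp (- 2 * real n * p\<^sup>2)"
proof -
  let ?U = "{1..n} - {v, w}"
  let ?f = "\<lambda>x u. {u, x}"
  let ?R = "random_subset ?U p"
  have finU: "finite ?U" by simp
  have inj: "inj_on (?f x) ?U" for x by (auto simp: inj_on_def doubleton_eq_iff)
  have sub: "?f v ` ?U \<union> ?f w ` ?U \<subseteq> vertex_pairs n"
    using assms by (auto simp: doubleton_vertex_pairs)
  have "random_subset (?f v ` ?U \<union> ?f w ` ?U) p =
     map_pmf (\<lambda>(C, D). C \<union> D) (pair_pmf (random_subset (?f v ` ?U) p) (random_subset (?f w ` ?U) p))"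
    using assms by (intro random_subset_Un) (auto simp: doubleton_eq_iff)
  also have "\<dots> = map_pmf (\<lambda>(C, D). ?f v ` C \<union> ?f w ` D) (pair_pmf ?R ?R)"
    unfolding random_subset_image[OF finU inj]
    by (simp add: pair_map_pmf1 pair_map_pmf2 map_pmf_comp case_prod_unfold)
  finally have law: "map_pmf (\<lambda>H. H \<inter> (?f v ` ?U \<union> ?f w ` ?U)) (erdos_renyi n p) =
     map_pmf (\<lambda>(C, D). ?f v ` C \<union> ?f w ` D) (pair_pmf ?R ?R)"
    unfolding erdos_renyi_random_subset using random_subset_Int[OF finite_vertex_pairs sub] by simp
  let ?c = "\<lambda>H. card {u \<in> ?U. {u, v} \<in> H \<and> {u, w} \<in> H}"
  have "(\<integral>\<^sup>+H. ennreal (exp (real (?c H))) \<partial>erdos_renyi n p)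
     = (\<integral>\<^sup>+H. ennreal (exp (real (?c H))) \<partial>map_pmf (\<lambda>H. H \<inter> (?f v ` ?U \<union> ?f w ` ?U)) (erdos_renyi n p))"
    unfolding nn_integral_map_pmf
  proof (intro nn_integral_cong arg_cong[where f="\<lambda>z. ennreal (exp (real (card z)))"] Collect_cong conj_cong refl)
    fix H u assume "u \<in> ?U"
    then have "{u, v} \<in> ?f v ` ?U" "{u, w} \<in> ?f w ` ?U" by blast+
    then show "({u, v} \<in> H) = ({u, v} \<in> H \<inter> (?f v ` ?U \<union> ?f w ` ?U))"
      "({u, w} \<in> H) = ({u, w} \<in> H \<inter> (?f v ` ?U \<union> ?f w ` ?U))" by blast+
  qed
  also have "\<dots> = (\<integral>\<^sup>+C. (\<integral>\<^sup>+D. ennreal (exp (1 * real (card (D \<inter> C)))) \<partial>?R) \<partial>?R)"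
    unfolding law nn_integral_map_pmf nn_integral_pair_pmf'
  proof (intro nn_integral_cong_AE AE_pmfI)
    fix C D assume "C \<in> set_pmf ?R" "D \<in> set_pmf ?R"
    then have CD: "C \<subseteq> ?U" "D \<subseteq> ?U" by (blast dest: random_subset_subset)+
    have mem: "{u, v} \<in> ?f v ` C \<union> ?f w ` D \<longleftrightarrow> u \<in> C" "{u, w} \<in> ?f v ` C \<union> ?f w ` D \<longleftrightarrow> u \<in> D"
      if "u \<in> ?U" for u
    proof -
      have "({u, v} = {c, v}) = (u = c)" "({u, w} = {c, w}) = (u = c)" "{u, v} \<noteq> {c, w}" "{u, w} \<noteq> {c, v}" for c
        using that assms(3) by (auto simp: doubleton_eq_iff)
      then show "{u, v} \<in> ?f v ` C \<union> ?f w ` D \<longleftrightarrow> u \<in> C" "{u, w} \<in> ?f v ` C \<union> ?f w ` D \<longleftrightarrow> u \<in> D"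
        by (simp_all add: image_iff)
    qed
    have "{u \<in> ?U. {u, v} \<in> ?f v ` C \<union> ?f w ` D \<and> {u, w} \<in> ?f v ` C \<union> ?f w ` D} = {u \<in> ?U. u \<in> C \<and> u \<in> D}"
      by (intro Collect_cong conj_cong refl mem)
    also have "\<dots> = D \<inter> C" using CD by blast
    finally have "{u \<in> ?U. {u, v} \<in> ?f v ` C \<union> ?f w ` D \<and> {u, w} \<in> ?f v ` C \<union> ?f w ` D} = D \<inter> C" .
    then show "ennreal (exp (real (?c (case (C, D) of (C, D) \<Rightarrow> ?f v ` C \<union> ?f w ` D)))) =
       ennreal (exp (1 * real (card (D \<inter> C))))" by simp
  qed
  also have "\<dots> = (\<integral>\<^sup>+C. ennreal (\<Prod>x\<in>C. 1 - p + p * exp 1) \<partial>?R)"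
  proof (intro nn_integral_cong_AE AE_pmfI)
    fix C assume "C \<in> set_pmf ?R"
    then have "C \<subseteq> ?U" by (rule random_subset_subset)
    then show "(\<integral>\<^sup>+D. ennreal (exp (1 * real (card (D \<inter> C)))) \<partial>?R) = ennreal (\<Prod>x\<in>C. 1 - p + p * exp 1)"
      using expectation_random_subset_exp_card[OF p finU, of C 1]
      by (subst nn_integral_finite_pmf) auto
  qed
  also have "\<dots> = ennreal (\<Prod>x\<in>?U. 1 - p + p * (1 - p + p * exp 1))"
    using p by (subst nn_integral_finite_pmf) (auto intro!: prod_nonneg simp: expectation_random_subset_prod)
  also have "\<dots> \<le> ennreal (exp (2 * real n * p\<^sup>2))"
  proof (rule ennreal_leI)
    have "1 - p + p * (1 - p + p * exp 1) = 1 + p\<^sup>2 * (exp 1 - 1)" by (simp add: power2_eq_square algebra_simps)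
    also have "\<dots> \<le> 1 + p\<^sup>2 * 2" using exp_le by (intro add_left_mono mult_left_mono) auto
    also have "\<dots> \<le> exp (2 * p\<^sup>2)" using exp_ge_add_one_self[of "2 * p\<^sup>2"] by linarith
    finally have *: "1 - p + p * (1 - p + p * exp 1) \<le> exp (2 * p\<^sup>2)" .
    have "(\<Prod>x\<in>?U. 1 - p + p * (1 - p + p * exp 1)) \<le> (\<Prod>x\<in>?U. exp (2 * p\<^sup>2))"
      using p * by (intro prod_mono) auto
    also have "\<dots> = exp (real (card ?U) * (2 * p\<^sup>2))" by (simp add: exp_of_nat_mult)
    also have "\<dots> \<le> exp (real n * (2 * p\<^sup>2))"
      using card_mono[of "{1..n}" ?U] by (intro exp_le_cancel_iff[THEN iffD2] mult_right_mono) auto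
    finally show "(\<Prod>x\<in>?U. 1 - p + p * (1 - p + p * exp 1)) \<le> exp (2 * real n * p\<^sup>2)"
      by (simp add: mult_ac)
  qed
  finally have mgf: "(\<integral>\<^sup>+H. ennreal (exp (real (?c H))) \<partial>erdos_renyi n p) \<le> ennreal (exp (2 * real n * p\<^sup>2))" .
  show ?thesis
  proof (rule prob_le_nn_integral)
    have "(\<integral>\<^sup>+H. ennreal (exp (- 4 * real n * p\<^sup>2)) * ennreal (exp (real (?c H))) \<partial>erdos_renyi n p)
      \<le> ennreal (exp (- 4 * real n * p\<^sup>2)) * ennreal (exp (2 * real n * p\<^sup>2))"
      by (subst nn_integral_cmult, simp, rule mult_left_mono[OF mgf]) simp
    also have "\<dots> = ennreal (exp (- 2 * real n * p\<^sup>2))"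
      by (simp add: ennreal_mult[symmetric] exp_add[symmetric])
    finally show "(\<integral>\<^sup>+H. ennreal (exp (- 4 * real n * p\<^sup>2)) * ennreal (exp (real (?c H))) \<partial>erdos_renyi n p) \<le> \<dots>" .
    fix H assume H: "H \<in> set_pmf (erdos_renyi n p)" "H \<in> {H. real (card {u. {u, v} \<in> H \<and> {u, w} \<in> H}) > 4 * real n * p\<^sup>2}"
    have "H \<subseteq> vertex_pairs n" using H(1) set_erdos_renyi by (auto simp: simple_graphs_def)
    then have "u \<in> {1..n} \<and> u \<noteq> x" if "{u, x} \<in> H" for u x
      using that doubleton_vertex_pairs by blast
    then have "{u. {u, v} \<in> H \<and> {u, w} \<in> H} = {u \<in> ?U. {u, v} \<in> H \<and> {u, w} \<in> H}"
      by blast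
    then have "0 \<le> - 4 * real n * p\<^sup>2 + real (?c H)" using H(2) by simp
    then show "1 \<le> ennreal (exp (- 4 * real n * p\<^sup>2)) * ennreal (exp (real (?c H)))"
      by (simp add: ennreal_mult[symmetric] exp_add[symmetric])
  qed simp
qed

lemma prob_not_codegree_upper:
  "measure_pmf.prob (erdos_renyi n p) {H. \<not> codegree_upper p n H} \<le> real n * real n * exp (- 2 * real n * p\<^sup>2)"
proof -
  let ?M = "erdos_renyi n p"
  let ?I = "{(v, w). v \<in> {1..n} \<and> w \<in> {1..n} \<and> v \<noteq> w}"
  let ?bad = "\<lambda>(v, w). {H. real (card {u. {u, v} \<in> H \<and> {u, w} \<in> H}) > 4 * real n * p\<^sup>2}"
  have fin: "finite ?I" by (rule finite_subset[of _ "{1..n} \<times> {1..n}"]) auto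
  have "{H. \<not> codegree_upper p n H} \<subseteq> (\<Union>z\<in>?I. ?bad z)"
  proof
    fix H assume "H \<in> {H. \<not> codegree_upper p n H}"
    then obtain v w where "(v, w) \<in> ?I" "H \<in> ?bad (v, w)"
      unfolding codegree_upper_def mem_Collect_eq not_le case_prod_conv not_all not_imp bex_simps by force
    then show "H \<in> (\<Union>z\<in>?I. ?bad z)" by (rule UN_I)
  qed
  then have "measure_pmf.prob ?M {H. \<not> codegree_upper p n H} \<le> measure_pmf.prob ?M (\<Union>z\<in>?I. ?bad z)"
    by (intro measure_pmf.finite_measure_mono) auto
  also have "\<dots> \<le> (\<Sum>z\<in>?I. measure_pmf.prob ?M (?bad z))"
    by (intro measure_pmf.finite_measure_subadditive_finite fin) auto
  also have "\<dots> \<le> (\<Sum>z\<in>?I. exp (- 2 * real n * p\<^sup>2))"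
  proof (rule sum_mono)
    fix z assume "z \<in> ?I"
    then show "measure_pmf.prob ?M (?bad z) \<le> exp (- 2 * real n * p\<^sup>2)"
      using prob_codegree[of "fst z" n "snd z"] by (auto simp: case_prod_unfold)
  qed
  also have "\<dots> \<le> (\<Sum>z\<in>{1..n}\<times>{1..n}. exp (- 2 * real n * p\<^sup>2))"
    by (intro sum_mono2) auto
  finally show ?thesis by (simp add: card_cartesian_product)
qed

end


section \<open>Exponential moments of online algorithms\<close>

text \<open>Summation by parts. Only partial sums of \<open>d\<close> can be bounded, since a rule
  may distribute the degrees over the steps as it likes; decreasing weights turn this into a bound
  for the weighted sum.\<close>

lemma sum_decreasing_weights_le:
  fixes a d :: "nat \<Rightarrow> real"
  assumes "decseq a" "\<And>k. 0 \<le> a k" "0 \<le> b" "\<And>m. m \<le> n \<Longrightarrow> (\<Sum>k<m. d k) \<le> b"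
  shows "(\<Sum>k<n. a k * d k) \<le> b * a 0"
proof (cases n)
  case 0
  with assms show ?thesis by simp
next
  case (Suc m)
  \<comment> \<open>Subtracting the boundary term makes the inequality inductive; it is added back
    at the end.\<close>
  have "(\<Sum>k<Suc j. a k * d k) - a j * (\<Sum>k<Suc j. d k) \<le> b * (a 0 - a j)" if "Suc j \<le> n" for j
    using that
  proof (induction j)
    case (Suc j)
    have "(a j - a (Suc j)) * (\<Sum>k<Suc j. d k) \<le> (a j - a (Suc j)) * b"
      using assms(1) Suc.prems by (intro mult_left_mono assms(4)) (auto simp: decseq_Suc_iff)
    then show ?case using Suc by (simp add: algebra_simps)
  qed simp
  from this[of m] have "(\<Sum>k<n. a k * d k) \<le> b * (a 0 - a m) + a m * (\<Sum>k<n. d k)"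
    using Suc by simp
  also have "\<dots> \<le> b * (a 0 - a m) + a m * b"
    using assms by (intro add_left_mono mult_left_mono) auto
  finally show ?thesis by (simp add: algebra_simps)
qed

text \<open>A rule can choose among at most \<open>n\<close> vertices, which costs the term \<open>ln n / t\<close>. Since
  \<open>exp (\<theta> z) \<le> 1 + exp (t z)\<close> for \<open>0 \<le> \<theta> \<le> t\<close>, each step may use its own optimal \<open>t\<close>
  although the product over all steps needs a common \<open>\<theta>\<close>.\<close>

definition excess :: "nat \<Rightarrow> graph \<Rightarrow> real \<Rightarrow> real \<Rightarrow> nat list \<Rightarrow> nat \<Rightarrow> nat set \<Rightarrow> real" where
  "excess n H p t xs v C = real (card (C \<inter> back_nbrs H xs v)) - real (card (back_nbrs H xs v)) * p
     - (ln (real n) + real (card (back_nbrs H xs v)) * p * (exp t - 1 - t)) / t"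

context
  fixes n :: nat and P :: online_rule and H :: graph and p :: real
  assumes P: "valid_online_rule n P" and H: "H \<in> simple_graphs n" and p: "0 \<le> p" "p \<le> 1"
begin

lemma back_nbrs_subset: "xs \<in> partial_inj n k \<Longrightarrow> back_nbrs H xs v \<subseteq> {1..k}"
  by (auto simp: back_nbrs_def partial_inj_def)

text \<open>The choice may depend on the revealed column, so its weight is replaced by the sum over
  all \<open>n\<close> vertices, whose sets \<open>back_nbrs\<close> are fixed before the column is
  drawn. The normalisation in \<open>excess\<close> gives each summand a mean of at most
  \<open>1 / n\<close>; together with the constant 1 this makes 2.\<close>

lemma exp_moment_excess_le:
  assumes "k < n" "xs \<in> partial_inj n k" "G \<in> simple_graphs k" "0 \<le> \<theta>" "\<theta> \<le> t" "0 < t"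
  shows "(\<integral>\<^sup>+C. (\<integral>\<^sup>+v. ennreal (exp (\<theta> * excess n H p t xs v C)) \<partial>P (Suc k) (G \<union> new_edges k C) H xs)
       \<partial>random_subset {1..k} p) \<le> 2"
proof -
  let ?R = "random_subset {1..k} p"
  let ?N = "\<lambda>v. real (card (back_nbrs H xs v))"
  let ?h = "\<lambda>C. 1 + (\<Sum>v\<in>{1..n}. exp (t * excess n H p t xs v C))"
  have "(\<integral>\<^sup>+C. (\<integral>\<^sup>+v. ennreal (exp (\<theta> * excess n H p t xs v C)) \<partial>P (Suc k) (G \<union> new_edges k C) H xs) \<partial>?R)
     \<le> (\<integral>\<^sup>+C. (\<integral>\<^sup>+v. ennreal (?h C) \<partial>P (Suc k) (G \<union> new_edges k C) H xs) \<partial>?R)"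
  proof (intro nn_integral_mono_AE AE_pmfI ennreal_leI)
    fix C v assume C: "C \<in> set_pmf ?R" and v: "v \<in> set_pmf (P (Suc k) (G \<union> new_edges k C) H xs)"
    have "G \<union> new_edges k C \<in> simple_graphs n"
      using union_new_edges_simple[OF assms(3) random_subset_subset[OF C]] simple_graphs_mono[of "Suc k" n] assms(1)
      by auto
    then have "v \<in> {1..n}"
      using valid_online_ruleD(1)[OF P assms(1) H assms(2)] v by blast
    then have "exp (t * excess n H p t xs v C) \<le> (\<Sum>v\<in>{1..n}. exp (t * excess n H p t xs v C))"
      by (intro member_le_sum) auto
    moreover have "exp (\<theta> * excess n H p t xs v C) \<le> 1 + exp (t * excess n H p t xs v C)"
    proof (cases "excess n H p t xs v C \<ge> 0")
      case True
      then have "exp (\<theta> * excess n H p t xs v C) \<le> exp (t * excess n H p t xs v C)"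
        using assms by (auto intro: mult_right_mono)
      then show ?thesis by linarith
    next
      case False
      then have "exp (\<theta> * excess n H p t xs v C) \<le> 1"
        using assms by (simp add: mult_nonneg_nonpos)
      then show ?thesis using exp_ge_zero[of "t * excess n H p t xs v C"] by linarith
    qed
    ultimately show "exp (\<theta> * excess n H p t xs v C) \<le> ?h C" by linarith
  qed
  also have "\<dots> = (\<integral>\<^sup>+C. ennreal (?h C) \<partial>?R)" by simp
  also have "\<dots> = ennreal (measure_pmf.expectation ?R ?h)"
    by (intro nn_integral_finite_pmf) (auto intro!: add_nonneg_nonneg sum_nonneg)
  also have "measure_pmf.expectation ?R ?h \<le> 2"
  proof -
  have "measure_pmf.expectation ?R ?h = 1 + (\<Sum>v\<in>{1..n}. measure_pmf.expectation ?R (\<lambda>C. exp (t * excess n H p t xs v C)))"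
      by (subst Bochner_Integration.integral_add) (auto intro!: integrable_measure_pmf_finite Bochner_Integration.integral_sum)
    also have "\<dots> \<le> 1 + (\<Sum>v\<in>{1..n}. 1 / real n)"
    proof (intro add_left_mono sum_mono)
      fix v
      have "exp (t * excess n H p t xs v C) = exp (- ln (real n) - ?N v * p * (exp t - 1)) * exp (t * real (card (C \<inter> back_nbrs H xs v)))" for C
        using assms(6) by (simp add: excess_def exp_add[symmetric] field_simps)
      then have "measure_pmf.expectation ?R (\<lambda>C. exp (t * excess n H p t xs v C)) =
        exp (- ln (real n) - ?N v * p * (exp t - 1)) * measure_pmf.expectation ?R (\<lambda>C. exp (t * real (card (C \<inter> back_nbrs H xs v))))"
        by simp
      also have "\<dots> \<le> exp (- ln (real n) - ?N v * p * (exp t - 1)) * exp (?N v * p * (exp t - 1))"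
        using back_nbrs_subset[OF assms(2)] by (intro mult_left_mono expectation_random_subset_exp_card_le p) auto
      also have "\<dots> = 1 / real n"
        using assms(1) by (simp add: exp_add[symmetric] exp_minus inverse_eq_divide)
      finally show "measure_pmf.expectation ?R (\<lambda>C. exp (t * excess n H p t xs v C)) \<le> 1 / real n" .
    qed
    also have "\<dots> = 2" using assms(1) by simp
    finally show ?thesis .
    qed
  finally show ?thesis by (simp add: ennreal_leI)
qed

lemma prob_sum_excess_ge:
  assumes "0 \<le> \<theta>" "\<And>k. k < n \<Longrightarrow> \<theta> \<le> t k" "\<And>k. k < n \<Longrightarrow> 0 < t k"
  shows "measure_pmf.prob (partial_run P H p n)
      {(G, xs). (\<Sum>k<n. excess n H p (t k) (take k xs) (xs ! k) (new_nbrs G k)) \<ge> a} \<le> 2 ^ n * exp (- \<theta> * a)"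
proof -
  let ?F = "\<lambda>G xs. \<Sum>k<n. excess n H p (t k) (take k xs) (xs ! k) (new_nbrs G k)"
  \<comment> \<open>The weight sees only the list, so the step number is recovered as its
    length.\<close>
  let ?w = "\<lambda>xs v C. ennreal (exp (\<theta> * excess n H p (t (length xs)) xs v C))"
  have "(\<integral>\<^sup>+(G, xs). ennreal (exp (- \<theta> * a)) * (\<Prod>j<n. ?w (take j xs) (xs ! j) (new_nbrs G j)) \<partial>partial_run P H p n)
     = ennreal (exp (- \<theta> * a)) * (\<integral>\<^sup>+(G, xs). (\<Prod>j<n. ?w (take j xs) (xs ! j) (new_nbrs G j)) \<partial>partial_run P H p n)"
    by (simp add: case_prod_unfold nn_integral_cmult)
  also have "\<dots> \<le> ennreal (exp (- \<theta> * a)) * 2 ^ n"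
  proof (intro mult_left_mono nn_integral_partial_run_prod[OF P H])
    fix k xs G assume *: "k < n" "xs \<in> partial_inj n k" "G \<in> simple_graphs k"
    then have "length xs = k" by (simp add: partial_inj_def)
    then show "(\<integral>\<^sup>+C. (\<integral>\<^sup>+v. ?w xs v C \<partial>P (Suc k) (G \<union> new_edges k C) H xs) \<partial>random_subset {1..k} p) \<le> 2"
      using * assms by (simp only:) (intro exp_moment_excess_le, auto)
  qed auto
  also have "\<dots> = ennreal (2 ^ n * exp (- \<theta> * a))"
    by (simp add: ennreal_mult ennreal_power[symmetric] mult.commute)
  finally have le: "(\<integral>\<^sup>+(G, xs). ennreal (exp (- \<theta> * a)) * (\<Prod>j<n. ?w (take j xs) (xs ! j) (new_nbrs G j)) \<partial>partial_run P H p n)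
    \<le> ennreal (2 ^ n * exp (- \<theta> * a))" .
  show ?thesis
  proof (rule prob_le_nn_integral[OF _ le])
    fix z assume z: "z \<in> set_pmf (partial_run P H p n)" "z \<in> {(G, xs). ?F G xs \<ge> a}"
    obtain G xs where Gxs: "z = (G, xs)" by (cases z)
    have len: "length xs = n" using z set_partial_run[OF P _ H, of n p] unfolding Gxs by (auto simp: partial_inj_def)
    have "(\<Prod>j<n. ?w (take j xs) (xs ! j) (new_nbrs G j)) = ennreal (exp (\<theta> * ?F G xs))"
      using len by (subst prod_ennreal) (auto simp: exp_sum[symmetric] sum_distrib_left intro!: arg_cong[where f=ennreal] prod.cong)
    then have "ennreal (exp (- \<theta> * a)) * (\<Prod>j<n. ?w (take j xs) (xs ! j) (new_nbrs G j)) = ennreal (exp (\<theta> * (?F G xs - a)))"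
      by (simp add: ennreal_mult[symmetric] exp_add[symmetric] algebra_simps)
    also have "\<dots> \<ge> 1" using z assms(1) unfolding Gxs by simp
    finally show "1 \<le> (case z of (G, xs) \<Rightarrow> ennreal (exp (- \<theta> * a)) * (\<Prod>j<n. ?w (take j xs) (xs ! j) (new_nbrs G j)))"
      unfolding Gxs by simp
  qed simp
qed

text \<open>With \<open>N k\<close> the back degree at step \<open>k\<close>, the centred overlap
  consists of the excesses, of the terms subtracted in \<open>excess\<close>, and of
  \<open>p * (N k - k * p)\<close>. Every occurrence of \<open>N k\<close> is compared with
  \<open>k * p\<close>: \<open>edges_upper\<close> bounds the differences over each prefix of
  \<open>xs\<close>, and \<open>sum_decreasing_weights_le\<close> brings in the weights.\<close>

lemma centered_overlap_le_excess:
  assumes "edges_upper p n H" "xs \<in> partial_inj n n" "decseq a" "\<And>k. 0 \<le> a k"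
    and "\<And>k. k < n \<Longrightarrow> 0 < t k" "\<And>k. k < n \<Longrightarrow> (exp (t k) - 1 - t k) / t k \<le> a k"
  shows "centered_overlap n p G H (perm_of_list xs) \<le>
     (\<Sum>k<n. excess n H p (t k) (take k xs) (xs ! k) (new_nbrs G k)) + (\<Sum>k<n. ln (real n) / t k)
     + p\<^sup>2 * (\<Sum>k<n. a k * real k) + 2 * real n * sqrt (real n * p) * p * (1 + a 0)"
proof -
  define b where "b = 2 * real n * sqrt (real n * p)"
  define N where "N k = real (card (back_nbrs H (take k xs) (xs ! k)))" for k
  have b: "0 \<le> b" using p by (simp add: b_def)
  have xs: "length xs = n" "distinct xs" "set xs \<subseteq> {1..n}" using assms(2) by (auto simp: partial_inj_def)
  have partial: "(\<Sum>k<m. N k - real k * p) \<le> b" if "m \<le> n" for m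
  proof -
    have tk: "length (take m xs) = m" "distinct (take m xs)" "set (take m xs) \<subseteq> {1..n}"
      using xs that set_take_subset[of m xs] by auto
    have "(\<Sum>k<m. N k) = (\<Sum>k<length (take m xs). real (card (back_nbrs H (take k (take m xs)) (take m xs ! k))))"
      using tk that by (auto simp: N_def min_def intro!: sum.cong)
    also have "\<dots> = real (card {e \<in> H. e \<subseteq> set (take m xs)})"
      using sum_card_back_nbrs[OF H tk(2)] by (simp flip: of_nat_sum)
    also have "\<dots> \<le> real (card (set (take m xs)) choose 2) * p + b"
      using assms(1)[unfolded edges_upper_def, rule_format, OF tk(3)] by (simp add: b_def)
    also have "card (set (take m xs)) = m" using tk distinct_card by metis
    also have "real (m choose 2) = (\<Sum>k<m. real k)"
      by (simp add: gbinomial_sum_lower_neg Sum_Ico_nat choose_two lessThan_atLeast0 flip: of_nat_sum)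
    finally show ?thesis by (simp add: sum_subtractf sum_distrib_right)
  qed
  have "(\<Sum>k<n. a k * (N k - real k * p)) \<le> b * a 0"
    using assms b partial by (intro sum_decreasing_weights_le) auto
  then have "p * (\<Sum>k<n. a k * (N k - real k * p)) \<le> p * (b * a 0)" by (rule mult_left_mono) (rule p)
  moreover have "p * (\<Sum>k<n. N k - real k * p) \<le> p * b" using partial[of n] p by (intro mult_left_mono) auto
  moreover have "(\<Sum>k<n. p * (p * real k)) = p * (p * real (n choose 2))"
    by (simp add: Sum_Ico_nat choose_two lessThan_atLeast0 flip: of_nat_sum sum_distrib_left)
  moreover have "(\<Sum>k<n. N k * p * (exp (t k) - 1 - t k) / t k) \<le> (\<Sum>k<n. N k * p * a k)"
    using assms p by (intro sum_mono) (auto simp: N_def simp flip: times_divide_eq_right intro!: mult_left_mono)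
  moreover have "real (overlap n G H (perm_of_list xs)) = (\<Sum>k<n. excess n H p (t k) (take k xs) (xs ! k) (new_nbrs G k)
      + ln (real n) / t k + N k * p * (exp (t k) - 1 - t k) / t k + N k * p)"
    unfolding overlap_eq_sum_score[OF xs(1)] of_nat_sum
    using xs(1) by (intro sum.cong refl) (simp add: score_def excess_def N_def min_def add_divide_distrib)
  ultimately show ?thesis
    by (simp add: centered_overlap_def sum.distrib sum_subtractf sum_distrib_left sum_distrib_right b_def
        power2_eq_square algebra_simps)
qed

end


section \<open>Failure above the threshold\<close>

text \<open>Comparison with the integral of the square root. For consecutive roots with
  \<open>b^2 = a^2 + 1\<close> the increment inequality amounts to
  \<open>(b - a)^2 * (2 * b + a) >= 0\<close>. The shift \<open>c\<close> will be
  \<open>\<delta> n\<close>.\<close>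

lemma sqrt_sum_upper: "0 \<le> c \<Longrightarrow> (\<Sum>k<n. sqrt (real k + c)) \<le> 2 / 3 * ((real n + c) * sqrt (real n + c))"
proof (induction n)
  case (Suc n)
  define a b where "a = sqrt (real n + c)" and "b = sqrt (real n + c + 1)"
  have ab: "0 \<le> a" "a \<le> b" "b\<^sup>2 = a\<^sup>2 + 1" "0 < b" using Suc.prems by (auto simp: a_def b_def)
  have "3 * a * (b\<^sup>2 - a\<^sup>2) \<le> 2 * (b * b\<^sup>2 - a * a\<^sup>2)"
  proof -
    have "2 * (b * b\<^sup>2 - a * a\<^sup>2) - 3 * a * (b\<^sup>2 - a\<^sup>2) = (b - a)\<^sup>2 * (2 * b + a)"
      by (simp add: power2_eq_square algebra_simps)
    also have "\<dots> \<ge> 0" using ab by simp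
    finally show ?thesis by simp
  qed
  then have "a \<le> 2 / 3 * (b * b\<^sup>2 - a * a\<^sup>2)" using ab by simp
  moreover have "b\<^sup>2 = real n + c + 1" "a\<^sup>2 = real n + c" using Suc.prems by (auto simp: a_def b_def)
  ultimately have "sqrt (real n + c) \<le> 2 / 3 * ((real n + c + 1) * sqrt (real n + c + 1) - (real n + c) * sqrt (real n + c))"
    unfolding a_def[symmetric] b_def[symmetric] by (simp add: mult.commute)
  then show ?case using Suc by (simp add: add_ac algebra_simps)
qed simp

lemma sqrt_sum_lower: "2 / 3 * (real n * sqrt (real n)) \<le> (\<Sum>k<Suc n. sqrt (real k))"
proof (induction n)
  case (Suc n)
  define a b where "a = sqrt (real n)" and "b = sqrt (real n + 1)"
  have ab: "0 \<le> a" "a \<le> b" "b\<^sup>2 = a\<^sup>2 + 1" "0 < b" by (auto simp: a_def b_def)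
  have "2 * (b * b\<^sup>2 - a * a\<^sup>2) \<le> 3 * b * (b\<^sup>2 - a\<^sup>2)"
  proof -
    have "3 * b * (b\<^sup>2 - a\<^sup>2) - 2 * (b * b\<^sup>2 - a * a\<^sup>2) = (b - a)\<^sup>2 * (b + 2 * a)"
      by (simp add: power2_eq_square algebra_simps)
    also have "\<dots> \<ge> 0" using ab by simp
    finally show ?thesis by simp
  qed
  then have "2 / 3 * (b * b\<^sup>2 - a * a\<^sup>2) \<le> b" using ab by simp
  moreover have "b\<^sup>2 = real n + 1" "a\<^sup>2 = real n" by (auto simp: a_def b_def)
  ultimately have "2 / 3 * ((real n + 1) * sqrt (real n + 1) - real n * sqrt (real n)) \<le> sqrt (real n + 1)"
    unfolding a_def[symmetric] b_def[symmetric] by (simp add: mult.commute)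
  then show ?case using Suc by (simp add: add_ac algebra_simps)
qed simp

lemma exp_minus_one_minus_le:
  fixes t :: real
  assumes "0 < t" "2 * t \<le> d" "d \<le> 1"
  shows "(exp t - 1 - t) / t \<le> (1 + d) * t / 2"
proof -
  obtain s where s: "\<bar>s\<bar> \<le> \<bar>t\<bar>" "exp t = (\<Sum>m<2. t ^ m / fact m) + exp s / fact 2 * t ^ 2"
    using Maclaurin_exp_le[of t 2] by blast
  have "s \<le> t" using s(1) assms by simp
  then have "exp s \<le> exp t" by simp
  also have "\<dots> \<le> 1 + t + t\<^sup>2" using assms by (intro exp_bound) auto
  also have "t\<^sup>2 \<le> t * 1" unfolding power2_eq_square using assms by (intro mult_left_mono) auto
  finally have "exp s \<le> 1 + d" using assms by simp
  then have "exp s * t / 2 \<le> (1 + d) * t / 2" using assms by (intro mult_right_mono divide_right_mono) auto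
  moreover have "exp t - 1 - t = exp s * t / 2 * t" using s(2) by (simp add: numeral_2_eq_2)
  then have "(exp t - 1 - t) / t = exp s * t / 2" using assms by simp
  ultimately show ?thesis by simp
qed

lemma scale_D_eq: "0 \<le> p \<Longrightarrow> scale_D n p = p * (real n * sqrt (real n)) * sqrt (ln (real n))"
  by (simp add: scale_D_def real_sqrt_mult power3_eq_cube mult_ac)

lemma beta_c_eq': "beta_c = 2 * sqrt 2 / 3"
proof -
  have "sqrt (8 / 9) = sqrt (4 * 2) / sqrt 9" by (simp add: real_sqrt_divide)
  also have "\<dots> = 2 * sqrt 2 / 3" unfolding real_sqrt_mult by simp
  finally show ?thesis using beta_c_eq by simp
qed

text \<open>Minimising \<open>L / t + k * p^2 * t / 2\<close>, where \<open>L\<close> is ln n, gives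
  the tilt \<open>sqrt (2 * L / k) / p\<close> and the value \<open>p * sqrt (2 * k * L)\<close>,
  whose sum is about \<open>beta_c * scale_D n p\<close>. Replacing \<open>k\<close> by
  \<open>k + \<delta> n\<close> keeps all tilts small; together with the Taylor error this costs the
  factor \<open>1 + 7 \<delta>\<close>, and the error in the edge counts costs
  \<open>4 / sqrt L\<close>. Since \<open>k + \<delta> n <= 2 n\<close>, the value
  \<open>\<rho>\<close> lies below all tilts and can serve as the common exponent.\<close>

lemma compensator_le:
  fixes p \<delta> :: real and n :: nat
  defines "\<rho> \<equiv> sqrt (ln (real n) / real n) / p"
  defines "t \<equiv> \<lambda>k. sqrt (2 * real n / (real k + \<delta> * real n)) * \<rho>"
  assumes "2 \<le> n" "0 < p" "p \<le> 1" "0 < \<delta>" "\<delta> \<le> 1" "2 * (sqrt (2 / \<delta>) * \<rho>) \<le> \<delta>"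
  shows "(\<Sum>k<n. ln (real n) / t k) + p\<^sup>2 * (\<Sum>k<n. (1 + \<delta>) * t k / 2 * real k)
     + 2 * real n * sqrt (real n * p) * p * (1 + (1 + \<delta>) * t 0 / 2)
     \<le> (beta_c * (1 + 7 * \<delta>) + 4 / sqrt (ln (real n))) * scale_D n p"
    and "\<And>k. 0 < t k" "decseq (\<lambda>k. (1 + \<delta>) * t k / 2)"
    "\<And>k. (exp (t k) - 1 - t k) / t k \<le> (1 + \<delta>) * t k / 2" "\<And>k. k < n \<Longrightarrow> \<rho> \<le> t k"
proof -
  define L where "L = ln (real n)"
  have n: "0 < real n" using assms by simp
  have L: "0 < L" using assms by (simp add: L_def)
  have \<rho>: "0 < \<rho>" using assms L by (simp add: \<rho>_def L_def)
  show t: "0 < t k" for k using \<rho> n assms by (simp add: t_def add_nonneg_pos)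
  have pos: "0 < real k + \<delta> * real n" for k using n assms by (simp add: add_nonneg_pos)
  have t_mono: "t k \<le> t j" if "j \<le> k" for j k
    unfolding t_def using that \<rho> n assms
    by (intro mult_right_mono real_sqrt_le_mono divide_left_mono mult_pos_pos pos) auto
  then show "decseq (\<lambda>k. (1 + \<delta>) * t k / 2)"
    using \<open>0 < \<delta>\<close> unfolding decseq_def by (intro allI impI divide_right_mono mult_left_mono) auto
  have t0: "t 0 = sqrt (2 / \<delta>) * \<rho>" using n by (simp add: t_def)
  have t_le: "2 * t k \<le> \<delta>" for k using t_mono[of 0 k] assms t0 by simp
  show "(exp (t k) - 1 - t k) / t k \<le> (1 + \<delta>) * t k / 2" for k
    using t t_le assms by (intro exp_minus_one_minus_le) auto
  show "\<rho> \<le> t k" if "k < n" for k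
  proof -
    have "real k + \<delta> * real n \<le> 2 * real n" using that n assms mult_right_mono[of \<delta> 1 "real n"] by linarith
    then have "1 \<le> 2 * real n / (real k + \<delta> * real n)"
      using n assms by (subst le_divide_eq_1_pos) (auto intro: add_nonneg_pos)
    then have "1 \<le> sqrt (2 * real n / (real k + \<delta> * real n))" by simp
    then show ?thesis using \<rho> by (simp add: t_def)
  qed
  define q where "q k = sqrt (real k + \<delta> * real n)" for k
  have q: "0 < q k" for k using n assms by (simp add: q_def add_nonneg_pos)
  have q2: "q k * q k = real k + \<delta> * real n" for k using n assms by (simp add: q_def add_nonneg_nonneg)
  have tq: "t k = sqrt 2 * sqrt L / (p * q k)" for k
    using n assms by (simp add: t_def \<rho>_def L_def real_sqrt_divide real_sqrt_mult q_def)
  have s2: "sqrt 2 * sqrt 2 = (2::real)" by simp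
  have LL: "sqrt L * sqrt L = L" using L by simp
  have 1: "L / t k = p * sqrt L * q k / sqrt 2" for k
    using L q[of k] assms unfolding tq by (simp add: field_simps LL)
  \<comment> \<open>Enlarging \<open>k\<close> to the square of \<open>q k\<close> makes this term a
    multiple of \<open>q k\<close>, like the one in the previous fact.\<close>
  have 2: "p\<^sup>2 * ((1 + \<delta>) * t k / 2 * real k) \<le> (1 + \<delta>) * (p * sqrt L * q k / sqrt 2)" for k
  proof -
    have "p\<^sup>2 * ((1 + \<delta>) * t k / 2 * real k) \<le> p\<^sup>2 * ((1 + \<delta>) * t k / 2 * (q k * q k))"
      using t[of k] n assms unfolding q2 by (intro mult_left_mono) auto
    also have "\<dots> = (1 + \<delta>) * (p * sqrt L * q k * (sqrt 2 / 2))"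
      using q[of k] assms unfolding tq by (simp add: field_simps power2_eq_square)
    also have "sqrt 2 / 2 = 1 / sqrt 2" by (simp add: field_simps)
    finally show ?thesis by simp
  qed
  have "(\<Sum>k<n. L / t k) + p\<^sup>2 * (\<Sum>k<n. (1 + \<delta>) * t k / 2 * real k)
     \<le> (\<Sum>k<n. p * sqrt L * q k / sqrt 2) + (\<Sum>k<n. (1 + \<delta>) * (p * sqrt L * q k / sqrt 2))"
    unfolding sum_distrib_left 1 by (intro add_left_mono sum_mono 2)
  also have "\<dots> = (2 + \<delta>) / sqrt 2 * p * sqrt L * (\<Sum>k<n. q k)"
  proof -
    have "(\<Sum>k<n. p * sqrt L * q k / sqrt 2) = p * sqrt L / sqrt 2 * (\<Sum>k<n. q k)"
      by (simp add: sum_distrib_left)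
    then show ?thesis unfolding sum_distrib_left[symmetric] by (simp add: field_simps)
  qed
  also have "\<dots> \<le> (2 + \<delta>) / sqrt 2 * p * sqrt L * (2 / 3 * ((real n + \<delta> * real n) * sqrt (real n + \<delta> * real n)))"
    unfolding q_def using L assms(4,6) by (intro mult_left_mono sqrt_sum_upper) auto
  also have "real n + \<delta> * real n = (1 + \<delta>) * real n" by (simp add: algebra_simps)
  also have "2 / 3 * ((1 + \<delta>) * real n * sqrt ((1 + \<delta>) * real n)) = 2 / 3 * ((1 + \<delta>) * sqrt (1 + \<delta>)) * (real n * sqrt (real n))"
    by (simp add: real_sqrt_mult)
  also have "(2 + \<delta>) / sqrt 2 * p * sqrt L * (2 / 3 * ((1 + \<delta>) * sqrt (1 + \<delta>)) * (real n * sqrt (real n)))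
     = (2 / sqrt 2 * (2 / 3)) * ((1 + \<delta> / 2) * ((1 + \<delta>) * sqrt (1 + \<delta>))) * scale_D n p"
    using assms by (simp add: scale_D_eq L_def field_simps)
  also have "2 / sqrt 2 * (2 / 3) = beta_c"
    by (simp add: beta_c_eq' field_simps)
  also have "beta_c * ((1 + \<delta> / 2) * ((1 + \<delta>) * sqrt (1 + \<delta>))) * scale_D n p \<le> beta_c * (1 + 7 * \<delta>) * scale_D n p"
  proof (intro mult_right_mono mult_left_mono)
    show "0 \<le> beta_c" by (simp add: beta_c_eq')
    show "0 \<le> scale_D n p" using L assms(4) by (simp add: scale_D_eq L_def)
    \<comment> \<open>Each of the three factors is at most \<open>1 + \<delta>\<close>, and the cube
      of this is at most \<open>1 + 7 \<delta>\<close> because \<open>\<delta> <= 1\<close>.\<close>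
    have "sqrt (1 + \<delta>) \<le> 1 + \<delta>" using assms by (intro real_le_lsqrt) (auto simp: power2_eq_square algebra_simps)
    then have "(1 + \<delta> / 2) * ((1 + \<delta>) * sqrt (1 + \<delta>)) \<le> (1 + \<delta>) * ((1 + \<delta>) * (1 + \<delta>))"
      using assms by (intro mult_mono) auto
    also have "\<dots> = 1 + 3 * \<delta> + (3 * (\<delta> * \<delta>) + \<delta> * (\<delta> * \<delta>))" by (simp add: algebra_simps)
    also have "\<dots> \<le> 1 + 7 * \<delta>"
    proof -
      have "\<delta> * \<delta> \<le> \<delta> * 1" using assms by (intro mult_left_mono) auto
      moreover have "\<delta> * (\<delta> * \<delta>) \<le> \<delta> * (1 * 1)" using assms by (intro mult_left_mono mult_mono) auto
      ultimately show ?thesis by simp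
    qed
    finally show "(1 + \<delta> / 2) * ((1 + \<delta>) * sqrt (1 + \<delta>)) \<le> 1 + 7 * \<delta>" .
  qed
  finally have main: "(\<Sum>k<n. L / t k) + p\<^sup>2 * (\<Sum>k<n. (1 + \<delta>) * t k / 2 * real k)
     \<le> beta_c * (1 + 7 * \<delta>) * scale_D n p" .
  have D: "scale_D n p / sqrt L = p * (real n * sqrt (real n))"
    using L assms by (simp add: scale_D_eq L_def)
  have "(1 + \<delta>) * t 0 / 2 \<le> 2 * 1 / 2" 
    using t[of 0] t_le[of 0] \<open>\<delta> \<le> 1\<close> \<open>0 < \<delta>\<close> by (intro divide_right_mono mult_mono) linarith+
  then have "2 * real n * sqrt (real n * p) * p * (1 + (1 + \<delta>) * t 0 / 2) \<le> 2 * real n * (sqrt (real n) * 1) * p * 2"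
    unfolding real_sqrt_mult using assms(4-6) t[of 0] by (intro mult_mono add_nonneg_nonneg) auto
  also have "\<dots> = 4 * (scale_D n p / sqrt L)"
    unfolding D by simp
  finally show "(\<Sum>k<n. ln (real n) / t k) + p\<^sup>2 * (\<Sum>k<n. (1 + \<delta>) * t k / 2 * real k)
     + 2 * real n * sqrt (real n * p) * p * (1 + (1 + \<delta>) * t 0 / 2)
     \<le> (beta_c * (1 + 7 * \<delta>) + 4 / sqrt (ln (real n))) * scale_D n p"
    using main unfolding distrib_right by (simp add: L_def)
qed

section \<open>The dense regime, conditioning on \<open>H\<close>, and the impossibility
  theorem\<close>

lemma dense_regime_facts:
  assumes "dense_regime p"
  shows "0 \<le> p n" "p n \<le> 1" "(\<lambda>n. sqrt (ln (real n) / real n) / p n) \<longlonglongrightarrow> 0" "p \<longlonglongrightarrow> 0"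
    "\<forall>\<^sub>F n in sequentially. 0 < p n" "filterlim (\<lambda>n. real n * p n) at_top sequentially"
    "\<forall>\<^sub>F n in sequentially. c * ln (real n) \<le> real n * (p n)\<^sup>2"
proof -
  show p01: "0 \<le> p n" "p n \<le> 1" for n using assms by (auto simp: dense_regime_def)
  have o: "(\<lambda>n. sqrt (ln (real n) / real n)) \<in> o(p)" "p \<in> o(\<lambda>_. 1)" using assms by (auto simp: dense_regime_def)
  show lim: "(\<lambda>n. sqrt (ln (real n) / real n) / p n) \<longlonglongrightarrow> 0" using o(1) by (rule smalloD_tendsto)
  show "p \<longlonglongrightarrow> 0" using smalloD_tendsto[OF o(2)] by simp
  \<comment> \<open>The constant in the little-o condition is free, which yields every multiple of
    ln n; positivity of \<open>p n\<close> follows because it dominates a positive term.\<close>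
  have big: "\<forall>\<^sub>F n in sequentially. 0 < p n \<and> c * ln (real n) \<le> real n * (p n)\<^sup>2" for c
  proof -
    define C where "C = max c 1"
    have "C > 0" by (simp add: C_def)
    have "\<forall>\<^sub>F n in sequentially. norm (sqrt (ln (real n) / real n)) \<le> 1 / sqrt C * norm (p n)"
      using landau_o.smallD[OF o(1), of "1 / sqrt C"] \<open>C > 0\<close> by simp
    then show ?thesis using eventually_gt_at_top[of 2]
    proof eventually_elim
      case (elim n)
      have L: "0 < ln (real n)" using elim by simp
      have s: "sqrt (ln (real n) / real n) \<le> 1 / sqrt C * p n" using elim p01[of n] by simp
      moreover have "0 < sqrt (ln (real n) / real n)" using L elim by simp
      ultimately have "0 < 1 / sqrt C * p n" by linarith
      then have pos: "0 < p n" using \<open>C > 0\<close> by (simp add: zero_less_divide_iff)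
      have "(sqrt (ln (real n) / real n))\<^sup>2 \<le> (1 / sqrt C * p n)\<^sup>2" using s L elim by (intro power_mono) auto
      then have "ln (real n) / real n \<le> (p n)\<^sup>2 / C"
        using L elim \<open>C > 0\<close> by (simp add: power_mult_distrib power_divide)
      then have "C * ln (real n) \<le> real n * (p n)\<^sup>2" using elim \<open>C > 0\<close> by (simp add: field_simps)
      moreover have "c * ln (real n) \<le> C * ln (real n)" using L by (intro mult_right_mono) (auto simp: C_def)
      ultimately show ?case using pos by linarith
    qed
  qed
  show "\<forall>\<^sub>F n in sequentially. 0 < p n" using big[of 1] by (rule eventually_mono) simp
  show "\<forall>\<^sub>F n in sequentially. c * ln (real n) \<le> real n * (p n)\<^sup>2" using big[of c] by (rule eventually_mono) simp
  show "filterlim (\<lambda>n. real n * p n) at_top sequentially"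
  proof (rule filterlim_at_top_mono)
    show "filterlim (\<lambda>n. ln (real n)) at_top sequentially"
      by (rule filterlim_compose[OF ln_at_top filterlim_real_sequentially])
    show "\<forall>\<^sub>F n in sequentially. ln (real n) \<le> real n * p n"
      using big[of 1]
    proof eventually_elim
      case (elim n)
      have "(p n)\<^sup>2 \<le> p n * 1" unfolding power2_eq_square using p01[of n] by (intro mult_left_mono)
      then have "real n * (p n)\<^sup>2 \<le> real n * p n" by (intro mult_left_mono) auto
      then show ?case using elim by linarith
    qed
  qed
qed

text \<open>Conditioning on the second component, where values in \<open>Bad\<close> contribute at
  most their own probability. In both parts this freezes \<open>H\<close>.\<close>

lemma prob_pair_pmf_le:
  assumes "\<And>y. y \<in> set_pmf B \<Longrightarrow> y \<notin> Bad \<Longrightarrow> measure_pmf.prob A {x. (x, y) \<in> X} \<le> b" "0 \<le> b"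
  shows "measure_pmf.prob (pair_pmf A B) X \<le> measure_pmf.prob B Bad + b"
proof -
  have "ennreal (measure_pmf.prob (pair_pmf A B) X) = (\<integral>\<^sup>+z. indicator X z \<partial>pair_pmf A B)"
    by (simp add: measure_pmf.emeasure_eq_measure)
  also have "\<dots> = (\<integral>\<^sup>+y. (\<integral>\<^sup>+x. indicator {x. (x, y) \<in> X} x \<partial>A) \<partial>B)"
    by (subst pair_commute_pmf)
      (auto simp only: nn_integral_map_pmf nn_integral_pair_pmf' case_prod_conv indicator_def mem_Collect_eq
        intro!: nn_integral_cong)
  also have "\<dots> = (\<integral>\<^sup>+y. ennreal (measure_pmf.prob A {x. (x, y) \<in> X}) \<partial>B)"
    by (simp add: measure_pmf.emeasure_eq_measure)
  also have "\<dots> \<le> (\<integral>\<^sup>+y. indicator Bad y + ennreal b \<partial>B)"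
  proof (intro nn_integral_mono_AE AE_pmfI)
    fix y assume y: "y \<in> set_pmf B"
    show "ennreal (measure_pmf.prob A {x. (x, y) \<in> X}) \<le> indicator Bad y + ennreal b"
    proof (cases "y \<in> Bad")
      case True
      have "ennreal (measure_pmf.prob A {x. (x, y) \<in> X}) \<le> ennreal 1" by (intro ennreal_leI) simp
      also have "\<dots> \<le> 1 + ennreal b" by simp
      finally show ?thesis using True by simp
    next
      case False
      then show ?thesis using assms(1)[OF y False] by (simp add: ennreal_leI)
    qed
  qed
  also have "\<dots> = ennreal (measure_pmf.prob B Bad + b)"
    using assms(2) by (simp add: nn_integral_add measure_pmf.emeasure_eq_measure)
  finally show ?thesis using assms(2) by (subst (asm) ennreal_le_iff) auto
qed

text \<open>Success forces a total excess of \<open>s * scale_D n p\<close>, and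
  \<open>\<rho> * scale_D n p\<close> is \<open>n * ln n\<close>, so the run succeeds with
  probability at most \<open>2 ^ n * exp (- s * n * ln n)\<close>. Markov's inequality over
  \<open>G\<close>, applied to the success probability given \<open>G\<close>, loses the factor
  \<open>exp (c * n * ln n)\<close>.\<close>

lemma prob_online_success_le:
  assumes "online_algorithm n A" "H \<in> simple_graphs n" "edges_upper p n H"
    and "2 \<le> n" "0 < p" "p \<le> 1" "0 < \<delta>" "\<delta> \<le> 1"
    and "2 * (sqrt (2 / \<delta>) * (sqrt (ln (real n) / real n) / p)) \<le> \<delta>"
    and "beta_c * (1 + 7 * \<delta>) + 4 / sqrt (ln (real n)) + s \<le> \<beta>"
  shows "measure_pmf.prob (erdos_renyi n p) {G. measure_pmf.prob (A G H) (S_set n p \<beta> G H) \<ge> exp (- (c * real n * ln (real n)))}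
    \<le> 2 ^ n * exp ((c - s) * real n * ln (real n))"
proof -
  obtain P where P: "valid_online_rule n P"
    "\<And>G H. G \<in> simple_graphs n \<Longrightarrow> H \<in> simple_graphs n \<Longrightarrow> A G H = map_pmf perm_of_list (online_values P G H n)"
    using assms(1) by (auto simp: online_algorithm_def)
  define \<rho> where "\<rho> = sqrt (ln (real n) / real n) / p"
  define t where "t k = sqrt (2 * real n / (real k + \<delta> * real n)) * \<rho>" for k
  note comp = compensator_le[OF assms(4-9), folded \<rho>_def, folded t_def]
  have L: "0 < ln (real n)" using assms by simp
  have \<rho>: "0 \<le> \<rho>" using L assms by (simp add: \<rho>_def)
  have D: "0 \<le> scale_D n p" using L assms by (simp add: scale_D_eq)
  have \<rho>D: "\<rho> * scale_D n p = real n * ln (real n)"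
    using L assms by (simp add: \<rho>_def scale_D_eq real_sqrt_divide)
  let ?c = "c * real n * ln (real n)"
  let ?S = "S_set n p \<beta>"
  let ?X = "{(G, xs). (\<Sum>k<n. excess n H p (t k) (take k xs) (xs ! k) (new_nbrs G k)) \<ge> s * scale_D n p}" 
  have "measure_pmf.prob (partial_run P H p n) {(G, xs). perm_of_list xs \<in> ?S G H} \<le> measure_pmf.prob (partial_run P H p n) ?X"
  proof (rule measure_pmf.finite_measure_mono_AE)
    show "AE z in partial_run P H p n. z \<in> {(G, xs). perm_of_list xs \<in> ?S G H} \<longrightarrow> z \<in> ?X"
    proof (intro AE_pmfI impI)
      fix z assume z: "z \<in> set_pmf (partial_run P H p n)" "z \<in> {(G, xs). perm_of_list xs \<in> ?S G H}"
      obtain G xs where Gxs: "z = (G, xs)" by (cases z)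
      have xs: "xs \<in> partial_inj n n" using z set_partial_run[OF P(1) _ assms(2), of n p] unfolding Gxs by auto
      have "\<beta> * scale_D n p \<le> centered_overlap n p G H (perm_of_list xs)"
        using z(2) unfolding Gxs by (simp add: S_set_def)
      also have "\<dots> \<le> (\<Sum>k<n. excess n H p (t k) (take k xs) (xs ! k) (new_nbrs G k)) + (\<Sum>k<n. ln (real n) / t k)
     + p\<^sup>2 * (\<Sum>k<n. (1 + \<delta>) * t k / 2 * real k) + 2 * real n * sqrt (real n * p) * p * (1 + (1 + \<delta>) * t 0 / 2)"
        using comp assms less_imp_le[OF comp(2)]
        by (intro centered_overlap_le_excess[OF P(1) assms(2) _ _ assms(3) xs]) auto
      also have "\<dots> \<le> (\<Sum>k<n. excess n H p (t k) (take k xs) (xs ! k) (new_nbrs G k))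
         + (beta_c * (1 + 7 * \<delta>) + 4 / sqrt (ln (real n))) * scale_D n p"
        using comp(1) by linarith
      also have "\<dots> \<le> (\<Sum>k<n. excess n H p (t k) (take k xs) (xs ! k) (new_nbrs G k)) + (\<beta> - s) * scale_D n p"
        using assms(10) D by (intro add_left_mono mult_right_mono) auto
      finally show "z \<in> ?X" unfolding Gxs by (simp add: algebra_simps)
    qed
  qed auto
  also have "\<dots> \<le> 2 ^ n * exp (- \<rho> * (s * scale_D n p))"
    using assms \<rho> comp by (intro prob_sum_excess_ge[OF P(1) assms(2)]) auto
  also have "- \<rho> * (s * scale_D n p) = - s * (\<rho> * scale_D n p)" by simp
  finally have run: "measure_pmf.prob (partial_run P H p n) {(G, xs). perm_of_list xs \<in> ?S G H} \<le> 2 ^ n * exp (- s * (real n * ln (real n)))"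
    unfolding \<rho>D .
  show ?thesis
  proof (rule prob_le_nn_integral)
    have "(\<integral>\<^sup>+G. ennreal (exp ?c) * ennreal (measure_pmf.prob (A G H) (?S G H)) \<partial>erdos_renyi n p)
       = ennreal (exp ?c) * (\<integral>\<^sup>+G. ennreal (measure_pmf.prob (A G H) (?S G H)) \<partial>erdos_renyi n p)"
      by (simp add: nn_integral_cmult)
    also have "(\<integral>\<^sup>+G. ennreal (measure_pmf.prob (A G H) (?S G H)) \<partial>erdos_renyi n p)
      = (\<integral>\<^sup>+G. (\<integral>\<^sup>+xs. indicator {(G, xs). perm_of_list xs \<in> ?S G H} (G, xs) \<partial>online_values P G H n) \<partial>erdos_renyi n p)"
    proof (intro nn_integral_cong_AE AE_pmfI)
      fix G assume "G \<in> set_pmf (erdos_renyi n p)"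
      then have "G \<in> simple_graphs n" using set_erdos_renyi by blast
      then have eq: "A G H = map_pmf perm_of_list (online_values P G H n)" using assms(2) by (rule P(2))
      have "ennreal (measure_pmf.prob (A G H) (?S G H)) = (\<integral>\<^sup>+xs. indicator (?S G H) (perm_of_list xs) \<partial>online_values P G H n)"
        unfolding eq by (simp add: measure_pmf.emeasure_eq_measure[symmetric] flip: nn_integral_map_pmf)
      then show "ennreal (measure_pmf.prob (A G H) (?S G H)) =
         (\<integral>\<^sup>+xs. indicator {(G, xs). perm_of_list xs \<in> ?S G H} (G, xs) \<partial>online_values P G H n)"
        by (simp add: indicator_def)
    qed
    also have "\<dots> = ennreal (measure_pmf.prob (partial_run P H p n) {(G, xs). perm_of_list xs \<in> ?S G H})"
    proof -
      have "(\<integral>\<^sup>+z. indicator {(G, xs). perm_of_list xs \<in> ?S G H} z \<partial>partial_run P H p n) =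
        ennreal (measure_pmf.prob (partial_run P H p n) {(G, xs). perm_of_list xs \<in> ?S G H})"
        by (simp add: measure_pmf.emeasure_eq_measure)
      then show ?thesis unfolding partial_run_def nn_integral_bind_pmf nn_integral_map_pmf .
    qed
    also have "ennreal (exp ?c) * \<dots> \<le> ennreal (exp ?c) * ennreal (2 ^ n * exp (- s * (real n * ln (real n))))"
      by (intro mult_left_mono ennreal_leI run) auto
    also have "\<dots> = ennreal (2 ^ n * exp ((c - s) * real n * ln (real n)))"
      by (subst ennreal_mult[symmetric]) (auto simp: algebra_simps exp_diff exp_minus divide_inverse)
    finally show "(\<integral>\<^sup>+G. ennreal (exp ?c) * ennreal (measure_pmf.prob (A G H) (?S G H)) \<partial>erdos_renyi n p)
       \<le> ennreal (2 ^ n * exp ((c - s) * real n * ln (real n)))" .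
    fix G assume "G \<in> {G. measure_pmf.prob (A G H) (?S G H) \<ge> exp (- ?c)}"
    then have "exp ?c * exp (- ?c) \<le> exp ?c * measure_pmf.prob (A G H) (?S G H)" by (intro mult_left_mono) auto
    then show "1 \<le> ennreal (exp ?c) * ennreal (measure_pmf.prob (A G H) (?S G H))"
      by (simp add: ennreal_mult[symmetric] exp_minus)
  qed simp
qed

lemma two_power_exp_tendsto: "c < - ln 2 \<Longrightarrow> (\<lambda>n. 2 ^ n * exp (c * real n)) \<longlonglongrightarrow> (0::real)"
proof -
  assume c: "c < - ln 2"
  have "2 ^ n * exp (c * real n) = (2 * exp c) ^ n" for n
    by (simp add: power_mult_distrib exp_of_nat_mult[symmetric] mult.commute)
  moreover have "2 * exp c < 1"
  proof -
    have "exp c < exp (- ln 2)" using c by simp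
    then show ?thesis by (simp add: exp_minus)
  qed
  then have "(\<lambda>n. (2 * exp c) ^ n) \<longlonglongrightarrow> 0" by (intro LIMSEQ_realpow_zero) auto
  ultimately show ?thesis by (simp only:)
qed

theorem online_algorithms_fail_above_threshold:
  fixes \<epsilon> :: real
  assumes "\<epsilon> > 0" "dense_regime p" "\<And>n. online_algorithm n (A n)"
  shows "(\<lambda>n. measure_pmf.prob (input_law n (p n))
      {(G, H). measure_pmf.prob (A n G H) (S_set n (p n) (beta_c + \<epsilon>) G H)
         \<ge> exp (- (\<epsilon> / 4 * real n * ln (real n)))}) \<longlonglongrightarrow> 0"
proof -
  note dense = dense_regime_facts[OF assms(2)]
  \<comment> \<open>The margin \<open>\<epsilon>\<close> is split into a quarter for
    \<open>7 \<delta>\<close>, a quarter for \<open>4 / sqrt (ln n)\<close> and a half for the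
    excess. As the constant in the exponent is another quarter,
    \<open>exp (- \<epsilon> / 4 * n * ln n)\<close> remains against \<open>2 ^ n\<close>.\<close>
  define \<delta> where "\<delta> = min 1 (\<epsilon> / 28)"
  have \<delta>: "0 < \<delta>" "\<delta> \<le> 1" "7 * \<delta> \<le> \<epsilon> / 4" using assms(1) by (auto simp: \<delta>_def)
  have beta: "0 \<le> beta_c" "beta_c \<le> 1"
    unfolding beta_c_eq by auto
  have lnlim: "filterlim (\<lambda>n. ln (real n)) at_top sequentially"
    by (rule filterlim_compose[OF ln_at_top filterlim_real_sequentially])
  have e1: "\<forall>\<^sub>F n in sequentially. 2 * (sqrt (2 / \<delta>) * (sqrt (ln (real n) / real n) / p n)) < \<delta>"
  proof (rule order_tendstoD(2))
    show "(\<lambda>n. 2 * (sqrt (2 / \<delta>) * (sqrt (ln (real n) / real n) / p n))) \<longlonglongrightarrow> 2 * (sqrt (2 / \<delta>) * 0)"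
      by (intro tendsto_intros dense)
  qed (use \<delta> in simp)
  have e2: "\<forall>\<^sub>F n in sequentially. 4 / sqrt (ln (real n)) < \<epsilon> / 4"
  proof (rule order_tendstoD(2))
    show "(\<lambda>n. 4 / sqrt (ln (real n))) \<longlonglongrightarrow> 0"
      by (intro tendsto_divide_0 filterlim_at_top_imp_at_infinity filterlim_compose[OF sqrt_at_top] lnlim) auto
  qed (use assms in simp)
  have e3: "\<forall>\<^sub>F n in sequentially. 4 \<le> real n * p n"
    using dense(6) by (simp add: filterlim_at_top)
  \<comment> \<open>This makes \<open>\<epsilon> / 4 * ln n\<close> at least 2, so that the
    remaining factor is at most \<open>exp (- 2 * n)\<close>.\<close>
  have e4: "\<forall>\<^sub>F n in sequentially. 8 / \<epsilon> \<le> ln (real n)"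
    using lnlim by (simp add: filterlim_at_top)
  have ev: "\<forall>\<^sub>F n in sequentially. measure_pmf.prob (input_law n (p n))
      {(G, H). measure_pmf.prob (A n G H) (S_set n (p n) (beta_c + \<epsilon>) G H)
         \<ge> exp (- (\<epsilon> / 4 * real n * ln (real n)))} \<le> 2 ^ n * exp (- 2 * real n) + 2 ^ n * exp (- 2 * real n)"
    using e1 e2 e3 e4 dense(5) eventually_ge_at_top[of 2]
  proof eventually_elim
    case (elim n)
    let ?X = "{(G, H). measure_pmf.prob (A n G H) (S_set n (p n) (beta_c + \<epsilon>) G H)
         \<ge> exp (- (\<epsilon> / 4 * real n * ln (real n)))}"
    have "beta_c * (7 * \<delta>) \<le> 1 * (\<epsilon> / 4)" using \<delta> beta by (intro mult_mono) auto
    then have thr: "beta_c * (1 + 7 * \<delta>) + 4 / sqrt (ln (real n)) + \<epsilon> / 2 \<le> beta_c + \<epsilon>"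
      using elim(2) by (simp add: distrib_left)
    have "measure_pmf.prob (pair_pmf (erdos_renyi n (p n)) (erdos_renyi n (p n))) ?X \<le>
      measure_pmf.prob (erdos_renyi n (p n)) {H. \<not> edges_upper (p n) n H} + 2 ^ n * exp (- 2 * real n)"
    proof (rule prob_pair_pmf_le)
      fix H assume H: "H \<in> set_pmf (erdos_renyi n (p n))" "H \<notin> {H. \<not> edges_upper (p n) n H}"
      then have "H \<in> simple_graphs n" using set_erdos_renyi by blast
      then have "measure_pmf.prob (erdos_renyi n (p n)) {G. (G, H) \<in> ?X} \<le> 2 ^ n * exp ((\<epsilon> / 4 - \<epsilon> / 2) * real n * ln (real n))"
        using elim H(2) \<delta> dense(2)[of n] thr prob_online_success_le[OF assms(3)[of n], of H "p n" \<delta> "\<epsilon> / 2" "beta_c + \<epsilon>" "\<epsilon> / 4"]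
        by simp
      also have "\<dots> \<le> 2 ^ n * exp (- 2 * real n)"
      proof -
        have "2 \<le> \<epsilon> / 4 * ln (real n)" using elim(4) assms(1) by (simp add: field_simps)
        then have "2 * real n \<le> (\<epsilon> / 4 * ln (real n)) * real n" by (intro mult_right_mono) auto
        then show ?thesis by (simp add: algebra_simps)
      qed
      finally show "measure_pmf.prob (erdos_renyi n (p n)) {G. (G, H) \<in> ?X} \<le> 2 ^ n * exp (- 2 * real n)" .
    qed simp
    also have "measure_pmf.prob (erdos_renyi n (p n)) {H. \<not> edges_upper (p n) n H} \<le> 2 ^ n * exp (- 2 * real n)"
      using elim(3) dense by (intro prob_not_edges_upper) auto
    finally show ?case by (simp add: input_law_def)
  qed
  have "(\<lambda>n. 2 ^ n * exp (- 2 * real n) + 2 ^ n * exp (- 2 * real n)) \<longlonglongrightarrow> 0 + (0::real)"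
    using ln_2_less_1 by (intro tendsto_add two_power_exp_tendsto) auto
  then show ?thesis
    by (intro tendsto_sandwich[OF _ ev tendsto_const]) auto
qed


section \<open>Second moment method for tilted sums\<close>

text \<open>Chebyshev's inequality, as \<open>Z = 0\<close> is a deviation by the whole mean, stated
  so that a lower bound for the mean and an upper bound for the second moment can be
  inserted.\<close>

lemma prob_zero_le_second_moment:
  fixes Z :: "'a \<Rightarrow> real"
  assumes "finite (set_pmf M)" "0 < a" "a \<le> measure_pmf.expectation M Z" "measure_pmf.expectation M (\<lambda>x. (Z x)\<^sup>2) \<le> b"
  shows "measure_pmf.prob M {x. Z x = 0} \<le> b / a\<^sup>2 - 1"
proof -
  let ?E = "measure_pmf.expectation M"
  define e where "e = ?E Z"
  have int: "integrable M f" for f :: "'a \<Rightarrow> real" by (intro integrable_measure_pmf_finite assms)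
  have "e\<^sup>2 * measure_pmf.prob M {x. Z x = 0} = ?E (\<lambda>x. e\<^sup>2 * indicator {x. Z x = 0} x)"
    by simp
  also have "\<dots> \<le> ?E (\<lambda>x. (Z x - e)\<^sup>2)"
    by (intro integral_mono int) (auto simp: indicator_def)
  also have "\<dots> = ?E (\<lambda>x. (Z x)\<^sup>2 - (2 * e) * Z x + e\<^sup>2)"
    by (simp add: power2_diff algebra_simps)
  also have "\<dots> = ?E (\<lambda>x. (Z x)\<^sup>2) - e\<^sup>2"
    using int by (simp add: e_def power2_eq_square)
  also have "\<dots> \<le> b - e\<^sup>2" using assms(4) by simp
  finally have *: "e\<^sup>2 * measure_pmf.prob M {x. Z x = 0} \<le> b - e\<^sup>2" .
  have e: "a \<le> e" "0 < e" using assms by (auto simp: e_def)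
  have "0 \<le> ?E (\<lambda>x. (Z x)\<^sup>2)" by simp
  then have b: "0 \<le> b" using assms(4) by linarith
  have "measure_pmf.prob M {x. Z x = 0} \<le> (b - e\<^sup>2) / e\<^sup>2" using * e by (simp add: field_simps)
  also have "\<dots> = b / e\<^sup>2 - 1" using e by (simp add: diff_divide_distrib)
  also have "\<dots> \<le> b / a\<^sup>2 - 1" using e b assms(2) by (intro diff_right_mono divide_left_mono power_mono) auto
  finally show ?thesis .
qed

text \<open>Under the exponentially tilted law the edge density \<open>p\<close> becomes \<open>tilted p t\<close>.\<close>

definition tilted :: "real \<Rightarrow> real \<Rightarrow> real" where
  "tilted p t = p * exp t / (1 - p + p * exp t)"

context
  fixes p :: real
  assumes p: "0 < p" "p < 1"
begin

lemma tilted_bounds: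
  assumes "0 \<le> t"
  shows "0 < tilted p t" "tilted p t \<le> 1" "1 \<le> 1 - p + p * exp t"
proof -
  show z: "1 \<le> 1 - p + p * exp t" using p assms by (simp add: mult_le_cancel_left1)
  then have zp: "0 < 1 - p + p * exp t" by linarith
  then show "0 < tilted p t" unfolding tilted_def using p by (intro divide_pos_pos mult_pos_pos exp_gt_zero)
  show "tilted p t \<le> 1" unfolding tilted_def using zp p by (simp add: divide_le_eq_1_pos)
qed

text \<open>Passing to the tilted law turns the weight into the power of the normaliser. There the
  size has mean \<open>m * tilted p t\<close> and a variance of at most this value, so Chebyshev's
  inequality bounds what the truncation removes.\<close>

lemma expectation_tilted_near_mean:
  assumes "finite I" "B \<subseteq> I" "0 \<le> t" "0 < s"
  defines "m \<equiv> real (card B)"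
  shows "(1 - p + p * exp t) ^ card B * (1 - m * tilted p t / s\<^sup>2) \<le>
     measure_pmf.expectation (random_subset I p)
       (\<lambda>C. exp (t * real (card (C \<inter> B))) * of_bool (\<bar>real (card (C \<inter> B)) - m * tilted p t\<bar> \<le> s))"
proof -
  let ?q = "tilted p t"
  let ?M = "random_subset B ?q"
  have fin: "finite B" using assms finite_subset by blast
  note tb = tilted_bounds[OF assms(3)]
  let ?far = "{C. \<bar>real (card C) - m * ?q\<bar> > s}"
  have "s\<^sup>2 * measure_pmf.prob ?M ?far = measure_pmf.expectation ?M (\<lambda>C. s\<^sup>2 * indicator ?far C)"
    by simp
  also have "\<dots> \<le> measure_pmf.expectation ?M (\<lambda>C. (real (card C) - m * ?q)\<^sup>2)"
  proof (intro integral_mono integrable_measure_pmf_finite)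
    fix C
    show "s\<^sup>2 * indicator ?far C \<le> (real (card C) - m * ?q)\<^sup>2"
      using assms(4) power_mono[of s "\<bar>real (card C) - m * ?q\<bar>" 2] by (auto simp: indicator_def)
  qed (use fin in auto)
  also have "\<dots> = m * ?q * (1 - ?q)"
    unfolding m_def using tb fin by (intro variance_random_subset_card) auto
  also have "\<dots> \<le> m * ?q * 1" using tb by (intro mult_left_mono) (auto simp: m_def)
  finally have far: "measure_pmf.prob ?M ?far \<le> m * ?q / s\<^sup>2"
    using assms(4) by (simp add: field_simps)
  have "1 - measure_pmf.prob ?M ?far = measure_pmf.expectation ?M (\<lambda>C. 1 - indicator ?far C)"
    using fin by (subst Bochner_Integration.integral_diff) (auto intro!: integrable_measure_pmf_finite)
  also have "\<dots> = measure_pmf.expectation ?M (\<lambda>C. of_bool (\<bar>real (card C) - m * ?q\<bar> \<le> s))"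
    by (intro Bochner_Integration.integral_cong) (auto simp: indicator_def)
  finally have near: "1 - m * ?q / s\<^sup>2 \<le> measure_pmf.expectation ?M (\<lambda>C. of_bool (\<bar>real (card C) - m * ?q\<bar> \<le> s))"
    using far by linarith
  have "measure_pmf.expectation (random_subset I p)
       (\<lambda>C. exp (t * real (card (C \<inter> B))) * of_bool (\<bar>real (card (C \<inter> B)) - m * tilted p t\<bar> \<le> s))
    = measure_pmf.expectation (map_pmf (\<lambda>C. C \<inter> B) (random_subset I p))
       (\<lambda>C. exp (t * real (card C)) * of_bool (\<bar>real (card C) - m * tilted p t\<bar> \<le> s))"
    by simp
  also have "\<dots> = (1 - p + p * exp t) ^ card B * measure_pmf.expectation ?M (\<lambda>C. of_bool (\<bar>real (card C) - m * ?q\<bar> \<le> s))"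
    unfolding random_subset_Int[OF assms(1,2)] using p fin
    by (simp only: expectation_random_subset_tilt less_imp_le tilted_def)
  finally have eq: "measure_pmf.expectation (random_subset I p)
       (\<lambda>C. exp (t * real (card (C \<inter> B))) * of_bool (\<bar>real (card (C \<inter> B)) - m * tilted p t\<bar> \<le> s)) = \<dots>" .
  have "0 \<le> (1 - p + p * exp t) ^ card B" using tb(3) by (intro zero_le_power) linarith
  then show ?thesis unfolding eq by (rule mult_left_mono[OF near])
qed

text \<open>A common element contributes \<open>1 - p + p * exp (2 * t)\<close>, which is the square
  of the normaliser plus \<open>p * (1 - p) * (exp t - 1)^2\<close>. As the normaliser is at least
  1, each common element costs at most the factor \<open>exp (p * (exp t - 1)^2)\<close>.\<close>

lemma expectation_exp_pair_le:
  assumes "finite I" "A \<subseteq> I" "B \<subseteq> I" "0 \<le> t"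
  shows "measure_pmf.expectation (random_subset I p) (\<lambda>C. exp (t * real (card (C \<inter> A))) * exp (t * real (card (C \<inter> B))))
    \<le> (1 - p + p * exp t) ^ card A * (1 - p + p * exp t) ^ card B * exp (real (card (A \<inter> B)) * (p * (exp t - 1)\<^sup>2))"
proof -
  let ?z = "1 - p + p * exp t"
  define f where "f x = (if x \<in> A then exp t else 1) * (if x \<in> B then exp t else 1)" for x
  have "measure_pmf.expectation (random_subset I p) (\<lambda>C. exp (t * real (card (C \<inter> A))) * exp (t * real (card (C \<inter> B))))
    = measure_pmf.expectation (random_subset I p) (\<lambda>C. \<Prod>x\<in>C. f x)"
  proof (intro integral_cong_AE AE_pmfI)
    fix C assume "C \<in> set_pmf (random_subset I p)"
    then have "finite C" by (rule finite_subset[OF random_subset_subset assms(1)])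
    then have "(\<Prod>x\<in>C. f x) = exp t ^ card (C \<inter> A) * exp t ^ card (C \<inter> B)"
      by (simp add: f_def prod.distrib prod.If_cases)
    then show "exp (t * real (card (C \<inter> A))) * exp (t * real (card (C \<inter> B))) = (\<Prod>x\<in>C. f x)"
      by (simp only: exp_of_nat2_mult)
  qed auto
  also have "\<dots> = (\<Prod>x\<in>I. 1 - p + p * f x)"
    using p assms by (intro expectation_random_subset_prod) auto
  also have "\<dots> \<le> (\<Prod>x\<in>I. (if x \<in> A then ?z else 1) * (if x \<in> B then ?z else 1) * (if x \<in> A \<inter> B then exp (p * (exp t - 1)\<^sup>2) else 1))"
  proof (rule prod_mono)
    fix x
    have "1 - p + p * (exp t * exp t) \<le> ?z * ?z + p * (exp t - 1)\<^sup>2"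
      using p zero_le_square[of "p * (exp t - 1)"] by (simp add: power2_eq_square algebra_simps)
    also have "\<dots> \<le> ?z * ?z * (1 + p * (exp t - 1)\<^sup>2)"
    proof -
      have "1 * 1 \<le> ?z * ?z" using tilted_bounds(3)[OF assms(4)] by (intro mult_mono) linarith+
      moreover have "0 \<le> p * (exp t - 1)\<^sup>2" using p by simp
      ultimately have "1 * (p * (exp t - 1)\<^sup>2) \<le> ?z * ?z * (p * (exp t - 1)\<^sup>2)"
        by (intro mult_right_mono) linarith+
      then show ?thesis unfolding distrib_left[of "?z * ?z"] by linarith
    qed
    also have "\<dots> \<le> ?z * ?z * exp (p * (exp t - 1)\<^sup>2)"
      using exp_ge_add_one_self by (intro mult_left_mono) auto
    finally have "1 - p + p * (exp t * exp t) \<le> ?z * ?z * exp (p * (exp t - 1)\<^sup>2)" .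
    then show "0 \<le> 1 - p + p * f x \<and> 1 - p + p * f x \<le> (if x \<in> A then ?z else 1) * (if x \<in> B then ?z else 1) * (if x \<in> A \<inter> B then exp (p * (exp t - 1)\<^sup>2) else 1)"
      using p by (auto simp: f_def)
  qed
  also have "\<dots> = ?z ^ card A * ?z ^ card B * exp (real (card (A \<inter> B)) * (p * (exp t - 1)\<^sup>2))"
  proof -
    have *: "(\<Prod>x\<in>I. if x \<in> S then c else 1) = c ^ card S" if "S \<subseteq> I" for S and c :: real
      using that assms(1) by (simp add: prod.If_cases Int_absorb1 Int_commute)
    show ?thesis
      unfolding prod.distrib *[OF assms(2)] *[OF assms(3)] *[OF le_infI1[OF assms(2)]] exp_of_nat_mult ..
  qed
  finally show ?thesis .
qed

text \<open>Second moment method for the number of \<open>v\<close> with \<open>card (C \<inter> B v)\<close> close to the tilted mean, each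
  weighted by \<open>exp (t * card (C \<inter> B v))\<close>. Without the truncation the diagonal terms would restrict
  \<open>t\<close> to values smaller by a factor \<open>sqrt 2\<close> than needed; the weights make precise binomial tail
  estimates unnecessary.\<close>

lemma prob_all_below_tilted_mean:
  assumes "finite I" "finite V" "V \<noteq> {}" "\<And>v. v \<in> V \<Longrightarrow> B v \<subseteq> I" "\<And>v. v \<in> V \<Longrightarrow> card (B v) = m"
    and "\<And>v w. v \<in> V \<Longrightarrow> w \<in> V \<Longrightarrow> v \<noteq> w \<Longrightarrow> real (card (B v \<inter> B w)) \<le> c"
    and "0 \<le> t" "0 < s" "real m * tilted p t / s\<^sup>2 \<le> \<kappa>" "\<kappa> < 1" "0 \<le> c"
  shows "measure_pmf.prob (random_subset I p) {C. \<forall>v\<in>V. real (card (C \<inter> B v)) < real m * tilted p t - s}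
    \<le> (exp (c * (p * (exp t - 1)\<^sup>2)) + exp (t * (real m * tilted p t + s)) / (real (card V) * (1 - p + p * exp t) ^ m)) / (1 - \<kappa>)\<^sup>2 - 1"
proof -
  let ?M = "random_subset I p"
  let ?E = "measure_pmf.expectation ?M"
  let ?z = "1 - p + p * exp t"
  define \<mu> where "\<mu> = real m * tilted p t"
  define Y where "Y v C = exp (t * real (card (C \<inter> B v))) * of_bool (\<bar>real (card (C \<inter> B v)) - \<mu>\<bar> \<le> s)" for v C
  define Z where "Z C = (\<Sum>v\<in>V. Y v C)" for C
  have int: "integrable ?M f" for f :: "_ \<Rightarrow> real" using assms(1) by (intro integrable_measure_pmf_finite) auto
  have z: "1 \<le> ?z" using tilted_bounds(3)[OF assms(7)] .
  then have z0: "0 < ?z ^ m" by (intro zero_less_power) linarith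
  have V: "0 < real (card V)" using assms(2,3) by (simp add: card_gt_0_iff)
  have "{C. \<forall>v\<in>V. real (card (C \<inter> B v)) < \<mu> - s} \<subseteq> {C. Z C = 0}"
    by (auto simp: Z_def Y_def intro!: sum.neutral)
  then have "measure_pmf.prob ?M {C. \<forall>v\<in>V. real (card (C \<inter> B v)) < \<mu> - s} \<le> measure_pmf.prob ?M {C. Z C = 0}"
    by (intro measure_pmf.finite_measure_mono) auto
  also have "\<dots> \<le> ((real (card V) * ?z ^ m)\<^sup>2 * exp (c * (p * (exp t - 1)\<^sup>2)) + real (card V) * (exp (t * (\<mu> + s)) * ?z ^ m))
       / (real (card V) * (?z ^ m * (1 - \<kappa>)))\<^sup>2 - 1"
  proof (rule prob_zero_le_second_moment)
    show "0 < real (card V) * (?z ^ m * (1 - \<kappa>))" using V z0 assms(10) by simp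
    have "real (card V) * (?z ^ m * (1 - \<kappa>)) = (\<Sum>v\<in>V. ?z ^ m * (1 - \<kappa>))" by simp
    also have "\<dots> \<le> (\<Sum>v\<in>V. ?E (Y v))"
    proof (rule sum_mono)
      fix v assume v: "v \<in> V"
      have "?z ^ m * (1 - \<kappa>) \<le> ?z ^ m * (1 - real m * tilted p t / s\<^sup>2)"
        using z0 assms(9) by (intro mult_left_mono) auto
      also have "\<dots> \<le> ?E (Y v)"
        using expectation_tilted_near_mean[OF assms(1) assms(4)[OF v] assms(7,8)] assms(5)[OF v]
        unfolding Y_def \<mu>_def by simp
      finally show "?z ^ m * (1 - \<kappa>) \<le> ?E (Y v)" .
    qed
    also have "\<dots> = ?E Z" unfolding Z_def using int by (subst Bochner_Integration.integral_sum) auto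
    finally show "real (card V) * (?z ^ m * (1 - \<kappa>)) \<le> ?E Z" .
    have "?E (\<lambda>C. (Z C)\<^sup>2) = (\<Sum>v\<in>V. \<Sum>w\<in>V. ?E (\<lambda>C. Y v C * Y w C))"
      unfolding Z_def power2_eq_square sum_product using int by (simp add: Bochner_Integration.integral_sum)
    \<comment> \<open>The bound for pairs is charged on the diagonal as well, which makes the main
      term a full square; the diagonal receives an additional term.\<close>
    also have "\<dots> \<le> (\<Sum>v\<in>V. \<Sum>w\<in>V. ?z ^ m * ?z ^ m * exp (c * (p * (exp t - 1)\<^sup>2)) + (if w = v then exp (t * (\<mu> + s)) * ?z ^ m else 0))"
    proof (intro sum_mono)
      fix v w assume v: "v \<in> V" and w: "w \<in> V"
      show "?E (\<lambda>C. Y v C * Y w C) \<le> ?z ^ m * ?z ^ m * exp (c * (p * (exp t - 1)\<^sup>2)) + (if w = v then exp (t * (\<mu> + s)) * ?z ^ m else 0)"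
      proof (cases "w = v")
        case False
        have "?E (\<lambda>C. Y v C * Y w C) \<le> ?E (\<lambda>C. exp (t * real (card (C \<inter> B v))) * exp (t * real (card (C \<inter> B w))))"
          by (intro integral_mono int) (auto simp: Y_def)
        also have "\<dots> \<le> ?z ^ card (B v) * ?z ^ card (B w) * exp (real (card (B v \<inter> B w)) * (p * (exp t - 1)\<^sup>2))"
          using assms v w by (intro expectation_exp_pair_le) auto
        also have "\<dots> \<le> ?z ^ card (B v) * ?z ^ card (B w) * exp (c * (p * (exp t - 1)\<^sup>2))"
          using assms(6)[OF v w] False p z by (intro mult_left_mono exp_le_cancel_iff[THEN iffD2] mult_right_mono) auto
        finally show ?thesis using False assms(5) v w by simp
      next
        case True
        \<comment> \<open>Here the truncation is used: one of the two weights is at most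
          \<open>exp (t * (\<mu> + s))\<close>.\<close>
        have "?E (\<lambda>C. Y v C * Y v C) \<le> ?E (\<lambda>C. exp (t * (\<mu> + s)) * exp (t * real (card (C \<inter> B v))))"
        proof (intro integral_mono int)
          fix C
          show "Y v C * Y v C \<le> exp (t * (\<mu> + s)) * exp (t * real (card (C \<inter> B v)))"
          proof (cases "\<bar>real (card (C \<inter> B v)) - \<mu>\<bar> \<le> s")
            case True
            then have "exp (t * real (card (C \<inter> B v))) \<le> exp (t * (\<mu> + s))"
              using assms(7) by (intro exp_le_cancel_iff[THEN iffD2] mult_left_mono) auto
            then show ?thesis using True by (auto simp: Y_def intro!: mult_right_mono)
          qed (simp add: Y_def)
        qed
        also have "\<dots> = exp (t * (\<mu> + s)) * ?z ^ m"
          using p assms(1,4,5) v by (simp add: expectation_random_subset_exp_card)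
        finally have "?E (\<lambda>C. Y v C * Y v C) \<le> exp (t * (\<mu> + s)) * ?z ^ m" .
        moreover have "0 \<le> ?z ^ m * ?z ^ m * exp (c * (p * (exp t - 1)\<^sup>2))"
          using z0 by (intro mult_nonneg_nonneg) auto
        ultimately show ?thesis unfolding True by (simp only: if_True refl)
      qed
    qed
    also have "\<dots> = (real (card V) * ?z ^ m)\<^sup>2 * exp (c * (p * (exp t - 1)\<^sup>2)) + real (card V) * (exp (t * (\<mu> + s)) * ?z ^ m)"
      using assms(2) by (simp add: sum.distrib) (simp only: power2_eq_square distrib_left mult_ac)
    finally show "?E (\<lambda>C. (Z C)\<^sup>2) \<le> \<dots>" .
  qed (use assms(1) in auto)
  also have "\<dots> = (exp (c * (p * (exp t - 1)\<^sup>2)) + exp (t * (\<mu> + s)) / (real (card V) * ?z ^ m)) / (1 - \<kappa>)\<^sup>2 - 1"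
  proof -
    have *: "(y\<^sup>2 * a + b * y) / (y * k)\<^sup>2 = (a + b / y) / k\<^sup>2" if "0 < y" "0 < k" for y k a b :: real
    proof -
      have "(y\<^sup>2 * a + b * y) / (y * k)\<^sup>2 = (y\<^sup>2 * (a + b / y)) / (y\<^sup>2 * k\<^sup>2)"
        using that by (simp add: power2_eq_square distrib_left mult_ac)
      also have "\<dots> = (a + b / y) / k\<^sup>2" using that by simp
      finally show ?thesis .
    qed
    have "0 < real (card V) * ?z ^ m" using V z0 by (rule mult_pos_pos)
    moreover have "0 < 1 - \<kappa>" using assms(10) by simp
    ultimately show ?thesis
      using *[of "real (card V) * ?z ^ m" "1 - \<kappa>" "exp (c * (p * (exp t - 1)\<^sup>2))" "exp (t * (\<mu> + s))"]
      by (simp only: mult_ac)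
  qed
  finally show ?thesis unfolding \<mu>_def .
qed

text \<open>By the inequality of arithmetic and geometric means a shortfall \<open>- y\<close> is at
  most \<open>y^2 / (2 * a) + a / 2\<close>, and the variance of the size is at most
  \<open>card B * p\<close>. The best \<open>a\<close> is of the order of the standard
  deviation.\<close>

lemma expectation_deficit_le:
  assumes "finite I" "B \<subseteq> I" "0 < a"
  shows "measure_pmf.expectation (random_subset I p) (\<lambda>C. max 0 (real (card B) * p - real (card (C \<inter> B))))
    \<le> (real (card B) * p / a + a) / 2"
proof -
  have fin: "finite B" using assms finite_subset by blast
  let ?E = "measure_pmf.expectation (random_subset B p)"
  have int: "integrable (random_subset B p) f" for f :: "_ \<Rightarrow> real" using fin by (intro integrable_measure_pmf_finite) auto
  have "measure_pmf.expectation (random_subset I p) (\<lambda>C. max 0 (real (card B) * p - real (card (C \<inter> B))))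
     = measure_pmf.expectation (map_pmf (\<lambda>C. C \<inter> B) (random_subset I p)) (\<lambda>C. max 0 (real (card B) * p - real (card C)))"
    by simp
  also have "\<dots> \<le> ?E (\<lambda>C. (real (card C) - real (card B) * p)\<^sup>2 / (2 * a) + a / 2)"
    unfolding random_subset_Int[OF assms(1,2)]
  proof (intro integral_mono int)
    fix C :: "'a set"
    define y where "y = real (card C) - real (card B) * p"
    have "0 \<le> (y + a)\<^sup>2 / (2 * a)" using assms by simp
    also have "\<dots> = y\<^sup>2 / (2 * a) + a / 2 + y" using assms by (simp add: field_simps power2_eq_square)
    finally have "- y \<le> y\<^sup>2 / (2 * a) + a / 2" by simp
    moreover have "0 \<le> y\<^sup>2 / (2 * a) + a / 2" using assms by simp
    ultimately show "max 0 (real (card B) * p - real (card C)) \<le> (real (card C) - real (card B) * p)\<^sup>2 / (2 * a) + a / 2"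
      unfolding y_def by simp
  qed
  also have "\<dots> = ?E (\<lambda>C. (real (card C) - real (card B) * p)\<^sup>2) / (2 * a) + a / 2"
    using int by simp
  also have "\<dots> = real (card B) * p * (1 - p) / (2 * a) + a / 2"
    using p fin by (simp add: variance_random_subset_card)
  also have "\<dots> \<le> real (card B) * p * 1 / (2 * a) + a / 2"
    using p assms by (intro add_right_mono divide_right_mono mult_left_mono) auto
  finally show ?thesis by (simp add: field_simps)
qed

end


section \<open>The greedy algorithm on the random access machine\<close>

text \<open>The first component is one more than the best value so far, and \<open>0\<close> if there is no candidate yet.\<close>

primrec scan_best :: "(nat \<Rightarrow> nat) \<Rightarrow> nat set \<Rightarrow> nat \<Rightarrow> nat \<times> nat" where
  "scan_best f U 0 = (0, 0)"
| "scan_best f U (Suc v) =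
     (if Suc v \<in> U \<or> f (Suc v) < fst (scan_best f U v) then scan_best f U v else (Suc (f (Suc v)), Suc v))"

lemma scan_best_ge: "v \<in> {1..n} \<Longrightarrow> v \<notin> U \<Longrightarrow> f v < fst (scan_best f U n)"
  by (induction n) (auto simp: le_Suc_eq)

lemma scan_best_attained:
  "fst (scan_best f U n) > 0 \<Longrightarrow> snd (scan_best f U n) \<in> {1..n} - U \<and> fst (scan_best f U n) = Suc (f (snd (scan_best f U n)))"
  by (induction n) auto

definition greedy_pick :: "nat \<Rightarrow> graph \<Rightarrow> graph \<Rightarrow> nat list \<Rightarrow> nat" where
  "greedy_pick n G H xs = snd (scan_best (score G H xs) (set xs) n)"

lemma greedy_pick:
  assumes "xs \<in> partial_inj n k" "k < n"
  shows "greedy_pick n G H xs \<in> {1..n} - set xs"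
    and "v \<in> {1..n} - set xs \<Longrightarrow> score G H xs v \<le> score G H xs (greedy_pick n G H xs)"
proof -
  let ?b = "scan_best (score G H xs) (set xs) n"
  have "card (set xs) < card {1..n}" using assms distinct_card[of xs] by (auto simp: partial_inj_def)
  then have "\<not> {1..n} \<subseteq> set xs" by (metis card_mono leD List.finite_set)
  then obtain w where "w \<in> {1..n}" "w \<notin> set xs" by blast
  then have "0 < fst ?b" using scan_best_ge[of w n "set xs" "score G H xs"] by simp
  note att = scan_best_attained[OF this]
  show "greedy_pick n G H xs \<in> {1..n} - set xs" using att by (simp add: greedy_pick_def)
  show "score G H xs v \<le> score G H xs (greedy_pick n G H xs)" if "v \<in> {1..n} - set xs"
    using scan_best_ge[of v n "set xs" "score G H xs"] that att by (simp add: greedy_pick_def)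
qed

primrec greedy_list :: "nat \<Rightarrow> graph \<Rightarrow> graph \<Rightarrow> nat \<Rightarrow> nat list" where
  "greedy_list n G H 0 = []"
| "greedy_list n G H (Suc k) = greedy_list n G H k @ [greedy_pick n G H (greedy_list n G H k)]"

lemma greedy_list_partial_inj: "k \<le> n \<Longrightarrow> greedy_list n G H k \<in> partial_inj n k"
proof (induction k)
  case (Suc k)
  then show ?case using partial_inj_snoc greedy_pick(1)[of "greedy_list n G H k" n k G H] by simp
qed (simp add: partial_inj_def)

definition greedy_rule :: "nat \<Rightarrow> online_rule" where
  "greedy_rule n k G H xs = return_pmf (greedy_pick n G H xs)"

definition greedy_algorithm :: "nat \<Rightarrow> alignment_algorithm" where
  "greedy_algorithm n G H = return_pmf (perm_of_list (greedy_list n G H n))"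

lemma online_values_greedy: "online_values (greedy_rule n) G H k = return_pmf (greedy_list n G H k)"
  by (induction k) (simp_all add: greedy_rule_def bind_return_pmf)

lemma valid_greedy_rule: "valid_online_rule n (greedy_rule n)"
  unfolding valid_online_rule_def
proof (intro ballI allI impI conjI)
  fix k H xs G assume k: "k \<in> {1..n}" and xs: "length xs = k - 1 \<and> distinct xs \<and> set xs \<subseteq> {1..n}"
  then have "xs \<in> partial_inj n (k - 1)" "k - 1 < n" by (auto simp: partial_inj_def)
  then show "set_pmf (greedy_rule n k G H xs) \<subseteq> {1..n} - set xs"
    using greedy_pick(1) by (simp add: greedy_rule_def)
  fix G' assume "\<forall>i j. 1 \<le> i \<and> i < j \<and> j \<le> k \<longrightarrow> adj G i j = adj G' i j"
  then have "{i, k} \<in> G \<longleftrightarrow> {i, k} \<in> G'" if "i \<in> {1..k - 1}" for i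
    using that k by (force simp: adj_def of_bool_eq_iff)
  then have "new_nbrs G (length xs) = new_nbrs G' (length xs)"
    using xs k by (auto simp: new_nbrs_def)
  then have "score G H xs = score G' H xs" by (simp add: score_def fun_eq_iff)
  then show "greedy_rule n k G H xs = greedy_rule n k G' H xs"
    by (simp add: greedy_rule_def greedy_pick_def)
qed

lemma online_greedy_algorithm: "online_algorithm n (greedy_algorithm n)"
  unfolding online_algorithm_def
  by (intro exI[of _ "greedy_rule n"]) (simp add: valid_greedy_rule online_values_greedy greedy_algorithm_def)

text \<open>The form in which the inner loop of the program accumulates the score, with indices
  counted from 0.\<close>

lemma score_eq_sum:
  "score G H xs v = (\<Sum>i<length xs. adj G (Suc i) (Suc (length xs)) * adj H (xs ! i) v)"
proof -
  have "(\<Sum>i<length xs. adj G (Suc i) (Suc (length xs)) * adj H (xs ! i) v) =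
     (\<Sum>i\<in>{1..length xs}. adj G i (Suc (length xs)) * adj H (xs ! (i - 1)) v)"
    by (rule sum.reindex_bij_witness[of _ "\<lambda>i. i - 1" Suc]) auto
  also have "\<dots> = (\<Sum>i\<in>{1..length xs}. if i \<in> new_nbrs G (length xs) \<inter> back_nbrs H xs v then 1 else 0)"
    by (intro sum.cong) (auto simp: adj_def new_nbrs_def back_nbrs_def)
  also have "\<dots> = card ({1..length xs} \<inter> (new_nbrs G (length xs) \<inter> back_nbrs H xs v))"
    by (simp add: sum.If_cases Collect_conj_eq)
  also have "{1..length xs} \<inter> (new_nbrs G (length xs) \<inter> back_nbrs H xs v) = new_nbrs G (length xs) \<inter> back_nbrs H xs v"
    by (auto simp: new_nbrs_def)
  finally show ?thesis by (simp add: score_def)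
qed

text \<open>The program draws no random numbers, so its runs can be followed as iterates of a
  function rather than as distributions.\<close>

primrec exec_det :: "nat \<Rightarrow> instr \<Rightarrow> ram_state \<Rightarrow> ram_state" where
  "exec_det W (Const d c) s = set_reg d (c mod W) s"
| "exec_det W (Add d a b) s = set_reg d ((reg s a + reg s b) mod W) s"
| "exec_det W (Sub d a b) s = set_reg d (reg s a - reg s b) s"
| "exec_det W (Mul d a b) s = set_reg d ((reg s a * reg s b) mod W) s"
| "exec_det W (Div d a b) s = set_reg d (reg s a div reg s b) s"
| "exec_det W (Load d a) s = set_reg d (mem s (reg s a)) s"
| "exec_det W (Store a b) s = s\<lparr>pc := Suc (pc s), mem := (mem s)(reg s a := reg s b)\<rparr>"
| "exec_det W (Rand d a) s = s"
| "exec_det W (JumpZero a t) s = s\<lparr>pc := (if reg s a = 0 then t else Suc (pc s))\<rparr>"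

text \<open>
  Registers 2, 6 and 7 hold \<open>k\<close>, the candidate \<open>v\<close> and the summation index \<open>i\<close>, all counted from 0;
  register 10 accumulates the score, and registers 8 and 9 hold the value of \<^const>\<open>scan_best\<close>. Registers 3, 4
  and 5 hold the base addresses of \<open>H\<close>, of the output and of \<open>n\<close> cells in which the used vertices are
  marked. Register 15 is never written, so that \<open>JumpZero 15\<close> is an unconditional jump.
\<close>

definition greedy_prog :: "instr list" where
  "greedy_prog =
    [Const 1 1, Mul 3 0 0, Add 4 3 3, Add 5 4 0,
     Sub 11 0 2, JumpZero 11 47, Const 6 0, Const 8 0, Const 9 0,
     Sub 11 0 6, JumpZero 11 40, Add 12 5 6, Load 12 12, JumpZero 12 15, JumpZero 15 38,
     Const 7 0, Const 10 0,
     Sub 11 2 7, JumpZero 11 33, Mul 12 7 0, Add 12 12 2, Load 12 12, Add 13 4 7, Load 13 13,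
     Sub 13 13 1, Mul 13 13 0, Add 13 13 3, Add 13 13 6, Load 13 13, Mul 12 12 13, Add 10 10 12,
     Add 7 7 1, JumpZero 15 17,
     Add 10 10 1, Sub 11 10 8, JumpZero 11 38, Add 8 10 15, Add 9 6 1,
     Add 6 6 1, JumpZero 15 9,
     Add 12 4 2, Store 12 9, Sub 12 9 1, Add 12 12 5, Store 12 1, Add 2 2 1, JumpZero 15 4]"

lemma length_greedy_prog: "length greedy_prog = 47"
  by (simp add: greedy_prog_def)

definition greedy_step :: "nat \<Rightarrow> ram_state \<Rightarrow> ram_state" where
  "greedy_step W s = (if pc s < 47 then exec_det W (greedy_prog ! pc s) s else s)"

lemma ram_step_greedy: "ram_step W greedy_prog s = return_pmf (greedy_step W s)"
proof -
  have "exec_instr W i s = return_pmf (exec_det W i s)" if "i \<in> set greedy_prog" for i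
    using that by (auto simp: greedy_prog_def)
  then show ?thesis by (auto simp: ram_step_def halted_def greedy_step_def length_greedy_prog not_le)
qed

lemma ram_run_greedy: "ram_run W greedy_prog t s = return_pmf ((greedy_step W ^^ t) s)"
  by (induction t arbitrary: s) (simp_all add: ram_step_greedy bind_return_pmf funpow_swap1)

text \<open>A bound on the number of steps instead of an exact count, because the branches in the
  loops differ in length. Since halted states stay fixed, a bound is enough.\<close>

definition reaches :: "nat \<Rightarrow> nat \<Rightarrow> ram_state \<Rightarrow> ram_state \<Rightarrow> bool" where
  "reaches W t s s' \<longleftrightarrow> (\<exists>u\<le>t. (greedy_step W ^^ u) s = s')"

lemma reaches_trans: "reaches W t s s' \<Longrightarrow> reaches W t' s' s'' \<Longrightarrow> reaches W (t + t') s s''"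
  unfolding reaches_def
proof (elim exE conjE)
  fix u u' assume "u \<le> t" "(greedy_step W ^^ u) s = s'" "u' \<le> t'" "(greedy_step W ^^ u') s' = s''"
  then show "\<exists>u\<le>t + t'. (greedy_step W ^^ u) s = s''"
    by (intro exI[of _ "u' + u"]) (auto simp: funpow_add)
qed

lemma reaches_mono: "reaches W t s s' \<Longrightarrow> t \<le> t' \<Longrightarrow> reaches W t' s s'"
  unfolding reaches_def using le_trans by blast

lemma reaches_funpow: "reaches W t s ((greedy_step W ^^ t) s)"
  unfolding reaches_def by blast

lemma set_reg_sel [simp]:
  "pc (set_reg d v s) = Suc (pc s)" "reg (set_reg d v s) x = (if x = d then v else reg s x)" "mem (set_reg d v s) = mem s"
  by (simp_all add: set_reg_def)

text \<open>The first positions also appear as \<open>Suc\<close> terms, the form that the program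
  counter takes when execution starts from 0.\<close>

lemma greedy_prog_nth:
  "greedy_prog ! 0 = Const 1 1" "greedy_prog ! Suc 0 = Mul 3 0 0" "greedy_prog ! Suc (Suc 0) = Add 4 3 3" "greedy_prog ! Suc (Suc (Suc 0)) = Add 5 4 0" "greedy_prog ! 2 = Add 4 3 3" "greedy_prog ! 3 = Add 5 4 0"
  "greedy_prog ! 4 = Sub 11 0 2" "greedy_prog ! 5 = JumpZero 11 47" "greedy_prog ! 6 = Const 6 0" "greedy_prog ! 7 = Const 8 0"
  "greedy_prog ! 8 = Const 9 0" "greedy_prog ! 9 = Sub 11 0 6" "greedy_prog ! 10 = JumpZero 11 40" "greedy_prog ! 11 = Add 12 5 6"
  "greedy_prog ! 12 = Load 12 12" "greedy_prog ! 13 = JumpZero 12 15" "greedy_prog ! 14 = JumpZero 15 38" "greedy_prog ! 15 = Const 7 0"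
  "greedy_prog ! 16 = Const 10 0" "greedy_prog ! 17 = Sub 11 2 7" "greedy_prog ! 18 = JumpZero 11 33" "greedy_prog ! 19 = Mul 12 7 0"
  "greedy_prog ! 20 = Add 12 12 2" "greedy_prog ! 21 = Load 12 12" "greedy_prog ! 22 = Add 13 4 7" "greedy_prog ! 23 = Load 13 13"
  "greedy_prog ! 24 = Sub 13 13 1" "greedy_prog ! 25 = Mul 13 13 0" "greedy_prog ! 26 = Add 13 13 3" "greedy_prog ! 27 = Add 13 13 6"
  "greedy_prog ! 28 = Load 13 13" "greedy_prog ! 29 = Mul 12 12 13" "greedy_prog ! 30 = Add 10 10 12" "greedy_prog ! 31 = Add 7 7 1"
  "greedy_prog ! 32 = JumpZero 15 17" "greedy_prog ! 33 = Add 10 10 1" "greedy_prog ! 34 = Sub 11 10 8" "greedy_prog ! 35 = JumpZero 11 38"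
  "greedy_prog ! 36 = Add 8 10 15" "greedy_prog ! 37 = Add 9 6 1" "greedy_prog ! 38 = Add 6 6 1" "greedy_prog ! 39 = JumpZero 15 9"
  "greedy_prog ! 40 = Add 12 4 2" "greedy_prog ! 41 = Store 12 9" "greedy_prog ! 42 = Sub 12 9 1" "greedy_prog ! 43 = Add 12 12 5"
  "greedy_prog ! 44 = Store 12 1" "greedy_prog ! 45 = Add 2 2 1" "greedy_prog ! 46 = JumpZero 15 4"
  by (simp_all add: greedy_prog_def)

text \<open>Peels off the first step, so that simplification executes the instructions in program
  order.\<close>

lemma funpow_numeral_rev: "(f ^^ numeral k) x = (f ^^ pred_numeral k) (f x)"
  by (simp add: numeral_eq_Suc funpow_swap1)

text \<open>The blocks are \<open>G\<close>, \<open>H\<close>, the output and the marks of used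
  vertices. The address of an entry of \<open>H\<close> is written in the order in which the program
  adds its parts.\<close>

definition memory_holds :: "nat \<Rightarrow> graph \<Rightarrow> graph \<Rightarrow> nat list \<Rightarrow> (nat \<Rightarrow> nat) \<Rightarrow> bool" where
  "memory_holds n G H xs m \<longleftrightarrow>
     (\<forall>a b. a < n \<longrightarrow> b < n \<longrightarrow> m (a * n + b) = adj G (Suc a) (Suc b) \<and> m (a * n + n * n + b) = adj H (Suc a) (Suc b)) \<and>
     (\<forall>i<length xs. m (2 * n * n + i) = xs ! i) \<and>
     (\<forall>v<n. m (2 * n * n + n + v) = of_bool (Suc v \<in> set xs))"

definition base_regs :: "nat \<Rightarrow> nat \<Rightarrow> ram_state \<Rightarrow> bool" where
  "base_regs n k s \<longleftrightarrow> reg s 0 = n \<and> reg s 1 = 1 \<and> reg s 2 = k \<and> reg s 3 = n * n \<and> reg s 4 = 2 * n * n \<and>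
     reg s 5 = 2 * n * n + n \<and> reg s 15 = 0"

context
  fixes n W :: nat and G H :: graph
  assumes W: "W = (n + 2) ^ 4"
begin

text \<open>All addresses and counters stay below this bound, so with the exponent 4 no arithmetic
  wraps around and the \<open>mod\<close> terms disappear.\<close>

lemma word_bounds: "2 * n * n + 2 * n + 2 < W"
proof -
  have "2 * n * n + 2 * n + 2 < (n + 2) * (n + 2) * 4" by (simp add: algebra_simps)
  also have "\<dots> \<le> (n + 2) * (n + 2) * ((n + 2) * (n + 2))" by (intro mult_left_mono) (simp_all add: algebra_simps)
  also have "\<dots> = W" by (simp only: W power4_eq_xxxx mult.assoc)
  finally show ?thesis .
qed

lemma index_bound: "a < n \<Longrightarrow> b < n \<Longrightarrow> a * n + b < n * n"
proof -
  assume "a < n" "b < n"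
  then have "a * n + b < Suc a * n" by simp
  also have "\<dots> \<le> n * n" using \<open>a < n\<close> by (intro mult_right_mono) auto
  finally show ?thesis .
qed

lemma score_le_length: "score G H xs v \<le> length xs"
proof -
  have "score G H xs v \<le> card {1..length xs}"
    unfolding score_def by (intro card_mono) (auto simp: new_nbrs_def)
  then show ?thesis by simp
qed

text \<open>Positions 17 to 32 are the loop over the summation index: 16 instructions per round, and
  2 for leaving it. Truncated subtraction followed by \<open>JumpZero\<close> acts as the
  comparison.\<close>

lemma inner_loop:
  assumes "xs \<in> partial_inj n k" "k < n" "v < n"
    and "memory_holds n G H xs (mem s)" "base_regs n k s" "pc s = 17" "reg s 6 = v"
    "reg s 7 = i" "i \<le> k" "reg s 10 = (\<Sum>j<i. adj G (Suc j) (Suc k) * adj H (xs ! j) (Suc v))"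
  shows "\<exists>s'. reaches W (16 * (k - i) + 2) s s' \<and> pc s' = 33 \<and> base_regs n k s' \<and> mem s' = mem s \<and>
    reg s' 6 = v \<and> reg s' 8 = reg s 8 \<and> reg s' 9 = reg s 9 \<and> reg s' 10 = score G H xs (Suc v)"
  using assms(4-)
proof (induction "k - i" arbitrary: s i)
  case 0
  then have [simp]: "i = k" by simp
  have len: "length xs = k" using assms(1) by (simp add: partial_inj_def)
  let ?s = "(greedy_step W ^^ 2) s"
  have "reaches W (16 * (k - i) + 2) s ?s" by (rule reaches_mono[OF reaches_funpow]) simp
  moreover have "pc ?s = 33 \<and> base_regs n k ?s \<and> mem ?s = mem s \<and>
    reg ?s 6 = v \<and> reg ?s 8 = reg s 8 \<and> reg ?s 9 = reg s 9 \<and> reg ?s 10 = score G H xs (Suc v)"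
    using 0 len by (simp add: funpow_numeral_rev greedy_step_def greedy_prog_nth base_regs_def score_eq_sum)
  ultimately show ?case by blast
next
  case (Suc d)
  let ?s = "(greedy_step W ^^ 16) s"
  have len: "length xs = k" using assms(1) by (simp add: partial_inj_def)
  have i: "i < k" "d = k - Suc i" using Suc.hyps(2) by auto
  \<comment> \<open>Stored images count from 1, rows of the matrices from 0.\<close>
  define u where "u = xs ! i - 1"
  have "xs ! i \<in> set xs" "set xs \<subseteq> {1..n}" using assms(1) i by (simp_all add: partial_inj_def)
  then have "xs ! i \<in> {1..n}" by blast
  then have u: "xs ! i = Suc u" "u < n" by (auto simp: u_def)
  have mod: "i * n mod W = i * n" "(i * n + k) mod W = i * n + k" "(2 * n * n + i) mod W = 2 * n * n + i"
    "u * n mod W = u * n" "(u * n + n * n) mod W = u * n + n * n" "(u * n + n * n + v) mod W = u * n + n * n + v"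
    "Suc i mod W = Suc i"
    using index_bound[of i k] index_bound[of u v] i u assms(2,3) word_bounds by auto
  have m: "mem s (i * n + k) = adj G (Suc i) (Suc k)" "mem s (2 * n * n + i) = Suc u"
    "mem s (u * n + n * n + v) = adj H (Suc u) (Suc v)"
    using Suc.prems(1) i u assms(2,3) len by (auto simp: memory_holds_def)
  let ?S = "\<lambda>i. \<Sum>j<i. adj G (Suc j) (Suc k) * adj H (xs ! j) (Suc v)"
  have le1: "adj G (Suc i) (Suc k) * adj H (Suc u) (Suc v) \<le> 1" by (simp add: adj_def)
  have "?S (Suc i) \<le> (\<Sum>j<Suc i. 1)" by (intro sum_mono) (simp add: adj_def)
  then have "?S i + adj G (Suc i) (Suc k) * adj H (Suc u) (Suc v) \<le> Suc i" using u by simp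
  then have mod2: "(?S i + adj G (Suc i) (Suc k) * adj H (Suc u) (Suc v)) mod W = ?S i + adj G (Suc i) (Suc k) * adj H (Suc u) (Suc v)"
    "(adj G (Suc i) (Suc k) * adj H (Suc u) (Suc v)) mod W = adj G (Suc i) (Suc k) * adj H (Suc u) (Suc v)"
    using word_bounds i assms(2) le1 by (auto intro!: mod_less)
  have s: "pc ?s = 17" "base_regs n k ?s" "mem ?s = mem s" "reg ?s 6 = v" "reg ?s 7 = Suc i" "reg ?s 8 = reg s 8"
    "reg ?s 9 = reg s 9" "reg ?s 10 = ?S (Suc i)"
    using Suc.prems i u(1) mod mod2 m
    by (simp_all add: funpow_numeral_rev greedy_step_def greedy_prog_nth base_regs_def mult.assoc)
  obtain s' where s': "reaches W (16 * (k - Suc i) + 2) ?s s'" "pc s' = 33" "base_regs n k s'" "mem s' = mem ?s"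
    "reg s' 6 = v" "reg s' 8 = reg ?s 8" "reg s' 9 = reg ?s 9" "reg s' 10 = score G H xs (Suc v)"
    using Suc.hyps(1)[OF i(2), of ?s] Suc.prems(1) i s by auto
  have "16 * (k - i) + 2 = 16 + (16 * (k - Suc i) + 2)" using i by simp
  then have "reaches W (16 * (k - i) + 2) s s'" using reaches_trans[OF reaches_funpow s'(1)] by (simp only:)
  then show ?case using s'(2-) s by (intro exI[of _ s']) simp
qed

text \<open>Positions 9 to 39 handle one candidate, with at most 7 instructions before and 7 after
  the inner loop; this gives \<open>16 * k + 16\<close>.\<close>

lemma candidate_loop:
  assumes "xs \<in> partial_inj n k" "k < n"
    and "memory_holds n G H xs (mem s)" "base_regs n k s" "pc s = 9" "reg s 6 = v" "v \<le> n"
    "(reg s 8, reg s 9) = scan_best (score G H xs) (set xs) v"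
  shows "\<exists>s'. reaches W ((n - v) * (16 * k + 16) + 2) s s' \<and> pc s' = 40 \<and> base_regs n k s' \<and> mem s' = mem s \<and>
    reg s' 9 = greedy_pick n G H xs"
  using assms(3-)
proof (induction "n - v" arbitrary: s v)
  case 0
  then have v: "v = n" by simp
  let ?s = "(greedy_step W ^^ 2) s"
  have "reaches W ((n - v) * (16 * k + 16) + 2) s ?s" by (rule reaches_mono[OF reaches_funpow]) simp
  moreover have "reg s 9 = greedy_pick n G H xs"
    using 0 v unfolding greedy_pick_def by (metis snd_conv)
  then have "pc ?s = 40 \<and> base_regs n k ?s \<and> mem ?s = mem s \<and> reg ?s 9 = greedy_pick n G H xs"
    using 0 v by (simp add: funpow_numeral_rev greedy_step_def greedy_prog_nth base_regs_def)
  ultimately show ?case by blast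
next
  case (Suc d)
  let ?f = "score G H xs"
  have v: "v < n" "d = n - Suc v" using Suc.hyps(2) by auto
  have len: "length xs = k" using assms(1) by (simp add: partial_inj_def)
  have best: "reg s 8 = fst (scan_best ?f (set xs) v)" "reg s 9 = snd (scan_best ?f (set xs) v)"
    using Suc.prems(6) by (metis fst_conv, metis snd_conv)
  have "\<exists>s'. reaches W (16 * k + 16) s s' \<and> pc s' = 9 \<and> base_regs n k s' \<and> mem s' = mem s \<and> reg s' 6 = Suc v \<and>
     (reg s' 8, reg s' 9) = scan_best ?f (set xs) (Suc v)"
  proof (cases "Suc v \<in> set xs")
    case True
    let ?s = "(greedy_step W ^^ 8) s"
    have "mem s (2 * n * n + n + v) = 1" using Suc.prems(1) v True by (simp add: memory_holds_def)
    moreover have "(2 * n * n + n + v) mod W = 2 * n * n + n + v" "Suc v mod W = Suc v"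
      using word_bounds v by (auto intro!: mod_less)
    ultimately have "pc ?s = 9 \<and> base_regs n k ?s \<and> mem ?s = mem s \<and> reg ?s 6 = Suc v \<and>
      reg ?s 8 = reg s 8 \<and> reg ?s 9 = reg s 9"
      using Suc.prems v by (simp add: funpow_numeral_rev greedy_step_def greedy_prog_nth base_regs_def)
    moreover have "reaches W (16 * k + 16) s ?s" by (rule reaches_mono[OF reaches_funpow]) simp
    ultimately show ?thesis using True best by (intro exI[of _ ?s]) simp
  next
    case False
    let ?s = "(greedy_step W ^^ 7) s"
    have "mem s (2 * n * n + n + v) = 0" using Suc.prems(1) v False by (simp add: memory_holds_def)
    moreover have "(2 * n * n + n + v) mod W = 2 * n * n + n + v"
      using word_bounds v by (auto intro!: mod_less)
    ultimately have s: "pc ?s = 17" "base_regs n k ?s" "mem ?s = mem s" "reg ?s 6 = v" "reg ?s 7 = 0" "reg ?s 10 = 0"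
      "reg ?s 8 = reg s 8" "reg ?s 9 = reg s 9"
      using Suc.prems v by (simp_all add: funpow_numeral_rev greedy_step_def greedy_prog_nth base_regs_def)
    have "\<exists>s'. reaches W (16 * (k - 0) + 2) ?s s' \<and> pc s' = 33 \<and> base_regs n k s' \<and> mem s' = mem ?s \<and>
      reg s' 6 = v \<and> reg s' 8 = reg ?s 8 \<and> reg s' 9 = reg ?s 9 \<and> reg s' 10 = ?f (Suc v)"
      using s Suc.prems(1) by (intro inner_loop[OF assms(1,2) v(1)]) simp_all
    then obtain t where t: "reaches W (16 * k + 2) ?s t" "pc t = 33" "base_regs n k t" "mem t = mem s"
      "reg t 6 = v" "reg t 8 = reg s 8" "reg t 9 = reg s 9" "reg t 10 = ?f (Suc v)"
      using s by auto
    have "?f (Suc v) \<le> k" using score_le_length[of xs "Suc v"] len by simp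
    then have mod: "Suc (?f (Suc v)) mod W = Suc (?f (Suc v))" "Suc v mod W = Suc v"
      using word_bounds v assms(2) by (auto intro!: mod_less)
    have reach: "reaches W (7 + (16 * k + 2) + 7) s r" if "reaches W 7 t r" for r
      using reaches_trans[OF reaches_trans[OF reaches_funpow t(1)] that] .
    show ?thesis
    \<comment> \<open>Position 34 subtracts register 8 from the score plus one. The truncated
      difference is 0 exactly in the first case, where the previous best candidate is kept.\<close>
    proof (cases "?f (Suc v) < reg s 8")
      case True
      let ?t = "(greedy_step W ^^ 5) t"
      have "pc ?t = 9 \<and> base_regs n k ?t \<and> mem ?t = mem s \<and> reg ?t 6 = Suc v \<and> reg ?t 8 = reg s 8 \<and> reg ?t 9 = reg s 9"
        using t True mod by (simp add: funpow_numeral_rev greedy_step_def greedy_prog_nth base_regs_def)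
      moreover have "reaches W 7 t ?t" by (rule reaches_mono[OF reaches_funpow]) simp
      ultimately show ?thesis using True best reach[of ?t] by (intro exI[of _ ?t]) (simp add: add_ac)
    next
      case not_less: False
      let ?t = "(greedy_step W ^^ 7) t"
      have "pc ?t = 9 \<and> base_regs n k ?t \<and> mem ?t = mem s \<and> reg ?t 6 = Suc v \<and> reg ?t 8 = Suc (?f (Suc v)) \<and> reg ?t 9 = Suc v"
        using t not_less mod by (simp add: funpow_numeral_rev greedy_step_def greedy_prog_nth base_regs_def)
      moreover have "reaches W 7 t ?t" by (rule reaches_funpow)
      ultimately show ?thesis using not_less False best reach[of ?t] by (intro exI[of _ ?t]) (simp add: add_ac)
    qed
  qed
  then obtain t where t: "reaches W (16 * k + 16) s t" "pc t = 9" "base_regs n k t" "mem t = mem s" "reg t 6 = Suc v"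
     "(reg t 8, reg t 9) = scan_best ?f (set xs) (Suc v)" by blast
  obtain s' where s': "reaches W ((n - Suc v) * (16 * k + 16) + 2) t s'" "pc s' = 40" "base_regs n k s'" "mem s' = mem t"
    "reg s' 9 = greedy_pick n G H xs"
    using Suc.hyps(1)[OF v(2), of t] Suc.prems(1) v t by auto
  have "n - v = Suc (n - Suc v)" using v by simp
  then have "(n - v) * (16 * k + 16) + 2 = 16 * k + 16 + ((n - Suc v) * (16 * k + 16) + 2)" by simp
  then have "reaches W ((n - v) * (16 * k + 16) + 2) s s'" using reaches_trans[OF t(1) s'(1)] by (simp only:)
  then show ?case using s' t(4) by (intro exI[of _ s']) simp
qed

lemma memory_holds_snoc:
  assumes "memory_holds n G H xs m" "xs \<in> partial_inj n k" "k < n" "w < n"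
  shows "memory_holds n G H (xs @ [Suc w]) (m(2 * n * n + k := Suc w, 2 * n * n + n + w := Suc 0))"
proof -
  have len: "length xs = k" using assms(2) by (simp add: partial_inj_def)
  define m' where "m' = m(2 * n * n + k := Suc w, 2 * n * n + n + w := Suc 0)"
  have low: "m' a = m a" if "a < 2 * n * n" for a using that by (simp add: m'_def)
  have "m' (a * n + b) = adj G (Suc a) (Suc b) \<and> m' (a * n + n * n + b) = adj H (Suc a) (Suc b)"
    if "a < n" "b < n" for a b
  proof -
    have "a * n + b < 2 * n * n" "a * n + n * n + b < 2 * n * n" using index_bound[OF that] by simp_all
    then show ?thesis using assms(1) that by (simp add: low memory_holds_def)
  qed
  moreover have "m' (2 * n * n + i) = (xs @ [Suc w]) ! i" if "i < length (xs @ [Suc w])" for i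
    using that assms(1,3) len by (auto simp: m'_def memory_holds_def nth_append less_Suc_eq)
  moreover have "m' (2 * n * n + n + v) = of_bool (Suc v \<in> set (xs @ [Suc w]))" if "v < n" for v
    using that assms(1,3) by (auto simp: m'_def memory_holds_def)
  ultimately show ?thesis unfolding m'_def[symmetric] memory_holds_def by blast
qed

text \<open>Besides the scan, a round needs 5 instructions to start it, 2 to leave it and 7 to
  record the choice, which explains the 14.\<close>

lemma outer_loop:
  assumes "memory_holds n G H (greedy_list n G H k) (mem s)" "base_regs n k s" "pc s = 4" "k \<le> n"
  shows "\<exists>s'. reaches W ((n - k) * (n * (16 * n + 16) + 14) + 2) s s' \<and> pc s' = 47 \<and>
    memory_holds n G H (greedy_list n G H n) (mem s')"
  using assms
proof (induction "n - k" arbitrary: s k)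
  case 0
  then have k: "k = n" by simp
  let ?s = "(greedy_step W ^^ 2) s"
  have "reaches W ((n - k) * (n * (16 * n + 16) + 14) + 2) s ?s" by (rule reaches_mono[OF reaches_funpow]) simp
  moreover have "pc ?s = 47 \<and> memory_holds n G H (greedy_list n G H n) (mem ?s)"
    using 0 k by (simp add: funpow_numeral_rev greedy_step_def greedy_prog_nth base_regs_def)
  ultimately show ?case by blast
next
  case (Suc d)
  let ?xs = "greedy_list n G H k"
  have k: "k < n" "d = n - Suc k" using Suc.hyps(2) by auto
  have xs: "?xs \<in> partial_inj n k" using k by (intro greedy_list_partial_inj) simp
  let ?s = "(greedy_step W ^^ 5) s"
  have s: "pc ?s = 9" "base_regs n k ?s" "mem ?s = mem s" "reg ?s 6 = 0" "reg ?s 8 = 0" "reg ?s 9 = 0"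
    using Suc.prems k by (simp_all add: funpow_numeral_rev greedy_step_def greedy_prog_nth base_regs_def)
  have "\<exists>s'. reaches W ((n - 0) * (16 * k + 16) + 2) ?s s' \<and> pc s' = 40 \<and> base_regs n k s' \<and> mem s' = mem ?s \<and>
    reg s' 9 = greedy_pick n G H ?xs"
    using s Suc.prems(1) by (intro candidate_loop[OF xs k(1)]) simp_all
  then obtain t where t: "reaches W (n * (16 * k + 16) + 2) ?s t" "pc t = 40" "base_regs n k t" "mem t = mem s"
    "reg t 9 = greedy_pick n G H ?xs" using s by auto
  define w where "w = greedy_pick n G H ?xs - 1"
  have w: "greedy_pick n G H ?xs = Suc w" "w < n" using greedy_pick(1)[OF xs k(1), of G H] by (auto simp: w_def)
  let ?t = "(greedy_step W ^^ 7) t"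
  have mod: "(2 * n * n + k) mod W = 2 * n * n + k" "(w + (2 * n * n + n)) mod W = 2 * n * n + n + w" "Suc k mod W = Suc k"
    using word_bounds k w by (auto intro!: mod_less)
  have t': "pc ?t = 4" "base_regs n (Suc k) ?t" "mem ?t = (mem s)(2 * n * n + k := Suc w, 2 * n * n + n + w := Suc 0)"
    using t w(1) mod by (simp_all add: funpow_numeral_rev greedy_step_def greedy_prog_nth base_regs_def)
  have mem: "memory_holds n G H (greedy_list n G H (Suc k)) (mem ?t)"
    unfolding t' using memory_holds_snoc[OF Suc.prems(1) xs k(1) w(2)] w(1) by simp
  obtain s' where s': "reaches W ((n - Suc k) * (n * (16 * n + 16) + 14) + 2) ?t s'" "pc s' = 47"
    "memory_holds n G H (greedy_list n G H n) (mem s')"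
    using Suc.hyps(1)[OF k(2) mem t'(2,1)] k by auto
  have "reaches W (5 + (n * (16 * k + 16) + 2) + 7 + ((n - Suc k) * (n * (16 * n + 16) + 14) + 2)) s s'"
    using reaches_trans[OF reaches_trans[OF reaches_trans[OF reaches_funpow t(1)] reaches_funpow] s'(1)] .
  moreover have "n * (16 * k + 16) \<le> n * (16 * n + 16)" using k by (intro mult_left_mono) auto
  moreover have "n - k = Suc (n - Suc k)" using k by simp
  ultimately have "reaches W ((n - k) * (n * (16 * n + 16) + 14) + 2) s s'" by (elim reaches_mono) simp
  then show ?case using s' by blast
qed

lemma greedy_prog_correct:
  "\<exists>s. reaches W (n * (n * (16 * n + 16) + 14) + 6) (ram_input n G H) s \<and> pc s = 47 \<and>
    memory_holds n G H (greedy_list n G H n) (mem s)"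
proof -
  let ?i = "ram_input n G H"
  let ?s = "(greedy_step W ^^ 4) ?i"
  have "n * n mod W = n * n" "(2 * (n * n)) mod W = 2 * (n * n)" "(2 * (n * n) + n) mod W = 2 * (n * n) + n" "1 mod W = 1"
    using word_bounds by (auto intro!: mod_less)
  then have s: "pc ?s = 4" "base_regs n 0 ?s" "mem ?s = mem ?i"
    by (simp_all add: funpow_numeral_rev greedy_step_def greedy_prog_nth base_regs_def ram_input_def mult_2[symmetric] mult.assoc)
  have "memory_holds n G H [] (mem ?i)"
    unfolding memory_holds_def
  proof (intro conjI allI impI)
    fix a b assume ab: "a < n" "b < n"
    then show "mem ?i (a * n + b) = adj G (Suc a) (Suc b)" "mem ?i (a * n + n * n + b) = adj H (Suc a) (Suc b)"
      using index_bound[OF ab] by (auto simp: ram_input_def)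
  qed (auto simp: ram_input_def)
  then have "\<exists>s'. reaches W ((n - 0) * (n * (16 * n + 16) + 14) + 2) ?s s' \<and> pc s' = 47 \<and>
    memory_holds n G H (greedy_list n G H n) (mem s')"
    using s by (intro outer_loop) simp_all
  then obtain s' where s': "reaches W (n * (n * (16 * n + 16) + 14) + 2) ?s s'" "pc s' = 47"
    "memory_holds n G H (greedy_list n G H n) (mem s')" by auto
  have "reaches W (4 + (n * (n * (16 * n + 16) + 14) + 2)) ?i s'"
    using reaches_trans[OF reaches_funpow s'(1)] .
  then show ?thesis using s' by (intro exI[of _ s']) (simp add: add_ac)
qed

end

lemma runs_in_time_greedy: "runs_in_time greedy_algorithm (\<lambda>n. n * (n * (16 * n + 16) + 14) + 6)"
  unfolding runs_in_time_def Let_def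
proof (rule exI[of _ greedy_prog], rule exI[of _ "4 :: nat"], rule conjI, simp, rule allI, rule ballI, rule ballI, rule conjI)
  fix n :: nat and G H
  let ?W = "(n + 2) ^ 4" and ?T = "n * (n * (16 * n + 16) + 14) + 6"
  obtain s u where s: "pc s = 47" "memory_holds n G H (greedy_list n G H n) (mem s)"
    and u: "u \<le> ?T" "(greedy_step ?W ^^ u) (ram_input n G H) = s"
    using greedy_prog_correct[OF refl, of n G H] unfolding reaches_def by blast
  \<comment> \<open>A halted state is a fixed point, so the time left over changes nothing.\<close>
  have "(greedy_step ?W ^^ j) s = s" for j
    by (induction j) (simp_all add: greedy_step_def s(1))
  then have "(greedy_step ?W ^^ (?T - u + u)) (ram_input n G H) = s"
    unfolding funpow_add comp_def u(2) .
  then have run: "ram_run ?W greedy_prog ?T (ram_input n G H) = return_pmf s"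
    unfolding ram_run_greedy using u(1) by simp
  show "\<forall>s\<in>set_pmf (ram_run ?W greedy_prog ?T (ram_input n G H)). halted greedy_prog s"
    unfolding run by (simp add: halted_def length_greedy_prog s(1))
  have len: "length (greedy_list n G H n) = n"
    using greedy_list_partial_inj[of n n G H] by (simp add: partial_inj_def)
  have "ram_output n s = perm_of_list (greedy_list n G H n)"
  proof
    fix i
    have "mem s (2 * n * n + (i - 1)) = greedy_list n G H n ! (i - 1)" if "i \<in> {1..n}"
    proof -
      have "i - 1 < n" using that by auto
      then show ?thesis using s(2) len by (simp add: memory_holds_def)
    qed
    then show "ram_output n s i = perm_of_list (greedy_list n G H n) i"
      unfolding ram_output_def perm_of_list_def len by simp
  qed
  then show "map_pmf (ram_output n) (ram_run ?W greedy_prog ?T (ram_input n G H)) = greedy_algorithm n G H"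
    unfolding run by (simp add: greedy_algorithm_def)
qed

lemma greedy_time_bigo: "(\<lambda>n. real (n * (n * (16 * n + 16) + 14) + 6)) \<in> O(\<lambda>n. real n ^ 3)"
\<comment> \<open>52 is the sum of the coefficients 16, 16, 14 and 6.\<close>
proof (rule bigoI[of _ 52])
  show "\<forall>\<^sub>F n in sequentially. norm (real (n * (n * (16 * n + 16) + 14) + 6)) \<le> 52 * norm (real n ^ 3)"
    using eventually_ge_at_top[of 1]
  proof eventually_elim
    case (elim n)
    then have 1: "1 \<le> n * n" using mult_le_mono[of 1 n 1 n] by simp
    have 2: "n \<le> n * n * n" using mult_le_mono[OF 1, of n n] by simp
    have 3: "n * n \<le> n * n * n" using mult_le_mono[of "n * n" "n * n" 1 n] elim by simp
    have "n * (n * (16 * n + 16) + 14) + 6 = 16 * (n * n * n) + 16 * (n * n) + 14 * n + 6" by (simp add: algebra_simps)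
    also have "\<dots> \<le> 52 * (n * n * n)" using 1 2 3 by linarith
    finally have "n * (n * (16 * n + 16) + 14) + 6 \<le> 52 * (n * n * n)" .
    from of_nat_mono[OF this, where 'a = real] show ?case by (simp add: power3_eq_cube)
  qed
qed


section \<open>One greedy step\<close>

text \<open>The subtracted term is twice the error in \<open>cut_lower\<close> divided by the number
  \<open>n - k\<close> of free vertices. Rounding to a natural number allows neighbourhoods to be
  cut to exactly this size.\<close>

definition degree_target :: "nat \<Rightarrow> real \<Rightarrow> nat \<Rightarrow> nat" where
  "degree_target n p k = nat \<lceil>real k * p - 4 * real n * sqrt (real n * p) / real (n - k)\<rceil>"

lemma sum_card_back_nbrs_cut:
  assumes "finite B" "distinct xs"
  shows "(\<Sum>v\<in>B. card (back_nbrs H xs v)) = card {(u, v) \<in> set xs \<times> B. {u, v} \<in> H}"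
proof -
  have "{(u, v) \<in> set xs \<times> B. {u, v} \<in> H} = (\<Union>v\<in>B. (\<lambda>u. (u, v)) ` {u \<in> set xs. {u, v} \<in> H})" by auto
  also have "card \<dots> = (\<Sum>v\<in>B. card ((\<lambda>u. (u, v)) ` {u \<in> set xs. {u, v} \<in> H}))"
    using assms(1) by (intro card_UN_disjoint) auto
  also have "\<dots> = (\<Sum>v\<in>B. card {u \<in> set xs. {u, v} \<in> H})"
    by (intro sum.cong refl card_image) (auto simp: inj_on_def)
  finally show ?thesis using assms(2) by (simp add: card_back_nbrs)
qed

context
  fixes n :: nat and p :: real and H :: graph
  assumes p: "0 < p" "p < 1" and H: "H \<in> simple_graphs n"
    and cut: "cut_lower p n H" and codeg: "codegree_upper p n H"
begin

lemma card_back_nbrs_Int_le: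
  assumes "xs \<in> partial_inj n k" "v \<in> {1..n}" "w \<in> {1..n}" "v \<noteq> w"
  shows "real (card (back_nbrs H xs v \<inter> back_nbrs H xs w)) \<le> 4 * real n * p\<^sup>2"
proof -
  have xs: "distinct xs" using assms(1) by (simp add: partial_inj_def)
  have fin: "finite {u. {u, v} \<in> H \<and> {u, w} \<in> H}"
  proof (rule finite_subset)
    have "{u, v} \<in> vertex_pairs n" if "{u, v} \<in> H" for u using that H by (auto simp: simple_graphs_def)
    then show "{u. {u, v} \<in> H \<and> {u, w} \<in> H} \<subseteq> {1..n}" unfolding doubleton_vertex_pairs by blast
  qed simp
  have "card (back_nbrs H xs v \<inter> back_nbrs H xs w) \<le> card {u. {u, v} \<in> H \<and> {u, w} \<in> H}"
  proof (rule card_inj_on_le[OF _ _ fin])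
    show "inj_on (\<lambda>i. xs ! (i - 1)) (back_nbrs H xs v \<inter> back_nbrs H xs w)"
      using xs by (auto simp: inj_on_def back_nbrs_def nth_eq_iff_index_eq)
  qed (auto simp: back_nbrs_def)
  also have "real (card {u. {u, v} \<in> H \<and> {u, w} \<in> H}) \<le> 4 * real n * p\<^sup>2"
    using codeg assms by (simp add: codegree_upper_def)
  finally show ?thesis by simp
qed

text \<open>If half of the free vertices had too few neighbours among the used ones, the cut between
  these two sets would violate \<open>cut_lower\<close>.\<close>

lemma many_good_candidates:
  assumes "xs \<in> partial_inj n k" "k < n"
  defines "V \<equiv> {v \<in> {1..n} - set xs. degree_target n p k \<le> card (back_nbrs H xs v)}"
  shows "real (n - k) / 2 \<le> real (card V)" "V \<noteq> {}"
proof -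
  define b where "b = 2 * real n * sqrt (real n * p)"
  define x where "x = real k * p - 2 * b / real (n - k)"
  define Bad where "Bad = {v \<in> {1..n} - set xs. real (card (back_nbrs H xs v)) < x}"
  have xs: "length xs = k" "distinct xs" "set xs \<subseteq> {1..n}" using assms(1) by (auto simp: partial_inj_def)
  have b: "0 < b" using assms(2) p by (simp add: b_def)
  have fin: "finite Bad" "finite V" by (auto simp: Bad_def V_def)
  have x: "degree_target n p k = nat \<lceil>x\<rceil>" by (simp add: degree_target_def x_def b_def mult.assoc)
  have "{1..n} - set xs - Bad \<subseteq> V"
    unfolding V_def Bad_def x by (auto simp: not_less ceiling_le_iff)
  then have "card ({1..n} - set xs - Bad) \<le> card V" using fin by (intro card_mono) auto
  moreover have "card ({1..n} - set xs - Bad) = n - k - card Bad"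
  proof -
    have "card ({1..n} - set xs) = n - k" using xs distinct_card[of xs] by (simp add: card_Diff_subset)
    then show ?thesis using fin by (subst card_Diff_subset) (auto simp: Bad_def)
  qed
  ultimately have V: "real (n - k) - real (card Bad) \<le> real (card V)" by linarith
  have "2 * real (card Bad) < real (n - k)"
  proof (cases "Bad = {}")
    case False
    have "real (card (set xs)) * real (card Bad) * p - b \<le> real (card {(u, v) \<in> set xs \<times> Bad. {u, v} \<in> H})"
    proof -
      have "Bad \<subseteq> {1..n}" "set xs \<inter> Bad = {}" by (auto simp: Bad_def)
      then show ?thesis using cut[unfolded cut_lower_def, rule_format, OF xs(3)] unfolding b_def by blast
    qed
    also have "\<dots> = (\<Sum>v\<in>Bad. real (card (back_nbrs H xs v)))"
      using sum_card_back_nbrs_cut[OF fin(1) xs(2), of H] by (simp flip: of_nat_sum)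
    also have "\<dots> < (\<Sum>v\<in>Bad. x)"
      using False fin by (intro sum_strict_mono) (auto simp: Bad_def)
    also have "\<dots> = real (card Bad) * (real k * p) - b * (2 * real (card Bad) / real (n - k))"
      by (simp add: x_def right_diff_distrib)
    finally have "b * (2 * real (card Bad) / real (n - k)) < b * 1"
      using xs distinct_card[of xs] by (simp add: mult_ac)
    then have "2 * real (card Bad) / real (n - k) < 1" using b by (simp only: mult_less_cancel_left_pos)
    then show ?thesis using assms(2) by (simp add: divide_less_eq)
  qed (use assms(2) in simp)
  then show half: "real (n - k) / 2 \<le> real (card V)" using V by linarith
  have "0 < real (n - k) / 2" using assms(2) by simp
  then have "0 < card V" using half by linarith
  then show "V \<noteq> {}" by auto
qed

text \<open>The target \<open>m * p + g\<close> is missed by at most \<open>g\<close>, when no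
  candidate comes near the tilted mean, plus the shortfall of one fixed candidate below its untilted
  mean. As the greedy choice dominates all candidates, each back neighbourhood may be cut to a
  subset of exactly \<open>m\<close> elements, the equal sizes that the second moment bound asks
  for. The case \<open>g = 0\<close> covers the steps near both ends.\<close>

lemma greedy_step_loss:
  fixes g \<eta> a t s \<kappa> :: real
  assumes "xs \<in> partial_inj n k" "k < n" "G \<in> simple_graphs k" "0 < a" "0 \<le> g"
  defines "m \<equiv> degree_target n p k"
  assumes "g = 0 \<or> 0 \<le> t \<and> 0 < s \<and> real m * tilted p t / s\<^sup>2 \<le> \<kappa> \<and> \<kappa> < 1 \<and> g \<le> real m * tilted p t - s - real m * p
     \<and> (exp (4 * real n * p\<^sup>2 * (p * (exp t - 1)\<^sup>2)) + exp (t * (real m * tilted p t + s)) / (real (n - k) / 2 * (1 - p + p * exp t) ^ m)) / (1 - \<kappa>)\<^sup>2 - 1 \<le> \<eta>"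
  shows "(\<integral>\<^sup>+C. (\<integral>\<^sup>+v. ennreal (max 0 (real m * p + g - real (card (C \<inter> back_nbrs H xs v))))
      \<partial>greedy_rule n (Suc k) (G \<union> new_edges k C) H xs) \<partial>random_subset {1..k} p) \<le> ennreal (g * \<eta> + (real m * p / a + a) / 2)"
proof -
  let ?R = "random_subset {1..k} p"
  define V where "V = {v \<in> {1..n} - set xs. degree_target n p k \<le> card (back_nbrs H xs v)}"
  have len: "length xs = k" using assms(1) by (simp add: partial_inj_def)
  note V = many_good_candidates[OF assms(1,2), folded V_def]
  have finV: "finite V" by (simp add: V_def)
  have bsub: "back_nbrs H xs v \<subseteq> {1..k}" for v using len by (auto simp: back_nbrs_def)
  have "\<forall>v. \<exists>B. v \<in> V \<longrightarrow> B \<subseteq> back_nbrs H xs v \<and> card B = m"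
  proof
    fix v
    show "\<exists>B. v \<in> V \<longrightarrow> B \<subseteq> back_nbrs H xs v \<and> card B = m"
    proof (cases "v \<in> V")
      case True
      then have "m \<le> card (back_nbrs H xs v)" by (simp add: V_def m_def)
      then show ?thesis by (rule obtain_subset_with_card_n) blast
    qed simp
  qed
  then obtain B where B: "\<And>v. v \<in> V \<Longrightarrow> B v \<subseteq> back_nbrs H xs v" "\<And>v. v \<in> V \<Longrightarrow> card (B v) = m" by metis
  \<comment> \<open>This candidate is fixed before the column is drawn, so the part of its score
    counted by \<open>B v0\<close> is a binomial variable.\<close>
  obtain v0 where v0: "v0 \<in> V" using V(2) by blast
  let ?fail = "{C. \<forall>v\<in>V. real (card (C \<inter> B v)) < real m * p + g}"
  let ?short = "\<lambda>C. max 0 (real m * p - real (card (C \<inter> B v0)))"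
  have "(\<integral>\<^sup>+C. (\<integral>\<^sup>+v. ennreal (max 0 (real m * p + g - real (card (C \<inter> back_nbrs H xs v))))
      \<partial>greedy_rule n (Suc k) (G \<union> new_edges k C) H xs) \<partial>?R) \<le> (\<integral>\<^sup>+C. ennreal (g * indicator ?fail C + ?short C) \<partial>?R)"
  proof (intro nn_integral_mono_AE AE_pmfI)
    fix C assume "C \<in> set_pmf ?R"
    then have C: "C \<subseteq> {1..k}" by (rule random_subset_subset)
    define G' where "G' = G \<union> new_edges k C"
    define w where "w = greedy_pick n G' H xs"
    have sc: "score G' H xs v = card (C \<inter> back_nbrs H xs v)" for v
      unfolding score_def len G'_def new_nbrs_union_new[OF assms(3) C] ..
    have ge: "card (C \<inter> B v) \<le> card (C \<inter> back_nbrs H xs w)" if "v \<in> V" for v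
    proof -
      have "card (C \<inter> B v) \<le> card (C \<inter> back_nbrs H xs v)"
        using B(1)[OF that] finite_subset[OF C] by (intro card_mono) auto
      also have "\<dots> \<le> card (C \<inter> back_nbrs H xs w)"
        using greedy_pick(2)[OF assms(1,2), of v G' H] that unfolding sc w_def by (simp add: V_def)
      finally show ?thesis .
    qed
    have "max 0 (real m * p + g - real (card (C \<inter> back_nbrs H xs w))) \<le> g * indicator ?fail C + ?short C"
    proof (cases "C \<in> ?fail")
      case True
      then show ?thesis using ge[OF v0] assms(5) by simp
    next
      case False
      then obtain v where "v \<in> V" "real m * p + g \<le> real (card (C \<inter> B v))" by (auto simp: not_less)
      then have "real m * p + g \<le> real (card (C \<inter> back_nbrs H xs w))" using ge[of v] by linarith
      then show ?thesis using False by simp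
    qed
    then show "(\<integral>\<^sup>+v. ennreal (max 0 (real m * p + g - real (card (C \<inter> back_nbrs H xs v))))
      \<partial>greedy_rule n (Suc k) (G \<union> new_edges k C) H xs) \<le> ennreal (g * indicator ?fail C + ?short C)"
      unfolding greedy_rule_def G'_def[symmetric] w_def[symmetric] by (simp add: ennreal_leI)
  qed
  also have "\<dots> = ennreal (measure_pmf.expectation ?R (\<lambda>C. g * indicator ?fail C + ?short C))"
    using assms(5) by (intro nn_integral_finite_pmf) auto
  also have "measure_pmf.expectation ?R (\<lambda>C. g * indicator ?fail C + ?short C) = g * measure_pmf.prob ?R ?fail + measure_pmf.expectation ?R ?short"
    by (subst Bochner_Integration.integral_add) (auto intro!: integrable_measure_pmf_finite)
  also have "\<dots> \<le> g * \<eta> + (real m * p / a + a) / 2"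
  proof (rule add_mono)
    show "measure_pmf.expectation ?R ?short \<le> (real m * p / a + a) / 2"
      using expectation_deficit_le[OF p, of "{1..k}" "B v0" a] B[OF v0] bsub[of v0] assms(4) by auto
    show "g * measure_pmf.prob ?R ?fail \<le> g * \<eta>"
      using assms(7)
    proof (elim disjE conjE)
      assume t: "0 \<le> t" "0 < s" "real m * tilted p t / s\<^sup>2 \<le> \<kappa>" "\<kappa> < 1" "g \<le> real m * tilted p t - s - real m * p"
        and \<eta>: "(exp (4 * real n * p\<^sup>2 * (p * (exp t - 1)\<^sup>2)) + exp (t * (real m * tilted p t + s)) / (real (n - k) / 2 * (1 - p + p * exp t) ^ m)) / (1 - \<kappa>)\<^sup>2 - 1 \<le> \<eta>"
      have "?fail \<subseteq> {C. \<forall>v\<in>V. real (card (C \<inter> B v)) < real m * tilted p t - s}"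
        using t(5) by force
      then have "measure_pmf.prob ?R ?fail \<le> measure_pmf.prob ?R {C. \<forall>v\<in>V. real (card (C \<inter> B v)) < real m * tilted p t - s}"
        by (intro measure_pmf.finite_measure_mono) auto
      also have "\<dots> \<le> (exp (4 * real n * p\<^sup>2 * (p * (exp t - 1)\<^sup>2)) + exp (t * (real m * tilted p t + s)) / (real (card V) * (1 - p + p * exp t) ^ m)) / (1 - \<kappa>)\<^sup>2 - 1"
      proof (rule prob_all_below_tilted_mean[OF p _ finV V(2) _ B(2) _ t(1-4)])
        show "B v \<subseteq> {1..k}" if "v \<in> V" for v using B(1)[OF that] bsub[of v] by blast
        show "real (card (B v \<inter> B w)) \<le> 4 * real n * p\<^sup>2" if "v \<in> V" "w \<in> V" "v \<noteq> w" for v w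
        proof -
          have "card (B v \<inter> B w) \<le> card (back_nbrs H xs v \<inter> back_nbrs H xs w)"
            using B(1) that finite_subset[OF bsub] by (intro card_mono Int_mono) auto
          then show ?thesis using card_back_nbrs_Int_le[OF assms(1), of v w] that by (simp add: V_def)
        qed
      qed auto
      also have "\<dots> \<le> \<eta>"
      proof (rule order_trans[OF diff_right_mono \<eta>], rule divide_right_mono, rule add_left_mono, rule divide_left_mono)
        have z: "0 < (1 - p + p * exp t) ^ m"
          using tilted_bounds(3)[OF p t(1)] by (intro zero_less_power) linarith
        show "real (n - k) / 2 * (1 - p + p * exp t) ^ m \<le> real (card V) * (1 - p + p * exp t) ^ m"
          using V(1) z by (intro mult_right_mono) auto
        show "0 < real (card V) * (1 - p + p * exp t) ^ m * (real (n - k) / 2 * (1 - p + p * exp t) ^ m)"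
          using V(2) finV z assms(2) by (intro mult_pos_pos) (auto simp: card_gt_0_iff)
      qed auto
      finally show ?thesis using assms(5) by (intro mult_left_mono)
    qed simp
  qed
  finally show ?thesis by (simp add: ennreal_leI)
qed

end


section \<open>Accumulated overlap of the greedy algorithm\<close>

lemma exp_minus_one_le: "0 \<le> t \<Longrightarrow> t \<le> 1 \<Longrightarrow> exp t - 1 \<le> 2 * (t::real)"
proof -
  assume t: "0 \<le> t" "t \<le> 1"
  have "t\<^sup>2 \<le> t * 1" unfolding power2_eq_square using t by (intro mult_left_mono) auto
  then show ?thesis using exp_bound[OF t] by simp
qed

text \<open>To first order the gain in density is \<open>p * t\<close>: the numerator of the
  difference is \<open>p * (1 - p) * (exp t - 1)\<close>, and the normaliser is at most
  \<open>1 + 2 * t\<close>.\<close>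

lemma tilted_gain:
  assumes "0 < p" "p < 1" "0 \<le> t" "t \<le> 1"
  shows "p * t * ((1 - p) * (1 - 2 * t)) \<le> tilted p t - p"
proof -
  define z where "z = 1 - p + p * exp t"
  have z1: "1 \<le> z" unfolding z_def using tilted_bounds(3)[OF assms(1-3)] .
  have "p * (exp t - 1) \<le> 1 * (2 * t)"
    using assms exp_minus_one_le[of t] by (intro mult_mono) auto
  then have z2: "z \<le> 1 + 2 * t" unfolding z_def by (simp add: algebra_simps)
  have "(1 - 2 * t) * z \<le> 1"
  proof (cases "2 * t \<le> 1")
    case True
    then have "(1 - 2 * t) * z \<le> (1 - 2 * t) * (1 + 2 * t)" using z2 by (intro mult_left_mono) auto
    also have "\<dots> = 1 - (2 * t)\<^sup>2" by (simp add: power2_eq_square algebra_simps)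
    also have "\<dots> \<le> 1" by simp
    finally show ?thesis .
  next
    case False
    then have "(1 - 2 * t) * z \<le> 0" using z1 by (intro mult_nonpos_nonneg) auto
    then show ?thesis by simp
  qed
  then have "p * t * (1 - p) * ((1 - 2 * t) * z) \<le> p * t * (1 - p) * 1"
    using assms by (intro mult_left_mono) auto
  also have "\<dots> = p * t * (1 - p)" by simp
  also have "\<dots> \<le> p * (exp t - 1) * (1 - p)"
  proof -
    have "t \<le> exp t - 1" using exp_ge_add_one_self[of t] by linarith
    then show ?thesis using assms by (intro mult_right_mono mult_left_mono) auto
  qed
  also have "\<dots> = p * exp t - p * z" by (simp add: z_def algebra_simps)
  finally have "p * t * ((1 - p) * (1 - 2 * t)) * z \<le> p * exp t - p * z" by (simp only: mult_ac)
  moreover have "tilted p t - p = (p * exp t - p * z) / z"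
    using z1 unfolding tilted_def z_def[symmetric] by (simp add: diff_divide_distrib)
  ultimately show ?thesis using z1 by (simp add: pos_le_divide_eq)
qed

lemma tilted_le: "0 < p \<Longrightarrow> p < 1 \<Longrightarrow> 0 \<le> t \<Longrightarrow> tilted p t \<le> p * exp t"
proof -
  assume *: "0 < p" "p < 1" "0 \<le> t"
  have "p * exp t / (1 - p + p * exp t) \<le> p * exp t / 1"
  proof (rule divide_left_mono)
    have z: "1 \<le> 1 - p + p * exp t" using tilted_bounds(3)[OF *] .
    then show "1 \<le> 1 - p + p * exp t" .
    show "0 < (1 - p + p * exp t) * 1" unfolding mult_1_right by (rule less_le_trans[OF zero_less_one z])
  qed (use * in simp)
  then show ?thesis by (simp add: tilted_def)
qed

text \<open>The left side is the relative entropy per element of the tilted law with respect to the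
  original one, about \<open>p * t^2 / 2\<close>. It governs the diagonal term of the second moment
  bound.\<close>

lemma tilted_rate:
  assumes "0 < p" "p \<le> 1 / 2" "0 \<le> t" "t \<le> 1"
  shows "t * tilted p t - ln (1 - p + p * exp t) \<le> p * t\<^sup>2 / 2 * (exp (2 * t) + 8 * p)"
proof -
  define y where "y = p * (exp t - 1)"
  have e: "exp t - 1 \<le> 2 * t" "0 \<le> exp t - 1" using exp_minus_one_le assms by auto
  have y: "0 \<le> y" using assms e by (simp add: y_def)
  have "y \<le> 1 / 2 * (2 * 1)" unfolding y_def using assms e by (intro mult_mono) auto
  then have "y - y\<^sup>2 \<le> ln (1 + y)" using y by (intro ln_one_plus_pos_lower_bound) auto
  moreover have "1 + y = 1 - p + p * exp t" by (simp add: y_def algebra_simps)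
  moreover have "t * tilted p t \<le> t * (p * exp t)" using tilted_le assms by (intro mult_left_mono) auto
  ultimately have 1: "t * tilted p t - ln (1 - p + p * exp t) \<le> p * (t * exp t - exp t + 1) + y\<^sup>2"
    by (simp add: y_def algebra_simps)
  have "y\<^sup>2 \<le> (p * (2 * t))\<^sup>2" using y assms e unfolding y_def by (intro power_mono mult_left_mono) auto
  then have 2: "y\<^sup>2 \<le> p * t\<^sup>2 / 2 * (8 * p)" by (simp add: power2_eq_square mult_ac)
  \<comment> \<open>Taylor expansion at \<open>- t\<close>, since
    \<open>t * exp t - exp t + 1\<close> equals \<open>exp t * (t - 1 + exp (- t))\<close>.\<close>
  obtain s where s: "\<bar>s\<bar> \<le> \<bar>- t\<bar>" "exp (- t) = (\<Sum>m<2. (- t) ^ m / fact m) + exp s / fact 2 * (- t) ^ 2"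
    using Maclaurin_exp_le[of "- t" 2] by blast
  have "exp s \<le> exp t" using s(1) assms by simp
  then have "exp s * t\<^sup>2 / 2 \<le> exp t * t\<^sup>2 / 2" by (intro divide_right_mono mult_right_mono) auto
  then have "t - 1 + exp (- t) \<le> exp t * t\<^sup>2 / 2" using s(2) by (simp add: numeral_2_eq_2)
  then have "exp t * (t - 1 + exp (- t)) \<le> exp t * (exp t * t\<^sup>2 / 2)" by (intro mult_left_mono) auto
  moreover have "exp (2 * t) = exp t * exp t" by (simp add: exp_add[symmetric])
  ultimately have "t * exp t - exp t + 1 \<le> exp (2 * t) * t\<^sup>2 / 2"
    by (simp only:) (simp add: distrib_left right_diff_distrib exp_minus power2_eq_square mult_ac)
  then have "p * (t * exp t - exp t + 1) \<le> p * (exp (2 * t) * t\<^sup>2 / 2)" using assms by (intro mult_left_mono) auto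
  then have "p * (t * exp t - exp t + 1) + y\<^sup>2 \<le> p * (exp (2 * t) * t\<^sup>2 / 2) + p * t\<^sup>2 / 2 * (8 * p)"
    using 2 by (rule add_mono)
  also have "\<dots> = p * t\<^sup>2 / 2 * (exp (2 * t) + 8 * p)" by (simp add: algebra_simps)
  finally show ?thesis using 1 by (rule order_trans[rotated])
qed

lemma harm_le_ln: "0 < n \<Longrightarrow> harm n \<le> 1 + ln (real n)"
proof (induction n rule: nat_induct_non_zero)
  case (Suc n)
  have "ln (real n / real (Suc n)) \<le> real n / real (Suc n) - 1"
    using Suc.hyps by (intro ln_le_minus_one) simp
  moreover have "real n / real (Suc n) - 1 = - inverse (real (Suc n))" by (simp add: field_simps)
  moreover have "ln (real n / real (Suc n)) = ln (real n) - ln (real (Suc n))" using Suc.hyps by (simp add: ln_div)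
  ultimately show ?case using Suc.IH unfolding harm_Suc by linarith
qed (simp add: harm_expand)

lemma real_nat_ceiling_le: "0 \<le> x \<Longrightarrow> real (nat \<lceil>x\<rceil>) \<le> x + 1"
  using of_int_ceiling_le_add_one[of x] by simp

text \<open>Collects the inequalities that allow the analysis at a fixed \<open>n\<close>; in the
  dense regime they hold for all large \<open>n\<close>. The recurring product
  \<open>sqrt (2 / \<delta>) * (sqrt (ln n / n) / p)\<close> bounds the tilts of the steps with
  \<open>k >= \<delta> n\<close>.\<close>

definition greedy_regime :: "nat \<Rightarrow> real \<Rightarrow> real \<Rightarrow> bool" where
  "greedy_regime n p \<delta> \<longleftrightarrow> 0 < \<delta> \<and> \<delta> \<le> 1 / 12 \<and> 0 < p \<and> p \<le> \<delta> / 3 \<and> 4 \<le> real n * p \<and> 1 \<le> \<delta> * (real n * p) \<and>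
     sqrt (2 / \<delta>) * (sqrt (ln (real n) / real n) / p) \<le> \<delta> / 6 \<and> 4 / (\<delta>\<^sup>2 * sqrt (real n * p)) \<le> \<delta> / 3 \<and>
     (1 + 1 / (\<delta> * (real n * p))) * (exp (2 * (sqrt (2 / \<delta>) * (sqrt (ln (real n) / real n) / p))) + 8 * p) \<le> 1 + \<delta> / 2 \<and>
     sqrt (2 / \<delta>) * sqrt (ln (real n)) * sqrt (sqrt (ln (real n))) \<le> \<delta> / 4 * ln (real n) \<and> 4 / sqrt (ln (real n)) < 1 \<and> 1 \<le> ln (real n)"

text \<open>
  The next two definitions come from the lemma \<open>prob_all_below_tilted_mean\<close> with \<open>t = sqrt (2 (1 - \<delta>) ln n / k) / p\<close>,
  \<open>s = p sqrt n sqrt (sqrt (ln n))\<close> and \<open>c = 4 n p\<^sup>2\<close>.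
\<close>

definition gain :: "nat \<Rightarrow> real \<Rightarrow> real \<Rightarrow> nat \<Rightarrow> real" where
  "gain n p \<delta> k = (if \<delta> * real n \<le> real k \<and> real k \<le> (1 - \<delta>) * real n
     then max 0 ((1 - \<delta>) * (p * sqrt (2 * (1 - \<delta>) * real k * ln (real n))) - p * sqrt (real n) * sqrt (sqrt (ln (real n)))) else 0)"

definition failure_bound :: "nat \<Rightarrow> real \<Rightarrow> real \<Rightarrow> real" where
  "failure_bound n p \<delta> =
     (exp (32 * p * ln (real n) / \<delta>) + 2 / \<delta> * exp (- (\<delta> / 4 * ln (real n)))) / (1 - 4 / sqrt (ln (real n)))\<^sup>2 - 1"

lemma degree_target_bounds:
  assumes "0 \<le> p"
  shows "real k * p - 4 * real n * sqrt (real n * p) / real (n - k) \<le> real (degree_target n p k)"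
    "real (degree_target n p k) \<le> real k * p + 1"
proof -
  define x where "x = real k * p - 4 * real n * sqrt (real n * p) / real (n - k)"
  have m: "degree_target n p k = nat \<lceil>x\<rceil>" by (simp add: degree_target_def x_def)
  show "x \<le> real (degree_target n p k)" unfolding m by (rule real_nat_ceiling_ge)
  have "x \<le> real k * p" using assms by (simp add: x_def)
  moreover have "0 \<le> real k * p" using assms by simp
  moreover have "real (nat \<lceil>x\<rceil>) \<le> max 0 (x + 1)" 
  proof (cases "0 \<le> x")
    case True
    then show ?thesis using real_nat_ceiling_le[of x] by linarith
  next
    case False
    then have "\<lceil>x\<rceil> \<le> 0" by simp
    then show ?thesis by simp
  qed
  ultimately show "real (degree_target n p k) \<le> real k * p + 1" unfolding m by linarith
qed

context
  fixes n :: nat and p \<delta> :: real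
  assumes regime: "greedy_regime n p \<delta>"
begin

abbreviation (input) "L \<equiv> ln (real n)"

lemma regime_facts:
  "0 < \<delta>" "\<delta> \<le> 1 / 12" "0 < p" "p \<le> \<delta> / 3" "p < 1" "4 \<le> real n * p" "1 \<le> \<delta> * (real n * p)"
  "sqrt (2 / \<delta>) * (sqrt (L / real n) / p) \<le> \<delta> / 6" "4 / (\<delta>\<^sup>2 * sqrt (real n * p)) \<le> \<delta> / 3"
  "(1 + 1 / (\<delta> * (real n * p))) * (exp (2 * (sqrt (2 / \<delta>) * (sqrt (L / real n) / p))) + 8 * p) \<le> 1 + \<delta> / 2"
  "sqrt (2 / \<delta>) * sqrt L * sqrt (sqrt L) \<le> \<delta> / 4 * L" "4 / sqrt L < 1" "1 \<le> L" "0 < n" "0 < L"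
proof -
  show "0 < L" using regime by (simp add: greedy_regime_def del: ln_gt_zero_iff)
qed (use regime in \<open>auto simp: greedy_regime_def intro: Nat.gr0I\<close>)

lemma failure_bound_nonneg: "0 \<le> failure_bound n p \<delta>"
proof -
  have "(1 - 4 / sqrt L)\<^sup>2 \<le> 1\<^sup>2" using regime_facts by (intro power_mono) auto
  also have "\<dots> \<le> exp (32 * p * L / \<delta>) + 2 / \<delta> * exp (- (\<delta> / 4 * L))"
  proof -
    have "1 \<le> exp (32 * p * L / \<delta>)" using regime_facts by simp
    moreover have "0 \<le> 2 / \<delta> * exp (- (\<delta> / 4 * L))" using regime_facts by simp
    ultimately show ?thesis unfolding one_power2 by linarith
  qed
  finally have "(1 - 4 / sqrt L)\<^sup>2 \<le> exp (32 * p * L / \<delta>) + 2 / \<delta> * exp (- (\<delta> / 4 * L))" .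
  moreover have "0 < (1 - 4 / sqrt L)\<^sup>2" using regime_facts(12) by (intro zero_less_power) linarith
  ultimately show ?thesis unfolding failure_bound_def by (simp only: le_diff_eq add_0 le_divide_eq_1_pos)
qed

text \<open>The lower bound on \<open>k\<close> keeps the tilt small; the upper bound keeps many
  free vertices and thereby limits the loss in \<open>degree_target\<close>. The factor
  \<open>1 - \<delta>\<close> inside the tilt stays just below the critical value, so that the
  expected number of candidates near the tilted mean still grows like a power of
  \<open>n\<close>.\<close>

lemma middle_step:
  assumes k: "\<delta> * real n \<le> real k" "real k \<le> (1 - \<delta>) * real n"
  defines "m \<equiv> degree_target n p k" and "t \<equiv> sqrt (2 * (1 - \<delta>) * L / real k) / p"
    and "s \<equiv> p * sqrt (real n) * sqrt (sqrt L)"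
  shows "0 \<le> t" "0 < s" "real m * tilted p t / s\<^sup>2 \<le> 4 / sqrt L"
    "(1 - \<delta>) * (p * sqrt (2 * (1 - \<delta>) * real k * L)) - s \<le> real m * tilted p t - s - real m * p"
    "(exp (4 * real n * p\<^sup>2 * (p * (exp t - 1)\<^sup>2)) + exp (t * (real m * tilted p t + s)) / (real (n - k) / 2 * (1 - p + p * exp t) ^ m))
       / (1 - 4 / sqrt L)\<^sup>2 - 1 \<le> failure_bound n p \<delta>"
proof -
  note r = regime_facts
  define T where "T = sqrt (2 / \<delta>) * (sqrt (L / real n) / p)"
  have n: "0 < real n" using r by simp
  have kpos: "0 < real k" using k(1) mult_pos_pos[OF r(1) n] by linarith
  have dnp: "\<delta> * (real n * p) \<le> real k * p" using mult_right_mono[OF k(1), of p] r by (simp add: mult.assoc)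
  have kp1: "1 \<le> real k * p" using dnp r by linarith
  have kn: "real k \<le> real n" 
  proof -
    have "0 \<le> \<delta> * real n" using r n by simp
    then show ?thesis using k(2) unfolding left_diff_distrib by linarith
  qed
  have nk: "\<delta> * real n \<le> real (n - k)" using k(2) kn by (simp add: of_nat_diff left_diff_distrib)
  have dn: "0 < \<delta> * real n" using r n by simp
  have "0 < 2 * (1 - \<delta>) * L / real k" using r kpos by (intro divide_pos_pos mult_pos_pos) linarith+
  then have t0: "0 < t" unfolding t_def using r(3) by (intro divide_pos_pos) (simp_all only: real_sqrt_gt_zero)
  then show "0 \<le> t" by simp
  show s0: "0 < s" using r n by (simp add: s_def)
  have T: "T = sqrt (2 * L / (\<delta> * real n)) / p" using r n by (simp add: T_def real_sqrt_mult real_sqrt_divide)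
  have "2 * (1 - \<delta>) * L / real k \<le> 2 * L / (\<delta> * real n)"
    using r k(1) dn kpos by (intro frac_le) auto
  then have sq: "sqrt (2 * (1 - \<delta>) * L / real k) \<le> sqrt (2 * L / (\<delta> * real n))" by simp
  then have tT: "t \<le> T" unfolding t_def T using r by (intro divide_right_mono) auto
  have T6: "T \<le> \<delta> / 6" using r(8) by (simp add: T_def)
  have t1: "t \<le> 1" "2 * t \<le> \<delta> / 3" using tT T6 r by auto
  have t2: "t\<^sup>2 = 2 * (1 - \<delta>) * L / real k / p\<^sup>2" using r kpos by (simp add: t_def power_divide)
  have et: "exp t \<le> 2" using exp_minus_one_le[of t] t0 t1 r by simp
  have m1: "real m \<le> real k * p + 1" unfolding m_def using r by (intro degree_target_bounds) auto
  have m2: "real k * p * (1 - \<delta> / 3) \<le> real m"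
  proof -
    define q where "q = sqrt (real n * p)"
    have q: "0 < q" "q * q = real n * p" using r n by (simp_all add: q_def)
    have "4 * real n * q / real (n - k) \<le> 4 * real n * q / (\<delta> * real n)"
      using nk dn n q by (intro divide_left_mono) auto
    also have "\<dots> = 4 / (\<delta>\<^sup>2 * q) * (\<delta> * (q * q))"
      using n q(1) r(1) by (simp add: power2_eq_square)
    also have "\<dots> \<le> \<delta> / 3 * (\<delta> * (q * q))" using r(9) r q unfolding q_def[symmetric] by (intro mult_right_mono) auto
    also have "\<dots> \<le> \<delta> / 3 * (real k * p)" unfolding q(2) using dnp r by (intro mult_left_mono) auto
    finally have 1: "4 * real n * q / real (n - k) \<le> \<delta> / 3 * (real k * p)" .
    have 2: "real k * p - 4 * real n * q / real (n - k) \<le> real m"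
      using degree_target_bounds(1)[of p k n] r(3) unfolding m_def q_def[symmetric] by simp
    have "real k * p * (1 - \<delta> / 3) = real k * p - \<delta> / 3 * (real k * p)" by (simp add: algebra_simps)
    then show ?thesis using order_trans[OF diff_left_mono[OF 1] 2] by (simp only:)
  qed
  have tl: "tilted p t \<le> p * exp t" using tilted_le r t0 by auto
  have mq: "real m * tilted p t \<le> 4 * real n * p\<^sup>2"
  proof -
    have "tilted p t \<le> p * 2" using order_trans[OF tl mult_left_mono[OF et]] r(3) by simp
    moreover have "real m \<le> 2 * (real k * p)" using m1 kp1 by linarith
    moreover have "0 \<le> tilted p t" using tilted_bounds(1)[OF r(3,5), of t] t0 by simp
    ultimately have "real m * tilted p t \<le> (2 * (real k * p)) * (p * 2)"
      using kp1 by (intro mult_mono) auto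
    also have "\<dots> = 4 * real k * p\<^sup>2" by (simp add: power2_eq_square)
    also have "\<dots> \<le> 4 * real n * p\<^sup>2" using kn by (intro mult_right_mono) auto
    finally show ?thesis .
  qed
  have s2: "s\<^sup>2 = p\<^sup>2 * real n * sqrt L" using r n by (simp add: s_def power_mult_distrib)
  have "real m * tilted p t / s\<^sup>2 \<le> 4 * real n * p\<^sup>2 / s\<^sup>2" using mq by (intro divide_right_mono) auto
  also have "\<dots> = 4 / sqrt L" unfolding s2 using r n by simp
  finally show "real m * tilted p t / s\<^sup>2 \<le> 4 / sqrt L" .
  have kt: "real k * p * (p * t) = p * sqrt (2 * (1 - \<delta>) * real k * L)"
  proof -
    have "real k * (sqrt (2 * (1 - \<delta>) * L / real k)) = sqrt (2 * (1 - \<delta>) * real k * L)"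
    proof -
      have "real k = sqrt (real k * real k)" by simp
      then have "real k * (sqrt (2 * (1 - \<delta>) * L / real k)) = sqrt (real k * real k * (2 * (1 - \<delta>) * L / real k))"
        by (metis real_sqrt_mult)
      also have "real k * real k * (2 * (1 - \<delta>) * L / real k) = 2 * (1 - \<delta>) * real k * L" using kpos by simp
      finally show ?thesis .
    qed
    then show ?thesis using r by (simp add: t_def)
  qed
  show "(1 - \<delta>) * (p * sqrt (2 * (1 - \<delta>) * real k * L)) - s \<le> real m * tilted p t - s - real m * p"
  proof -
    \<comment> \<open>The factor \<open>1 - \<delta>\<close> pays for three losses of at most
      \<open>\<delta> / 3\<close>: in the degree target, in \<open>1 - p\<close> and in
      \<open>1 - 2 * t\<close>.\<close>
    have "1 - \<delta> \<le> (1 - \<delta> / 3) * ((1 - \<delta> / 3) * (1 - \<delta> / 3))"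
    proof -
      have "(1 - \<delta> / 3) * ((1 - \<delta> / 3) * (1 - \<delta> / 3)) = 1 - \<delta> + \<delta> * \<delta> / 3 * (1 - \<delta> / 9)" by (simp add: field_simps)
      moreover have "0 \<le> \<delta> * \<delta> / 3 * (1 - \<delta> / 9)" using r by simp
      ultimately show ?thesis by linarith
    qed
    also have "\<dots> \<le> (1 - \<delta> / 3) * ((1 - p) * (1 - 2 * t))"
      using r t1 by (intro mult_left_mono mult_mono) auto
    finally have "(real k * p * (p * t)) * (1 - \<delta>) \<le> (real k * p * (p * t)) * ((1 - \<delta> / 3) * ((1 - p) * (1 - 2 * t)))"
      using r t0 by (intro mult_left_mono) auto
    also have "\<dots> = (real k * p * (1 - \<delta> / 3)) * (p * t * ((1 - p) * (1 - 2 * t)))" by simp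
    also have "\<dots> \<le> real m * (p * t * ((1 - p) * (1 - 2 * t)))"
      using m2 r t0 t1 by (intro mult_right_mono mult_nonneg_nonneg) auto
    also have "\<dots> \<le> real m * (tilted p t - p)"
      using tilted_gain[of p t] r t0 t1 by (intro mult_left_mono) auto
    finally show ?thesis unfolding kt by (simp add: algebra_simps)
  qed
  define z where "z = 1 - p + p * exp t"
  have z: "1 \<le> z" unfolding z_def using tilted_bounds(3)[of p t] r t0 by auto
  \<comment> \<open>The entropy costs \<open>(1 - \<delta> / 2) * ln n\<close> and the window
    \<open>s\<close> another \<open>\<delta> / 4 * ln n\<close>; the remaining
    \<open>\<delta> / 4 * ln n\<close> makes the failure bound small.\<close>
  have expo: "t * (real m * tilted p t + s) \<le> (1 - \<delta> / 4) * L + real m * ln z"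
  proof -
    define e where "e = exp (2 * T) + 8 * p"
    have e0: "0 \<le> e" using r by (simp add: e_def)
    have "real m * (t * tilted p t - ln z) \<le> real m * (p * t\<^sup>2 / 2 * (exp (2 * t) + 8 * p))"
      unfolding z_def using r t0 t1 by (intro mult_left_mono tilted_rate) auto
    also have "\<dots> \<le> (real k * p + 1) * (p * t\<^sup>2 / 2 * e)"
      unfolding e_def using m1 r t0 tT by (intro mult_mono mult_left_mono) auto
    also have "\<dots> = (1 - \<delta>) * L * ((1 + 1 / (real k * p)) * e)"
      unfolding t2 using r kpos by (simp add: field_simps power2_eq_square)
    also have "\<dots> \<le> (1 - \<delta>) * L * ((1 + 1 / (\<delta> * (real n * p))) * e)"
      using r e0 dnp kp1 by (intro mult_left_mono mult_right_mono add_left_mono divide_left_mono) auto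
    also have "\<dots> \<le> (1 - \<delta>) * L * (1 + \<delta> / 2)"
      unfolding e_def T_def using r(10) r by (intro mult_left_mono) auto
    also have "\<dots> = L * (1 - \<delta> / 2 - \<delta> * \<delta> / 2)" by (simp add: algebra_simps)
    also have "\<dots> \<le> L * (1 - \<delta> / 2)" using r by (intro mult_left_mono) auto
    finally have 1: "real m * (t * tilted p t - ln z) \<le> L * (1 - \<delta> / 2)" .
    have "t * s \<le> T * s" using tT s0 by (intro mult_right_mono) auto
    also have "T * s = sqrt (2 / \<delta>) * sqrt L * sqrt (sqrt L)"
      using r n by (simp add: T_def s_def real_sqrt_divide)
    also have "\<dots> \<le> \<delta> / 4 * L" by (rule r(11))
    finally show ?thesis using 1 by (simp add: algebra_simps)
  qed
  show "(exp (4 * real n * p\<^sup>2 * (p * (exp t - 1)\<^sup>2)) + exp (t * (real m * tilted p t + s)) / (real (n - k) / 2 * (1 - p + p * exp t) ^ m))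
       / (1 - 4 / sqrt L)\<^sup>2 - 1 \<le> failure_bound n p \<delta>"
    unfolding failure_bound_def
  proof (intro diff_right_mono divide_right_mono add_mono)
    have "(exp t - 1)\<^sup>2 \<le> (2 * T)\<^sup>2" using exp_minus_one_le[of t] t0 t1 tT by (intro power_mono) auto
    also have "\<dots> = 8 * L / (\<delta> * real n * p\<^sup>2)"
      unfolding T using r n by (simp add: power_mult_distrib power_divide)
    finally have "4 * real n * p\<^sup>2 * (p * (exp t - 1)\<^sup>2) \<le> 4 * real n * p\<^sup>2 * (p * (8 * L / (\<delta> * real n * p\<^sup>2)))"
      using r by (intro mult_left_mono) auto
    also have "\<dots> = 32 * p * L / \<delta>" using r n by simp
    finally show "exp (4 * real n * p\<^sup>2 * (p * (exp t - 1)\<^sup>2)) \<le> exp (32 * p * L / \<delta>)" by simp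
    have zm: "0 < z ^ m" using z by simp
    have "exp (t * (real m * tilted p t + s)) \<le> exp (L + - (\<delta> / 4 * L) + real m * ln z)"
      using expo by (simp add: algebra_simps)
    also have "\<dots> = real n * exp (- (\<delta> / 4 * L)) * z ^ m"
      using n z unfolding exp_add by (simp add: exp_of_nat_mult)
    finally have "exp (t * (real m * tilted p t + s)) / (real (n - k) / 2 * z ^ m) \<le> real n * exp (- (\<delta> / 4 * L)) * z ^ m / (\<delta> * real n / 2 * z ^ m)"
      using nk dn zm by (intro frac_le) auto
    also have "\<dots> = 2 / \<delta> * exp (- (\<delta> / 4 * L))" using n zm z r(1) by simp
    finally show "exp (t * (real m * tilted p t + s)) / (real (n - k) / 2 * (1 - p + p * exp t) ^ m) \<le> 2 / \<delta> * exp (- (\<delta> / 4 * L))"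
      unfolding z_def .
  qed auto
qed

lemma gain_bounds: "0 \<le> gain n p \<delta> k" "k < n \<Longrightarrow> gain n p \<delta> k \<le> 2 * (p * sqrt (real n) * sqrt L)"
proof -
  note r = regime_facts
  show "0 \<le> gain n p \<delta> k" by (simp add: gain_def)
  assume k: "k < n"
  have "(1 - \<delta>) * (p * sqrt (2 * (1 - \<delta>) * real k * L)) \<le> 1 * (p * sqrt (2 * 1 * real n * L))"
    using r k by (intro mult_mono mult_left_mono real_sqrt_le_mono) auto
  also have "\<dots> = sqrt 2 * (p * sqrt (real n) * sqrt L)" by (simp add: real_sqrt_mult)
  also have "\<dots> \<le> 2 * (p * sqrt (real n) * sqrt L)" using r by (intro mult_right_mono) (auto intro: real_le_lsqrt)
  finally have "(1 - \<delta>) * (p * sqrt (2 * (1 - \<delta>) * real k * L)) \<le> 2 * (p * sqrt (real n) * sqrt L)" .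
  moreover have "0 \<le> p * sqrt (real n) * sqrt (sqrt L)" "0 \<le> p * sqrt (real n) * sqrt L" using r by simp_all
  ultimately show "gain n p \<delta> k \<le> 2 * (p * sqrt (real n) * sqrt L)" by (simp add: gain_def)
qed

text \<open>Giving up the steps near both ends removes about \<open>2 \<delta> n\<close> terms of
  size at most \<open>sqrt n\<close>, at a cost of \<open>3 \<delta>\<close>. The powers of
  \<open>1 - \<delta>\<close> in the gain cost \<open>2 \<delta>\<close>, the windows add up to
  \<open>scale_D n p / sqrt (sqrt L)\<close>, and \<open>5 / n\<close> absorbs rounding.\<close>

lemma sum_gain_ge:
  "(beta_c - 5 * \<delta> - 5 / real n - 1 / sqrt (sqrt L)) * scale_D n p \<le> (\<Sum>k<n. gain n p \<delta> k)"
proof -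
  note r = regime_facts
  have n: "0 < real n" using r by simp
  let ?M = "{k. k < n \<and> \<delta> * real n \<le> real k \<and> real k \<le> (1 - \<delta>) * real n}"
  define w where "w = real n * sqrt (real n)"
  have w: "0 < w" using n by (simp add: w_def)
  have out: "real (card ({..<n} - ?M)) \<le> 2 * (\<delta> * real n + 1)"
  proof -
    define c where "c = nat \<lceil>\<delta> * real n\<rceil>"
    have c: "\<delta> * real n \<le> real c" "real c \<le> \<delta> * real n + 1"
      using r n real_nat_ceiling_le[of "\<delta> * real n"] by (simp_all add: c_def real_nat_ceiling_ge)
    have "{..<n} - ?M \<subseteq> {..<c} \<union> {n - c..<n}"
    proof
      fix k assume k: "k \<in> {..<n} - ?M"
      show "k \<in> {..<c} \<union> {n - c..<n}"
      proof (cases "\<delta> * real n \<le> real k")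
        case True
        then have "(1 - \<delta>) * real n < real k" using k by auto
        then have "real n < real (k + c)" using c(1) by (simp add: left_diff_distrib)
        then show ?thesis using k by auto
      next
        case False
        then have "real k < real c" using c(1) by linarith
        then show ?thesis by simp
      qed
    qed
    then have "card ({..<n} - ?M) \<le> card ({..<c} \<union> {n - c..<n})" by (intro card_mono) auto
    also have "\<dots> \<le> card {..<c} + card {n - c..<n}" by (rule card_Un_le)
    also have "\<dots> \<le> c + c" by simp
    finally have "real (card ({..<n} - ?M)) \<le> real (c + c)" by (simp only: of_nat_le_iff)
    then show ?thesis using c(2) unfolding of_nat_add distrib_left by linarith
  qed
  have "2 / 3 * w - sqrt (real n) \<le> (\<Sum>k<n. sqrt (real k))"
    using sqrt_sum_lower[of n] by (simp add: w_def)
  also have "\<dots> = (\<Sum>k\<in>?M. sqrt (real k)) + (\<Sum>k\<in>{..<n} - ?M. sqrt (real k))"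
    by (subst sum.subset_diff[of ?M "{..<n}"]) auto
  also have "(\<Sum>k\<in>{..<n} - ?M. sqrt (real k)) \<le> (\<Sum>k\<in>{..<n} - ?M. sqrt (real n))"
    by (intro sum_mono) auto
  also have "\<dots> = real (card ({..<n} - ?M)) * sqrt (real n)" by simp
  also have "\<dots> \<le> 2 * (\<delta> * real n + 1) * sqrt (real n)" using out by (intro mult_right_mono) auto
  finally have sumM: "(2 / 3 - 2 * \<delta> - 3 / real n) * w \<le> (\<Sum>k\<in>?M. sqrt (real k))"
    using n by (simp add: w_def algebra_simps)
  define c where "c = (1 - \<delta>) * sqrt (1 - \<delta>) * sqrt 2 * (p * sqrt L)"
  have c0: "0 \<le> c" using r by (simp add: c_def)
  have "c * (\<Sum>k\<in>?M. sqrt (real k)) - real n * (p * sqrt (real n) * sqrt (sqrt L))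
     \<le> (\<Sum>k\<in>?M. c * sqrt (real k)) - real (card ?M) * (p * sqrt (real n) * sqrt (sqrt L))"
  proof -
    have "card ?M \<le> card {..<n}" by (intro card_mono) auto
    then have "real (card ?M) * (p * sqrt (real n) * sqrt (sqrt L)) \<le> real n * (p * sqrt (real n) * sqrt (sqrt L))"
      using r by (intro mult_right_mono) auto
    then show ?thesis by (simp add: sum_distrib_left)
  qed
  also have "\<dots> = (\<Sum>k\<in>?M. c * sqrt (real k) - p * sqrt (real n) * sqrt (sqrt L))" by (simp add: sum_subtractf)
  also have "\<dots> \<le> (\<Sum>k\<in>?M. gain n p \<delta> k)"
  proof (rule sum_mono)
    fix k assume "k \<in> ?M"
    moreover have "c * sqrt (real k) = (1 - \<delta>) * (p * sqrt (2 * (1 - \<delta>) * real k * L))"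
      by (simp only: c_def real_sqrt_mult mult_ac)
    ultimately show "c * sqrt (real k) - p * sqrt (real n) * sqrt (sqrt L) \<le> gain n p \<delta> k" by (simp add: gain_def)
  qed
  also have "\<dots> \<le> (\<Sum>k<n. gain n p \<delta> k)" using gain_bounds(1) by (intro sum_mono2) auto
  finally have 1: "c * (\<Sum>k\<in>?M. sqrt (real k)) - real n * (p * sqrt (real n) * sqrt (sqrt L)) \<le> (\<Sum>k<n. gain n p \<delta> k)" .
  have "c * ((2 / 3 - 2 * \<delta> - 3 / real n) * w) \<le> c * (\<Sum>k\<in>?M. sqrt (real k))" using sumM c0 by (intro mult_left_mono)
  moreover have "(beta_c - 5 * \<delta> - 5 / real n) * (p * sqrt L * w) \<le> c * ((2 / 3 - 2 * \<delta> - 3 / real n) * w)"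
  proof -
    define x where "x = sqrt 2 * (2 / 3 - 2 * \<delta> - 3 / real n)"
    have s2: "1 \<le> sqrt 2" by simp
    \<comment> \<open>Multiplying by \<open>sqrt 2 <= 3 / 2\<close> turns the losses
      \<open>2 \<delta>\<close> and \<open>3 / n\<close> into at most \<open>3 \<delta>\<close> and
      \<open>5 / n\<close>.\<close>
    have s3: "sqrt 2 \<le> (3 / 2::real)" by (rule real_le_lsqrt) (simp_all add: power2_eq_square)
    define u v where "u = sqrt 2 * (2 * \<delta>)" and "v = sqrt 2 * (3 / real n)"
    have "u \<le> 3 / 2 * (2 * \<delta>)" "v \<le> 3 / 2 * (3 / real n)"
      unfolding u_def v_def using s3 r(1) n by (intro mult_right_mono; simp)+
    moreover have "3 / 2 * (3 / real n) \<le> 5 / real n" using n by (simp add: field_simps)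
    moreover have "x = beta_c - u - v" by (simp add: x_def u_def v_def beta_c_eq' right_diff_distrib)
    ultimately have x1: "beta_c - 3 * \<delta> - 5 / real n \<le> x" by simp
    have x2: "x \<le> 1"
    proof -
      have "0 \<le> 3 / real n" by simp
      then have "2 / 3 - 2 * \<delta> - 3 / real n \<le> 2 / 3" using r(1) by linarith
      then have "x \<le> sqrt 2 * (2 / 3)" unfolding x_def by (rule mult_left_mono) simp
      then show ?thesis using s3 by simp
    qed
    have d: "1 - \<delta> \<le> sqrt (1 - \<delta>)" using r by (intro real_le_rsqrt) (simp add: power2_eq_square mult_le_cancel_left1)
    have "beta_c - 5 * \<delta> - 5 / real n \<le> (1 - \<delta>) * sqrt (1 - \<delta>) * x"
    proof (cases "0 \<le> x")
      case True
      have "x - 2 * \<delta> \<le> x * ((1 - \<delta>) * (1 - \<delta>))"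
      proof -
        have "x * ((1 - \<delta>) * (1 - \<delta>)) = x - 2 * \<delta> * x + x * (\<delta> * \<delta>)" by (simp add: algebra_simps)
        moreover have "2 * \<delta> * x \<le> 2 * \<delta> * 1" using x2 r by (intro mult_left_mono) auto
        moreover have "0 \<le> x * (\<delta> * \<delta>)" using True by simp
        ultimately show ?thesis by linarith
      qed
      also have "\<dots> \<le> x * ((1 - \<delta>) * sqrt (1 - \<delta>))" using True d r by (intro mult_left_mono) auto
      finally show ?thesis using x1 r by (simp add: mult.commute)
    next
      case False
      have "(1 - \<delta>) * sqrt (1 - \<delta>) * (- x) \<le> 1 * (- x)"
        using r False by (intro mult_right_mono mult_le_one) auto
      then show ?thesis using x1 r by simp
    qed
    then have "(beta_c - 5 * \<delta> - 5 / real n) * (p * sqrt L * w) \<le> (1 - \<delta>) * sqrt (1 - \<delta>) * x * (p * sqrt L * w)"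
      using r w by (intro mult_right_mono) auto
    also have "\<dots> = c * ((2 / 3 - 2 * \<delta> - 3 / real n) * w)" by (simp add: c_def x_def)
    finally show ?thesis .
  qed
  moreover have "p * sqrt L * w = scale_D n p" using r by (simp add: scale_D_eq w_def)
  moreover have "real n * (p * sqrt (real n) * sqrt (sqrt L)) = 1 / sqrt (sqrt L) * scale_D n p"
  proof -
    have "sqrt (sqrt L) * sqrt (sqrt L) = sqrt L" using r by simp
    moreover have "0 < sqrt (sqrt L)" using r by simp
    ultimately have "sqrt (sqrt L) = sqrt L / sqrt (sqrt L)" by (simp add: eq_divide_eq)
    then have "real n * (p * sqrt (real n) * sqrt (sqrt L)) = real n * (p * sqrt (real n) * (sqrt L / sqrt (sqrt L)))" by simp
    then show ?thesis using r by (simp add: scale_D_eq mult_ac)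
  qed
  ultimately show ?thesis using 1 by (simp add: left_diff_distrib)
qed

text \<open>The losses in \<open>degree_target\<close> are proportional to
  \<open>1 / (n - k)\<close> and add up to a harmonic sum of order ln n. Relative to
  \<open>scale_D n p\<close> this is of order \<open>sqrt (p * L)\<close>, which vanishes under the
  assumption of part (i).\<close>

lemma sum_degree_target_ge:
  "real (n choose 2) * p\<^sup>2 - 8 * sqrt (p * L) * scale_D n p \<le> (\<Sum>k<n. real (degree_target n p k) * p)"
proof -
  note r = regime_facts
  have n: "0 < real n" using r by simp
  define b where "b = 4 * real n * sqrt (real n * p)"
  have b: "0 \<le> b" using r by (simp add: b_def)
  have "(\<Sum>k<n. 1 / real (n - k)) = harm n"
    unfolding harm_def by (rule sum.reindex_bij_witness[of _ "\<lambda>j. n - j" "\<lambda>k. n - k"]) (auto simp: inverse_eq_divide)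
  also have "\<dots> \<le> 2 * L" using harm_le_ln[of n] r by simp
  finally have harm: "(\<Sum>k<n. 1 / real (n - k)) \<le> 2 * L" .
  have ch: "(\<Sum>k<n. real k) = real (n choose 2)"
    by (simp add: Sum_Ico_nat choose_two lessThan_atLeast0 flip: of_nat_sum)
  have "b * p * (\<Sum>k<n. 1 / real (n - k)) \<le> b * p * (2 * L)" using b r harm by (intro mult_left_mono) auto
  also have "\<dots> = 8 * sqrt (p * L) * scale_D n p"
  proof -
    have "sqrt L * sqrt L = L" using r by simp
    then have "8 * sqrt (p * L) * scale_D n p = 8 * (sqrt p * p * (real n * sqrt (real n))) * (sqrt L * sqrt L)"
      using r by (simp add: scale_D_eq real_sqrt_mult del: real_sqrt_mult_self)
    also have "\<dots> = b * p * (2 * L)" using \<open>sqrt L * sqrt L = L\<close> by (simp add: b_def real_sqrt_mult)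
    finally show ?thesis ..
  qed
  finally have 1: "b * p * (\<Sum>k<n. 1 / real (n - k)) \<le> 8 * sqrt (p * L) * scale_D n p" .
  have "real (n choose 2) * p\<^sup>2 - b * p * (\<Sum>k<n. 1 / real (n - k)) = (\<Sum>k<n. (real k * p - b / real (n - k)) * p)"
  proof -
    have "(real k * p - b / real (n - k)) * p = real k * p\<^sup>2 - b * p * (1 / real (n - k))" for k
      by (simp add: power2_eq_square left_diff_distrib)
    then show ?thesis unfolding ch[symmetric] by (simp only: sum_subtractf sum_distrib_left sum_distrib_right)
  qed
  also have "\<dots> \<le> (\<Sum>k<n. real (degree_target n p k) * p)"
    unfolding b_def using r by (intro sum_mono mult_right_mono degree_target_bounds(1)) auto
  finally show ?thesis using 1 by linarith
qed

text \<open>The step targets \<open>\<tau> k\<close> add up to at least the required overlap plus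
  \<open>y * scale_D n p\<close>. Failure therefore forces the one-sided losses to add up to
  \<open>y * scale_D n p\<close>, and for Markov's inequality their expectations suffice, whatever
  the dependence between the steps.\<close>

lemma prob_greedy_fails:
  assumes "H \<in> simple_graphs n" "cut_lower p n H" "codegree_upper p n H" "0 < y"
    and "\<beta> + y \<le> beta_c - 5 * \<delta> - 5 / real n - 1 / sqrt (sqrt L) - 8 * sqrt (p * L)"
  shows "measure_pmf.prob (partial_run (greedy_rule n) H p n)
      {(G, xs). centered_overlap n p G H (perm_of_list xs) < \<beta> * scale_D n p}
    \<le> (3 / 2 / sqrt L + 2 * failure_bound n p \<delta>) / y"
proof -
  note r = regime_facts
  have n: "0 < real n" using r by simp
  let ?J = "partial_run (greedy_rule n) H p n"
  let ?m = "degree_target n p"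
  define \<tau> where "\<tau> k = real (?m k) * p + gain n p \<delta> k" for k
  let ?w = "\<lambda>xs v C. ennreal (max 0 (\<tau> (length xs) - real (card (C \<inter> back_nbrs H xs v))))"
  define D where "D = scale_D n p"
  have D: "D = p * (real n * sqrt (real n)) * sqrt L" "0 < D"
  proof -
    show "D = p * (real n * sqrt (real n)) * sqrt L" using r by (simp add: D_def scale_D_eq)
    moreover have "0 < L" using r(13) by linarith
    ultimately show "0 < D" using n r(3) by simp
  qed
  \<comment> \<open>The order of the standard deviation of a score. The shortfalls then cost at most
    \<open>3 / 2 * a\<close> per step and \<open>3 / 2 * D / sqrt L\<close> in total.\<close>
  define a where "a = p * sqrt (real n)"
  have a: "0 < a" using r n by (simp add: a_def)
  define K where "K k = gain n p \<delta> k * failure_bound n p \<delta> + (real (?m k) * p / a + a) / 2" for k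
  have K0: "0 \<le> K k" for k using gain_bounds(1) failure_bound_nonneg a r by (simp add: K_def)
  have "(\<integral>\<^sup>+(G, xs). (\<Sum>j<n. ?w (take j xs) (xs ! j) (new_nbrs G j)) \<partial>?J) \<le> (\<Sum>j<n. ennreal (K j))"
  proof (rule nn_integral_partial_run_sum[OF valid_greedy_rule assms(1) _ order_refl])
    fix k xs G assume *: "k < n" "xs \<in> partial_inj n k" "G \<in> simple_graphs k"
    then have len: "length xs = k" by (simp add: partial_inj_def)
    show "(\<integral>\<^sup>+C. (\<integral>\<^sup>+v. ?w xs v C \<partial>greedy_rule n (Suc k) (G \<union> new_edges k C) H xs) \<partial>random_subset {1..k} p) \<le> ennreal (K k)"
      unfolding len \<tau>_def K_def
    proof (rule greedy_step_loss[OF r(3,5) assms(1-3) *(2,1,3) a gain_bounds(1)])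
      let ?t = "sqrt (2 * (1 - \<delta>) * L / real k) / p" and ?s = "p * sqrt (real n) * sqrt (sqrt L)"
      show "gain n p \<delta> k = 0 \<or> 0 \<le> ?t \<and> 0 < ?s \<and> real (?m k) * tilted p ?t / ?s\<^sup>2 \<le> 4 / sqrt L \<and> 4 / sqrt L < 1
         \<and> gain n p \<delta> k \<le> real (?m k) * tilted p ?t - ?s - real (?m k) * p
         \<and> (exp (4 * real n * p\<^sup>2 * (p * (exp ?t - 1)\<^sup>2)) + exp (?t * (real (?m k) * tilted p ?t + ?s)) / (real (n - k) / 2 * (1 - p + p * exp ?t) ^ ?m k)) / (1 - 4 / sqrt L)\<^sup>2 - 1 \<le> failure_bound n p \<delta>"
      proof (cases "gain n p \<delta> k = 0")
        case False
        then have k: "\<delta> * real n \<le> real k" "real k \<le> (1 - \<delta>) * real n"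
          and g: "gain n p \<delta> k = (1 - \<delta>) * (p * sqrt (2 * (1 - \<delta>) * real k * L)) - ?s"
          by (auto simp: gain_def max_def split: if_splits)
        show ?thesis unfolding g by (intro disjI2 conjI middle_step[OF k] r(12))
      qed simp
    qed
  qed
  also have "\<dots> = ennreal (\<Sum>j<n. K j)" using K0 by (intro sum_ennreal) auto
  also have "(\<Sum>j<n. K j) \<le> (3 / 2 / sqrt L + 2 * failure_bound n p \<delta>) * D"
  proof -
    have "K k \<le> 2 * (p * sqrt (real n) * sqrt L) * failure_bound n p \<delta> + 3 / 2 * a" if "k < n" for k
    proof -
      have "gain n p \<delta> k * failure_bound n p \<delta> \<le> 2 * (p * sqrt (real n) * sqrt L) * failure_bound n p \<delta>"
        using gain_bounds(2)[OF that] failure_bound_nonneg by (rule mult_right_mono)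
      moreover have "real (?m k) * p / a \<le> 2 * a"
      proof -
        have "real k * p \<le> real n * p" using that r by (intro mult_right_mono) auto
        then have "real (?m k) \<le> 2 * (real n * p)" using degree_target_bounds(2)[of p n k] r by linarith
        then have "real (?m k) * p \<le> 2 * (real n * p) * p" using r by (intro mult_right_mono) auto
        also have "\<dots> = 2 * a * a" by (simp add: a_def)
        finally show ?thesis using a by (simp add: divide_le_eq)
      qed
      then have "(real (?m k) * p / a + a) / 2 \<le> (2 * a + a) / 2" by (intro divide_right_mono add_right_mono) simp_all
      then have "(real (?m k) * p / a + a) / 2 \<le> 3 / 2 * a" by (simp only: mult_2) simp
      ultimately show ?thesis unfolding K_def by (intro add_mono)
    qed
    then have "(\<Sum>j<n. K j) \<le> (\<Sum>j<n. 2 * (p * sqrt (real n) * sqrt L) * failure_bound n p \<delta> + 3 / 2 * a)"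
      by (intro sum_mono) auto
    also have "\<dots> = 2 * failure_bound n p \<delta> * D + 3 / 2 * (a * real n)" by (simp add: D algebra_simps)
    also have "a * real n = D / sqrt L" using r by (simp add: a_def D)
    finally show ?thesis by (simp add: algebra_simps)
  qed
  finally have loss: "(\<integral>\<^sup>+(G, xs). (\<Sum>j<n. ?w (take j xs) (xs ! j) (new_nbrs G j)) \<partial>?J)
    \<le> ennreal ((3 / 2 / sqrt L + 2 * failure_bound n p \<delta>) * D)" by (simp add: ennreal_leI)
  show ?thesis
  proof (rule prob_le_nn_integral)
    have "(\<integral>\<^sup>+(G, xs). ennreal (1 / (y * D)) * (\<Sum>j<n. ?w (take j xs) (xs ! j) (new_nbrs G j)) \<partial>?J)
       = ennreal (1 / (y * D)) * (\<integral>\<^sup>+(G, xs). (\<Sum>j<n. ?w (take j xs) (xs ! j) (new_nbrs G j)) \<partial>?J)"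
      by (simp add: case_prod_unfold nn_integral_cmult)
    also have "\<dots> \<le> ennreal (1 / (y * D)) * ennreal ((3 / 2 / sqrt L + 2 * failure_bound n p \<delta>) * D)"
      by (intro mult_left_mono loss) simp
    also have "\<dots> = ennreal ((3 / 2 / sqrt L + 2 * failure_bound n p \<delta>) / y)"
      using D assms(4) failure_bound_nonneg r by (subst ennreal_mult[symmetric]) auto
    finally show "(\<integral>\<^sup>+(G, xs). ennreal (1 / (y * D)) * (\<Sum>j<n. ?w (take j xs) (xs ! j) (new_nbrs G j)) \<partial>?J)
       \<le> ennreal ((3 / 2 / sqrt L + 2 * failure_bound n p \<delta>) / y)" .
    show "0 \<le> (3 / 2 / sqrt L + 2 * failure_bound n p \<delta>) / y"
      using failure_bound_nonneg r assms(4) by simp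
    fix z assume z: "z \<in> set_pmf ?J" "z \<in> {(G, xs). centered_overlap n p G H (perm_of_list xs) < \<beta> * scale_D n p}"
    obtain G xs where Gxs: "z = (G, xs)" by (cases z)
    have len: "length xs = n"
      using z set_partial_run[OF valid_greedy_rule order_refl assms(1), of p] unfolding Gxs by (auto simp: partial_inj_def)
    let ?l = "\<lambda>j. max 0 (\<tau> j - real (score G H (take j xs) (xs ! j)))"
    have "(\<Sum>j<n. ?w (take j xs) (xs ! j) (new_nbrs G j)) = (\<Sum>j<n. ennreal (?l j))"
      using len by (intro sum.cong) (auto simp: score_def min_def)
    also have "\<dots> = ennreal (\<Sum>j<n. ?l j)" by (intro sum_ennreal) auto
    finally have sum_w: "(\<Sum>j<n. ?w (take j xs) (xs ! j) (new_nbrs G j)) = ennreal (\<Sum>j<n. ?l j)" .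
    have "(\<Sum>j<n. \<tau> j) - real (overlap n G H (perm_of_list xs)) = (\<Sum>j<n. \<tau> j - real (score G H (take j xs) (xs ! j)))"
      unfolding overlap_eq_sum_score[OF len] by (simp add: sum_subtractf)
    also have "\<dots> \<le> (\<Sum>j<n. ?l j)" by (intro sum_mono) auto
    finally have 1: "(\<Sum>j<n. \<tau> j) - real (overlap n G H (perm_of_list xs)) \<le> (\<Sum>j<n. ?l j)" .
    have "(\<Sum>j<n. \<tau> j) = (\<Sum>j<n. real (?m j) * p) + (\<Sum>j<n. gain n p \<delta> j)" by (simp add: \<tau>_def sum.distrib)
    then have 2: "real (n choose 2) * p\<^sup>2 + (beta_c - 5 * \<delta> - 5 / real n - 1 / sqrt (sqrt L) - 8 * sqrt (p * L)) * D \<le> (\<Sum>j<n. \<tau> j)"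
      using sum_gain_ge sum_degree_target_ge unfolding D_def by (simp add: left_diff_distrib)
    have "(\<beta> + y) * D \<le> (beta_c - 5 * \<delta> - 5 / real n - 1 / sqrt (sqrt L) - 8 * sqrt (p * L)) * D"
      using assms(5) D by (intro mult_right_mono) auto
    moreover have "real (overlap n G H (perm_of_list xs)) < real (n choose 2) * p\<^sup>2 + \<beta> * D"
      using z(2) unfolding Gxs by (simp add: centered_overlap_def D_def)
    ultimately have "y * D \<le> (\<Sum>j<n. ?l j)" using 1 2 by (simp add: distrib_right)
    then have "1 \<le> 1 / (y * D) * (\<Sum>j<n. ?l j)" using D assms(4) by (simp add: le_divide_eq)
    then have "1 \<le> ennreal (1 / (y * D) * (\<Sum>j<n. ?l j))" by simp
    also have "\<dots> = ennreal (1 / (y * D)) * ennreal (\<Sum>j<n. ?l j)"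
      using D assms(4) by (intro ennreal_mult) (auto intro!: sum_nonneg)
    finally show "1 \<le> (case z of (G, xs) \<Rightarrow> ennreal (1 / (y * D)) * (\<Sum>j<n. ?w (take j xs) (xs ! j) (new_nbrs G j)))"
      unfolding Gxs case_prod_conv sum_w .
  qed
qed

end


section \<open>Success below the threshold\<close>

lemma perm_of_list_permutes:
  assumes "xs \<in> partial_inj n n"
  shows "perm_of_list xs permutes {1..n}"
proof (rule bij_imp_permutes)
  have xs: "length xs = n" "distinct xs" "set xs \<subseteq> {1..n}" using assms by (auto simp: partial_inj_def)
  show "bij_betw (perm_of_list xs) {1..n} {1..n}"
    unfolding bij_betw_def
  proof
    show inj: "inj_on (perm_of_list xs) {1..n}"
      using xs by (auto simp: inj_on_def perm_of_list_def nth_eq_iff_index_eq)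
    have "perm_of_list xs i \<in> {1..n}" if "i \<in> {1..n}" for i
    proof -
      have "xs ! (i - 1) \<in> set xs" using that xs by (intro nth_mem) auto
      then show ?thesis using that xs by (auto simp: perm_of_list_def)
    qed
    then have "perm_of_list xs ` {1..n} \<subseteq> {1..n}" by blast
    then show "perm_of_list xs ` {1..n} = {1..n}"
      using card_image[OF inj] by (intro card_subset_eq) simp_all
  qed
  show "perm_of_list xs x = x" if "x \<notin> {1..n}" for x using that xs by (auto simp: perm_of_list_def)
qed

lemma prob_joint_greedy:
  "measure_pmf.prob (joint_law n p (greedy_algorithm n)) {(G, H, \<pi>). \<pi> \<in> S_set n p \<beta> G H} =
   1 - measure_pmf.prob (input_law n p)
     {(G, H). centered_overlap n p G H (perm_of_list (greedy_list n G H n)) < \<beta> * scale_D n p}"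
proof -
  let ?\<pi> = "\<lambda>G H. perm_of_list (greedy_list n G H n)"
  have "joint_law n p (greedy_algorithm n) = map_pmf (\<lambda>(G, H). (G, H, ?\<pi> G H)) (input_law n p)"
    by (simp add: joint_law_def greedy_algorithm_def map_pmf_def case_prod_unfold bind_return_pmf)
  moreover have "(\<lambda>(G, H). (G, H, ?\<pi> G H)) -` {(G, H, \<pi>). \<pi> \<in> S_set n p \<beta> G H} =
    UNIV - {(G, H). centered_overlap n p G H (?\<pi> G H) < \<beta> * scale_D n p}"
    using perm_of_list_permutes[OF greedy_list_partial_inj[OF order_refl]] by (auto simp: S_set_def not_less)
  ultimately show ?thesis
    using measure_pmf.prob_compl[of "{(G, H). centered_overlap n p G H (?\<pi> G H) < \<beta> * scale_D n p}" "input_law n p"]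
    by simp
qed

lemma prob_greedy_fails_input:
  assumes "greedy_regime n p \<delta>" "0 < y"
    and "\<beta> + y \<le> beta_c - 5 * \<delta> - 5 / real n - 1 / sqrt (sqrt (ln (real n))) - 8 * sqrt (p * ln (real n))"
  shows "measure_pmf.prob (input_law n p)
     {(G, H). centered_overlap n p G H (perm_of_list (greedy_list n G H n)) < \<beta> * scale_D n p}
    \<le> 4 ^ n * exp (- 2 * real n) + real n * real n * exp (- 2 * real n * p\<^sup>2)
      + (3 / 2 / sqrt (ln (real n)) + 2 * failure_bound n p \<delta>) / y"
proof -
  let ?X = "{(G, H). centered_overlap n p G H (perm_of_list (greedy_list n G H n)) < \<beta> * scale_D n p}"
  let ?bad = "{H. \<not> cut_lower p n H} \<union> {H. \<not> codegree_upper p n H}"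
  note r = regime_facts[OF assms(1)]
  have "measure_pmf.prob (pair_pmf (erdos_renyi n p) (erdos_renyi n p)) ?X \<le>
     measure_pmf.prob (erdos_renyi n p) ?bad + (3 / 2 / sqrt (ln (real n)) + 2 * failure_bound n p \<delta>) / y"
  proof (rule prob_pair_pmf_le)
    fix H assume H: "H \<in> set_pmf (erdos_renyi n p)" "H \<notin> ?bad"
    then have Hs: "H \<in> simple_graphs n" using set_erdos_renyi by blast
    have "partial_run (greedy_rule n) H p n = map_pmf (\<lambda>G. (G, greedy_list n G H n)) (erdos_renyi n p)"
      by (simp add: partial_run_def online_values_greedy map_pmf_def bind_return_pmf)
    then have "measure_pmf.prob (erdos_renyi n p) {G. (G, H) \<in> ?X} =
      measure_pmf.prob (partial_run (greedy_rule n) H p n) {(G, xs). centered_overlap n p G H (perm_of_list xs) < \<beta> * scale_D n p}"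
      by (simp add: vimage_def)
    also have "\<dots> \<le> (3 / 2 / sqrt (ln (real n)) + 2 * failure_bound n p \<delta>) / y"
      using H(2) by (intro prob_greedy_fails[OF assms(1) Hs _ _ assms(2,3)]) auto
    finally show "measure_pmf.prob (erdos_renyi n p) {G. (G, H) \<in> ?X} \<le> (3 / 2 / sqrt (ln (real n)) + 2 * failure_bound n p \<delta>) / y" .
  next
    show "0 \<le> (3 / 2 / sqrt (ln (real n)) + 2 * failure_bound n p \<delta>) / y"
      using failure_bound_nonneg[OF assms(1)] assms(2) r(15) by simp
  qed
  moreover have "measure_pmf.prob (erdos_renyi n p) ?bad \<le>
    measure_pmf.prob (erdos_renyi n p) {H. \<not> cut_lower p n H} + measure_pmf.prob (erdos_renyi n p) {H. \<not> codegree_upper p n H}"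
    by (rule measure_Un_le) auto
  moreover have "measure_pmf.prob (erdos_renyi n p) {H. \<not> cut_lower p n H} \<le> 4 ^ n * exp (- 2 * real n)"
    using r by (intro prob_not_cut_lower) auto
  moreover have "measure_pmf.prob (erdos_renyi n p) {H. \<not> codegree_upper p n H} \<le> real n * real n * exp (- 2 * real n * p\<^sup>2)"
    using r by (intro prob_not_codegree_upper) auto
  ultimately show ?thesis unfolding input_law_def by linarith
qed

section \<open>Limits in the dense regime and the conclusion\<close>

lemma ln_at_top_sequentially: "filterlim (\<lambda>n. ln (real n)) at_top sequentially"
  by (rule filterlim_compose[OF ln_at_top filterlim_real_sequentially])

lemma inverse_sqrt_ln_tendsto: "(\<lambda>n. c / sqrt (ln (real n))) \<longlonglongrightarrow> 0"
  by (intro tendsto_divide_0 filterlim_at_top_imp_at_infinity filterlim_compose[OF sqrt_at_top] ln_at_top_sequentially) auto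

context
  fixes p :: "nat \<Rightarrow> real"
  assumes dense: "dense_regime p" and small: "\<forall>\<^sub>F n in sequentially. p n \<le> 1 / ln (real n) ^ 4"
begin

text \<open>The bound on \<open>p\<close> enters here; it lets the correlation term
  \<open>32 * p * ln n / \<delta>\<close> of \<open>failure_bound\<close> and the degree loss
  \<open>8 * sqrt (p * ln n)\<close> vanish.\<close>

lemma p_ln_tendsto: "(\<lambda>n. p n * ln (real n)) \<longlonglongrightarrow> 0"
proof (rule tendsto_sandwich)
  show "\<forall>\<^sub>F n in sequentially. 0 \<le> p n * ln (real n)"
    using eventually_ge_at_top[of 1] by eventually_elim (use dense_regime_facts(1)[OF dense] in auto)
  show "\<forall>\<^sub>F n in sequentially. p n * ln (real n) \<le> 1 / ln (real n)"
    using small ln_at_top_sequentially[unfolded filterlim_at_top, rule_format, of 1]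
  proof eventually_elim
    case (elim n)
    then have "p n * ln (real n) \<le> 1 / ln (real n) ^ 4 * ln (real n)" by (intro mult_right_mono) auto
    also have "\<dots> = 1 / ln (real n) ^ 3" using elim by (simp add: power_def numeral_eq_Suc)
    also have "\<dots> \<le> 1 / ln (real n) ^ 1" using elim by (intro divide_left_mono power_increasing) auto
    finally show ?case by simp
  qed
  show "(\<lambda>n. 1 / ln (real n)) \<longlonglongrightarrow> 0"
    by (intro tendsto_divide_0 filterlim_at_top_imp_at_infinity ln_at_top_sequentially) auto
qed simp

lemma eventually_greedy_regime:
  assumes "0 < \<delta>" "\<delta> \<le> 1 / 12"
  shows "\<forall>\<^sub>F n in sequentially. greedy_regime n (p n) \<delta>"
proof -
  note d = dense_regime_facts[OF dense]
  have np: "\<forall>\<^sub>F n in sequentially. c \<le> real n * p n" for c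
    using d(6) by (simp add: filterlim_at_top)
  have T: "(\<lambda>n. sqrt (2 / \<delta>) * (sqrt (ln (real n) / real n) / p n)) \<longlonglongrightarrow> 0"
    using tendsto_mult[OF tendsto_const d(3), of "sqrt (2 / \<delta>)"] by simp
  have e1: "\<forall>\<^sub>F n in sequentially. p n < \<delta> / 3"
    using d(4) assms by (intro order_tendstoD(2)) auto
  have e2: "\<forall>\<^sub>F n in sequentially. sqrt (2 / \<delta>) * (sqrt (ln (real n) / real n) / p n) < \<delta> / 6"
    using T assms by (intro order_tendstoD(2)) auto
  have e3: "\<forall>\<^sub>F n in sequentially. 4 / (\<delta>\<^sup>2 * sqrt (real n * p n)) < \<delta> / 3"
  proof (rule order_tendstoD(2))
    have "(\<lambda>n. (4 / \<delta>\<^sup>2) / sqrt (real n * p n)) \<longlonglongrightarrow> 0"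
      by (intro tendsto_divide_0[OF tendsto_const] filterlim_at_top_imp_at_infinity filterlim_compose[OF sqrt_at_top] d(6))
    then show "(\<lambda>n. 4 / (\<delta>\<^sup>2 * sqrt (real n * p n))) \<longlonglongrightarrow> 0" by (simp add: mult.assoc)
  qed (use assms in simp)
  have e4: "\<forall>\<^sub>F n in sequentially. (1 + 1 / (\<delta> * (real n * p n))) * (exp (2 * (sqrt (2 / \<delta>) * (sqrt (ln (real n) / real n) / p n))) + 8 * p n) < 1 + \<delta> / 2"
  proof (rule order_tendstoD(2))
    have "(\<lambda>n. (1 / \<delta>) / (real n * p n)) \<longlonglongrightarrow> 0"
      by (intro tendsto_divide_0[OF tendsto_const] filterlim_at_top_imp_at_infinity d(6))
    then have "(\<lambda>n. 1 / (\<delta> * (real n * p n))) \<longlonglongrightarrow> 0" by simp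
    then have "(\<lambda>n. (1 + 1 / (\<delta> * (real n * p n))) * (exp (2 * (sqrt (2 / \<delta>) * (sqrt (ln (real n) / real n) / p n))) + 8 * p n))
       \<longlonglongrightarrow> (1 + 0) * (exp (2 * 0) + 8 * 0)"
      by (intro tendsto_intros T d(4))
    then show "(\<lambda>n. (1 + 1 / (\<delta> * (real n * p n))) * (exp (2 * (sqrt (2 / \<delta>) * (sqrt (ln (real n) / real n) / p n))) + 8 * p n)) \<longlonglongrightarrow> 1"
      by simp
  qed (use assms in simp)
  \<comment> \<open>\<open>sqrt (sqrt (ln n))\<close> has to outgrow the constant
    \<open>4 / \<delta> * sqrt (2 / \<delta>)\<close>, so that the window \<open>s\<close> costs at
    most \<open>\<delta> / 4 * ln n\<close> in the exponent.\<close>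
  have e5: "\<forall>\<^sub>F n in sequentially. (4 / \<delta> * sqrt (2 / \<delta>))\<^sup>2 \<le> sqrt (ln (real n))"
    using filterlim_compose[OF sqrt_at_top ln_at_top_sequentially] by (simp add: filterlim_at_top)
  have e6: "\<forall>\<^sub>F n in sequentially. 4 / sqrt (ln (real n)) < 1"
    using inverse_sqrt_ln_tendsto[of 4] by (intro order_tendstoD(2)) auto
  have e7: "\<forall>\<^sub>F n in sequentially. 1 \<le> ln (real n)"
    using ln_at_top_sequentially by (simp add: filterlim_at_top)
  show ?thesis
    using d(5) e1 np[of 4] np[of "1 / \<delta>"] e2 e3 e4 e5 e6 e7
  proof eventually_elim
    case (elim n)
    define L where "L = ln (real n)"
    have L: "1 \<le> L" using elim by (simp add: L_def)
    have "4 / \<delta> * sqrt (2 / \<delta>) \<le> sqrt (sqrt L)"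
      using elim(8) unfolding L_def by (rule real_le_rsqrt)
    then have "sqrt (2 / \<delta>) \<le> \<delta> / 4 * sqrt (sqrt L)" using assms by (simp add: field_simps)
    then have "sqrt (2 / \<delta>) * (sqrt L * sqrt (sqrt L)) \<le> \<delta> / 4 * sqrt (sqrt L) * (sqrt L * sqrt (sqrt L))"
      using L by (intro mult_right_mono) auto
    also have "\<dots> = \<delta> / 4 * ((sqrt (sqrt L) * sqrt (sqrt L)) * sqrt L)" by (simp only: mult_ac)
    also have "(sqrt (sqrt L) * sqrt (sqrt L)) * sqrt L = L" using L by simp
    finally have "sqrt (2 / \<delta>) * sqrt L * sqrt (sqrt L) \<le> \<delta> / 4 * L" by (simp add: mult.assoc)
    moreover have "1 \<le> \<delta> * (real n * p n)" using elim(4) assms by (simp add: divide_le_eq mult.commute)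
    ultimately show ?case using elim assms unfolding greedy_regime_def L_def by (intro conjI) linarith+
  qed
qed

lemma failure_bound_tendsto:
  assumes "0 < \<delta>"
  shows "(\<lambda>n. failure_bound n (p n) \<delta>) \<longlonglongrightarrow> 0"
proof -
  have "(\<lambda>n. 32 / \<delta> * (p n * ln (real n))) \<longlonglongrightarrow> 32 / \<delta> * 0"
    by (rule tendsto_mult[OF tendsto_const p_ln_tendsto])
  then have 1: "(\<lambda>n. 32 * p n * ln (real n) / \<delta>) \<longlonglongrightarrow> 0" by (simp add: mult.assoc)
  have "filterlim (\<lambda>n. \<delta> / 4 * ln (real n)) at_top sequentially"
    using assms by (intro filterlim_tendsto_pos_mult_at_top[OF tendsto_const _ ln_at_top_sequentially]) auto
  then have 2: "(\<lambda>n. exp (- (\<delta> / 4 * ln (real n)))) \<longlonglongrightarrow> 0"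
    by (intro filterlim_compose[OF exp_at_bot]) (simp add: filterlim_uminus_at_top)
  have "(\<lambda>n. failure_bound n (p n) \<delta>) \<longlonglongrightarrow> (exp 0 + 2 / \<delta> * 0) / (1 - 0)\<^sup>2 - 1"
    unfolding failure_bound_def by (intro tendsto_intros 1 2 inverse_sqrt_ln_tendsto) auto
  then show ?thesis by simp
qed

lemma greedy_succeeds_below_threshold:
  assumes "\<epsilon> > 0"
  shows "(\<lambda>n. measure_pmf.prob (joint_law n (p n) (greedy_algorithm n))
      {(G, H, \<pi>). \<pi> \<in> S_set n (p n) (beta_c - \<epsilon>) G H}) \<longlonglongrightarrow> 1"
proof -
  note d = dense_regime_facts[OF dense]
  \<comment> \<open>Of the margin \<open>\<epsilon>\<close>, a quarter pays for
    \<open>5 \<delta>\<close>, a quarter for the vanishing terms, and the half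
    \<open>y = \<epsilon> / 2\<close> is left for the random losses.\<close>
  define \<delta> where "\<delta> = min (1 / 12) (\<epsilon> / 20)"
  have \<delta>: "0 < \<delta>" "\<delta> \<le> 1 / 12" "5 * \<delta> \<le> \<epsilon> / 4" using assms by (auto simp: \<delta>_def)
  let ?fail = "\<lambda>n. measure_pmf.prob (input_law n (p n))
     {(G, H). centered_overlap n (p n) G H (perm_of_list (greedy_list n G H n)) < (beta_c - \<epsilon>) * scale_D n (p n)}"
  let ?b = "\<lambda>n. 4 ^ n * exp (- 2 * real n) + 1 / real n
      + (3 / 2 / sqrt (ln (real n)) + 2 * failure_bound n (p n) \<delta>) / (\<epsilon> / 2)"
  have "(\<lambda>n. 5 / real n + 1 / sqrt (sqrt (ln (real n))) + 8 * sqrt (p n * ln (real n))) \<longlonglongrightarrow> 0 + 0 + 8 * sqrt 0"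
  proof (intro tendsto_add tendsto_mult tendsto_const tendsto_real_sqrt p_ln_tendsto)
    show "(\<lambda>n. 5 / real n) \<longlonglongrightarrow> 0" by (rule lim_const_over_n)
    show "(\<lambda>n. 1 / sqrt (sqrt (ln (real n)))) \<longlonglongrightarrow> 0"
      by (intro tendsto_divide_0[OF tendsto_const] filterlim_at_top_imp_at_infinity filterlim_compose[OF sqrt_at_top] ln_at_top_sequentially)
  qed
  then have e1: "\<forall>\<^sub>F n in sequentially. 5 / real n + 1 / sqrt (sqrt (ln (real n))) + 8 * sqrt (p n * ln (real n)) < \<epsilon> / 4"
    using assms by (intro order_tendstoD(2)) auto
  have ev: "\<forall>\<^sub>F n in sequentially. ?fail n \<le> ?b n"
    \<comment> \<open>With the constant \<open>3 / 2\<close> the exponent \<open>2 * n * p^2\<close>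
      is at least \<open>3 * ln n\<close>, so the union bound over \<open>n^2\<close> pairs of
      vertices still leaves \<open>1 / n\<close>.\<close>
    using eventually_greedy_regime[OF \<delta>(1,2)] e1 d(7)[of "3 / 2"] eventually_ge_at_top[of 1]
  proof eventually_elim
    case (elim n)
    have "?fail n \<le> 4 ^ n * exp (- 2 * real n) + real n * real n * exp (- 2 * real n * (p n)\<^sup>2)
      + (3 / 2 / sqrt (ln (real n)) + 2 * failure_bound n (p n) \<delta>) / (\<epsilon> / 2)"
      using elim(2) \<delta>(3) assms by (intro prob_greedy_fails_input[OF elim(1)]) linarith+
    moreover have "real n * real n * exp (- 2 * real n * (p n)\<^sup>2) \<le> 1 / real n"
    proof -
      have "real n * real n * exp (- 2 * real n * (p n)\<^sup>2) \<le> real n * real n * exp (- (3 * ln (real n)))"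
        using elim(3) by (intro mult_left_mono) auto
      also have "exp (- (3 * ln (real n))) = inverse (real n ^ 3)"
        using elim(4) exp_of_nat_mult[of 3 "ln (real n)"] by (simp add: exp_minus)
      also have "real n * real n * inverse (real n ^ 3) = 1 / real n"
        using elim(4) by (simp add: power3_eq_cube field_simps)
      finally show ?thesis .
    qed
    ultimately show ?case by linarith
  qed
  have "(\<lambda>n. 4 ^ n * exp (- 2 * real n)) \<longlonglongrightarrow> (0::real)"
  proof -
    have "exp (- 2 * real n) = exp (-2) ^ n" for n by (simp add: exp_of_nat_mult[symmetric] mult.commute)
    then have "4 ^ n * exp (- 2 * real n) = (4 * exp (-2)) ^ n" for n by (simp add: power_mult_distrib)
    moreover have "4 * exp (-2) < (1::real)"
    proof -
      have "(2::real) < exp 1" using exp_less_cancel_iff[of "ln 2" "1::real"] ln_2_less_1 by simp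
      then have "2 * 2 < exp 1 * exp (1::real)" by (intro mult_strict_mono) auto
      then have "4 < exp (2::real)" by (simp add: exp_add[symmetric])
      then show ?thesis by (simp add: exp_minus field_simps)
    qed
    then have "(\<lambda>n. (4 * exp (-2::real)) ^ n) \<longlonglongrightarrow> 0" by (intro LIMSEQ_realpow_zero) auto
    ultimately show ?thesis by (simp only:)
  qed
  then have "?b \<longlonglongrightarrow> 0 + 0 + (0 + 2 * 0) / (\<epsilon> / 2)"
    by (rule tendsto_add[OF tendsto_add[OF _ lim_const_over_n] tendsto_divide[OF tendsto_add[OF inverse_sqrt_ln_tendsto
        tendsto_mult[OF tendsto_const failure_bound_tendsto[OF \<delta>(1)]]] tendsto_const]]) (use assms in simp)
  then have "?b \<longlonglongrightarrow> 0" by simp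
  then have "?fail \<longlonglongrightarrow> 0"
    by (intro tendsto_sandwich[OF _ ev tendsto_const]) auto
  then have "(\<lambda>n. 1 - ?fail n) \<longlonglongrightarrow> 1 - 0" by (intro tendsto_intros)
  then show ?thesis unfolding prob_joint_greedy by simp
qed

end

theorem theorem1p4:
  fixes \<epsilon> :: real
  assumes "\<epsilon> > 0"
  shows
    "(\<forall>p. dense_regime p \<and> (\<forall>\<^sub>F n in sequentially. p n \<le> 1 / ln (real n) ^ 4) \<longrightarrow>
        (\<exists>A :: nat \<Rightarrow> alignment_algorithm. \<exists>T :: nat \<Rightarrow> nat.
           (\<forall>n. online_algorithm n (A n)) \<and>
           runs_in_time A T \<and> (\<lambda>n. real (T n)) \<in> O(\<lambda>n. real n ^ 3) \<and>
           (\<lambda>n. measure_pmf.prob (joint_law n (p n) (A n))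
                  {(G, H, \<pi>). \<pi> \<in> S_set n (p n) (beta_c - \<epsilon>) G H}) \<longlonglongrightarrow> 1)) \<and>
     (\<exists>c>0. \<forall>p. dense_regime p \<longrightarrow>
        (\<forall>A :: nat \<Rightarrow> alignment_algorithm. (\<forall>n. online_algorithm n (A n)) \<longrightarrow>
           (\<lambda>n. measure_pmf.prob (input_law n (p n))
                  {(G, H). measure_pmf.prob (A n G H) (S_set n (p n) (beta_c + \<epsilon>) G H)
                             \<ge> exp (- (c * real n * ln (real n)))}) \<longlonglongrightarrow> 0))"
proof (intro conjI allI impI)
  fix p assume "dense_regime p \<and> (\<forall>\<^sub>F n in sequentially. p n \<le> 1 / ln (real n) ^ 4)"
  then have p: "dense_regime p" "\<forall>\<^sub>F n in sequentially. p n \<le> 1 / ln (real n) ^ 4" by auto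
  show "\<exists>A :: nat \<Rightarrow> alignment_algorithm. \<exists>T :: nat \<Rightarrow> nat. (\<forall>n. online_algorithm n (A n)) \<and>
       runs_in_time A T \<and> (\<lambda>n. real (T n)) \<in> O(\<lambda>n. real n ^ 3) \<and>
       (\<lambda>n. measure_pmf.prob (joint_law n (p n) (A n))
          {(G, H, \<pi>). \<pi> \<in> S_set n (p n) (beta_c - \<epsilon>) G H}) \<longlonglongrightarrow> 1"
    using online_greedy_algorithm runs_in_time_greedy greedy_time_bigo greedy_succeeds_below_threshold[OF p assms]
    by blast
next
  show "\<exists>c>0. \<forall>p. dense_regime p \<longrightarrow> (\<forall>A :: nat \<Rightarrow> alignment_algorithm. (\<forall>n. online_algorithm n (A n)) \<longrightarrow>
       (\<lambda>n. measure_pmf.prob (input_law n (p n))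
          {(G, H). measure_pmf.prob (A n G H) (S_set n (p n) (beta_c + \<epsilon>) G H)
             \<ge> exp (- (c * real n * ln (real n)))}) \<longlonglongrightarrow> 0)"
    using online_algorithms_fail_above_threshold[OF assms] assms
    by (intro exI[of _ "\<epsilon> / 4"]) simp
qed

end
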